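(* Let $\mathcal G$ be a metric graph whose completion $\overline{\mathcal G}$ is compact and weakly connected, and let $w\in\mathcal G_{int}$ be a vertex of $\mathcal G$. Then the function $\nu_w$ on clopen subsets of $\partial\overline{\mathcal G}$ (defined in the context) extends to a nonnegative Radon measure on $\partial\overline{\mathcal G}$, with $\nu_w(S)>0$ for every nonempty clopen set $S\subset\partial\overline{\mathcal G}$.
   Context: A metric graph $\mathcal G$ is a connected, locally finite (every vertex has finite degree) graph with countable vertex set and edge set, in which each edge $e$ is assigned a length $l_e$ with $0<l_e<\infty$ and is identified with a real interval $[a_e,b_e]$ of length $l_e$. The distance $d(x_1,x_2)$ between points of $\mathcal G$ is the infimum of the lengths of paths joining them. $\overline{\mathcal G}$ denotes the completion of $(\mathcal G,d)$. $\partial\mathcal G$ is the set of vertices of degree $1$; $\mathcal G_{int}=\mathcal G\setminus\partial\mathcal G$; and $\partial\overline{\mathcal G}=\overline{\mathcal G}\setminus\mathcal G_{int}$. Clopen means open and closed in $\partial\overline{\mathcal G}$. $\overline{\mathcal G}$ is weakly connected if for every pair of distinct points $x,y\in\overline{\mathcal G}$ there is a finite set $W$ of points of $\mathcal G$ and disjoint open sets $U,V\subset\overline{\mathcal G}$ with $x\in U$, $y\in V$ and $\overline{\mathcal G}\setminus W=U\cup V$. For an edge $e$ incident on a vertex $v$ (written $e\sim v$), $\partial_\nu f_e(v)$ denotes the derivative of $f$ at $v$ along $e$ when $v$ is identified with $b_e$. $\mathcal A$ is the algebra of "eventually flat" functions: functions $\phi:\overline{\mathcal G}\to\mathbb R$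 that are continuous, infinitely differentiable on the open edges of $\mathcal G$, with $\phi'=0$ in the complement of a finite collection of edges and in an open neighborhood of each vertex $v\in\mathcal G$. Definition of $\nu_w$: the vertex $w$ is treated as an added boundary vertex, the new boundary being $\partial\overline{\mathcal G}\cup\{w\}$. Let $f$ be the harmonic extension to $\overline{\mathcal G}$ of the function $1_{\{w\}}$ on $\partial\overline{\mathcal G}\cup\{w\}$, i.e. the unique continuous $f:\overline{\mathcal G}\to\mathbb R$ with $f(w)=1$, $f=0$ on $\partial\overline{\mathcal G}$, $f$ linear on each edge, and $\sum_{e\sim v}\partial_\nu f_e(v)=0$ at each vertex $v\in\mathcal G_{int}$ with $v\ne w$. For a clopen set $E\subset\partial\overline{\mathcal G}$, take $\phi\in\mathcal A$ with $\phi=1$ in an open neighborhood of $E$ and $\phi=0$ in an open neighborhood of $(\partial\overline{\mathcal G}\cup\{w\})\setminus E$; then $$\nu_w(E)=\int_{\mathcal G}f\phi''.$$ (The value does not depend on the choice of $\phi$.) *)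

theory Defs
  imports "HOL-Analysis.Analysis" "Graph_Theory.Digraph_Component"
begin

text \<open>
  The combinatorial graph is a multigraph given by a \<^typ>\<open>('v, 'e) pre_digraph\<close>; the direction of an
  arc \<open>e\<close> only records the identification of the edge with the interval \<open>[0, len e]\<close>, with
  \<open>tail G e\<close> at \<open>0\<close> and \<open>head G e\<close> at \<open>len e\<close>. Loops and parallel edges are allowed.
  Note that \<open>Digraph_Component.connected\<close> ignores the directions of the arcs.
\<close>

locale metric_graph = wf_digraph G for G :: "('v, 'e) pre_digraph" +
  fixes len :: "'e \<Rightarrow> real"
  assumes countable_verts: "countable (verts G)"
    and countable_arcs: "countable (arcs G)"
    and graph_connected: "Digraph_Component.connected G"
    and locally_finite: "v \<in> verts G \<Longrightarrow> finite (in_arcs G v) \<and> finite (out_arcs G v)"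
    and len_pos: "e \<in> arcs G \<Longrightarrow> 0 < len e"

text \<open>A loop contributes 2 to the degree.\<close>

definition degree :: "('v, 'e) pre_digraph \<Rightarrow> 'v \<Rightarrow> nat" where
  "degree G v = in_degree G v + out_degree G v"

datatype ('v, 'e) gpoint = Vertex 'v | Inner 'e real

definition edge_point :: "('v, 'e) pre_digraph \<Rightarrow> ('e \<Rightarrow> real) \<Rightarrow> 'e \<Rightarrow> real \<Rightarrow> ('v, 'e) gpoint" where
  "edge_point G len e t =
     (if t \<le> 0 then Vertex (tail G e) else if t \<ge> len e then Vertex (head G e) else Inner e t)"

definition graph_points :: "('v, 'e) pre_digraph \<Rightarrow> ('e \<Rightarrow> real) \<Rightarrow> ('v, 'e) gpoint set" where
  "graph_points G len = Vertex ` verts G \<union> {Inner e t | e t. e \<in> arcs G \<and> 0 < t \<and> t < len e}"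

text \<open>
  \<open>gpath G len p q L\<close>: there is a path of length \<open>L\<close> from \<open>p\<close> to \<open>q\<close>, composed of finitely many
  segments, each running inside a single closed edge.
\<close>

inductive gpath :: "('v, 'e) pre_digraph \<Rightarrow> ('e \<Rightarrow> real) \<Rightarrow> ('v, 'e) gpoint \<Rightarrow> ('v, 'e) gpoint \<Rightarrow> real \<Rightarrow> bool"
  for G :: "('v, 'e) pre_digraph" and len :: "'e \<Rightarrow> real" where
  gpath_refl: "p \<in> graph_points G len \<Longrightarrow> gpath G len p p 0"
| gpath_step: "gpath G len p (edge_point G len e s) L \<Longrightarrow> e \<in> arcs G \<Longrightarrow>
    s \<in> {0..len e} \<Longrightarrow> t \<in> {0..len e} \<Longrightarrow> gpath G len p (edge_point G len e t) (L + \<bar>t - s\<bar>)"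

definition gdist :: "('v, 'e) pre_digraph \<Rightarrow> ('e \<Rightarrow> real) \<Rightarrow> ('v, 'e) gpoint \<Rightarrow> ('v, 'e) gpoint \<Rightarrow> real" where
  "gdist G len p q = Inf {L. gpath G len p q L}"

text \<open>
  The completion is characterised, as usual up to isometry, as a complete metric space \<open>X\<close>
  (a subset of a metric space type) with an isometric embedding \<open>\<iota>\<close> of the graph with dense image.
  Everything below is relative to such a pair.
\<close>

definition is_completion ::
  "('v, 'e) pre_digraph \<Rightarrow> ('e \<Rightarrow> real) \<Rightarrow> 'x::metric_space set \<Rightarrow> (('v, 'e) gpoint \<Rightarrow> 'x) \<Rightarrow> bool" where
  "is_completion G len X \<iota> \<longleftrightarrow>
     complete X \<and> \<iota> ` graph_points G len \<subseteq> X \<and> X \<subseteq> closure (\<iota> ` graph_points G len) \<and>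
     (\<forall>p\<in>graph_points G len. \<forall>q\<in>graph_points G len. dist (\<iota> p) (\<iota> q) = gdist G len p q)"

definition weakly_connected ::
  "('v, 'e) pre_digraph \<Rightarrow> ('e \<Rightarrow> real) \<Rightarrow> 'x::metric_space set \<Rightarrow> (('v, 'e) gpoint \<Rightarrow> 'x) \<Rightarrow> bool" where
  "weakly_connected G len X \<iota> \<longleftrightarrow>
     (\<forall>x\<in>X. \<forall>y\<in>X. x \<noteq> y \<longrightarrow>
       (\<exists>W U V. finite W \<and> W \<subseteq> \<iota> ` graph_points G len \<and>
          openin (top_of_set X) U \<and> openin (top_of_set X) V \<and> U \<inter> V = {} \<and>
          x \<in> U \<and> y \<in> V \<and> X - W = U \<union> V))"

definition graph_boundary :: "('v, 'e) pre_digraph \<Rightarrow> ('v, 'e) gpoint set" where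
  "graph_boundary G = Vertex ` {v \<in> verts G. degree G v = 1}"

definition graph_interior :: "('v, 'e) pre_digraph \<Rightarrow> ('e \<Rightarrow> real) \<Rightarrow> ('v, 'e) gpoint set" where
  "graph_interior G len = graph_points G len - graph_boundary G"

definition completion_boundary ::
  "('v, 'e) pre_digraph \<Rightarrow> ('e \<Rightarrow> real) \<Rightarrow> 'x set \<Rightarrow> (('v, 'e) gpoint \<Rightarrow> 'x) \<Rightarrow> 'x set" where
  "completion_boundary G len X \<iota> = X - \<iota> ` graph_interior G len"

definition clopen_in :: "'x::topological_space set \<Rightarrow> 'x set \<Rightarrow> bool" where
  "clopen_in B S \<longleftrightarrow> openin (top_of_set B) S \<and> closedin (top_of_set B) S"

definition on_edge ::
  "('v, 'e) pre_digraph \<Rightarrow> ('e \<Rightarrow> real) \<Rightarrow> (('v, 'e) gpoint \<Rightarrow> 'x) \<Rightarrow> ('x \<Rightarrow> real) \<Rightarrow> 'e \<Rightarrow> real \<Rightarrow> real" where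
  "on_edge G len \<iota> f e t = f (\<iota> (edge_point G len e t))"

text \<open>
  The sum over the edges \<open>e \<sim> v\<close> of the derivative of \<open>f\<close> at \<open>v\<close> along \<open>e\<close> directed towards \<open>v\<close>.
  Identifying the tail of \<open>e\<close> with the right end of the interval reverses the parametrisation,
  hence the sign in the second sum. A loop contributes one term for each of its ends.
\<close>

definition vertex_flux ::
  "('v, 'e) pre_digraph \<Rightarrow> ('e \<Rightarrow> real) \<Rightarrow> (('v, 'e) gpoint \<Rightarrow> 'x) \<Rightarrow> ('x \<Rightarrow> real) \<Rightarrow> 'v \<Rightarrow> real" where
  "vertex_flux G len \<iota> f v =
     (\<Sum>e\<in>in_arcs G v. vector_derivative (on_edge G len \<iota> f e) (at (len e) within {0..len e}))
     + (\<Sum>e\<in>out_arcs G v. - vector_derivative (on_edge G len \<iota> f e) (at 0 within {0..len e}))"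

definition is_harmonic_extension ::
  "('v, 'e) pre_digraph \<Rightarrow> ('e \<Rightarrow> real) \<Rightarrow> 'x::metric_space set \<Rightarrow> (('v, 'e) gpoint \<Rightarrow> 'x) \<Rightarrow> 'v \<Rightarrow> ('x \<Rightarrow> real) \<Rightarrow> bool" where
  "is_harmonic_extension G len X \<iota> w f \<longleftrightarrow>
     continuous_on X f \<and> f (\<iota> (Vertex w)) = 1 \<and>
     (\<forall>x\<in>completion_boundary G len X \<iota>. f x = 0) \<and>
     (\<forall>e\<in>arcs G. \<exists>a b. \<forall>t\<in>{0..len e}. on_edge G len \<iota> f e t = a * t + b) \<and>
     (\<forall>v\<in>verts G. Vertex v \<in> graph_interior G len \<and> v \<noteq> w \<longrightarrow> vertex_flux G len \<iota> f v = 0)"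

text \<open>Extensionality makes the function on \<open>X\<close> unique as a total HOL function.\<close>

definition harmonic_extension ::
  "('v, 'e) pre_digraph \<Rightarrow> ('e \<Rightarrow> real) \<Rightarrow> 'x::metric_space set \<Rightarrow> (('v, 'e) gpoint \<Rightarrow> 'x) \<Rightarrow> 'v \<Rightarrow> 'x \<Rightarrow> real" where
  "harmonic_extension G len X \<iota> w =
     (THE f. f \<in> extensional X \<and> is_harmonic_extension G len X \<iota> w f)"

text \<open>
  In the last condition, the derivative is only required to vanish at the points of the
  neighbourhood that lie on open edges; the derivative is not defined elsewhere in \<open>X\<close>.
\<close>

definition eventually_flat ::
  "('v, 'e) pre_digraph \<Rightarrow> ('e \<Rightarrow> real) \<Rightarrow> 'x::metric_space set \<Rightarrow> (('v, 'e) gpoint \<Rightarrow> 'x) \<Rightarrow> ('x \<Rightarrow> real) set" where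
  "eventually_flat G len X \<iota> = {\<phi>.
     continuous_on X \<phi> \<and>
     (\<forall>e\<in>arcs G. \<forall>t\<in>{0<..<len e}. \<forall>n. (deriv ^^ n) (on_edge G len \<iota> \<phi> e) differentiable (at t)) \<and>
     (\<exists>F. finite F \<and> F \<subseteq> arcs G \<and>
        (\<forall>e\<in>arcs G - F. \<forall>t\<in>{0<..<len e}. deriv (on_edge G len \<iota> \<phi> e) t = 0)) \<and>
     (\<forall>v\<in>verts G. \<exists>U. openin (top_of_set X) U \<and> \<iota> (Vertex v) \<in> U \<and>
        (\<forall>e\<in>arcs G. \<forall>t\<in>{0<..<len e}.
           \<iota> (edge_point G len e t) \<in> U \<longrightarrow> deriv (on_edge G len \<iota> \<phi> e) t = 0))}"

definition is_cutoff ::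
  "('v, 'e) pre_digraph \<Rightarrow> ('e \<Rightarrow> real) \<Rightarrow> 'x::metric_space set \<Rightarrow> (('v, 'e) gpoint \<Rightarrow> 'x) \<Rightarrow> 'v \<Rightarrow> 'x set \<Rightarrow> ('x \<Rightarrow> real) \<Rightarrow> bool" where
  "is_cutoff G len X \<iota> w E \<phi> \<longleftrightarrow>
     \<phi> \<in> eventually_flat G len X \<iota> \<and>
     (\<exists>U. openin (top_of_set X) U \<and> E \<subseteq> U \<and> (\<forall>x\<in>U. \<phi> x = 1)) \<and>
     (\<exists>U. openin (top_of_set X) U \<and>
        (completion_boundary G len X \<iota> \<union> {\<iota> (Vertex w)}) - E \<subseteq> U \<and> (\<forall>x\<in>U. \<phi> x = 0))"

text \<open>
  The integral of \<open>f \<phi>''\<close> over the graph: \<open>\<phi>''\<close> is computed in the coordinate of each edge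
  (it does not depend on the orientation), and vertices form a null set.
\<close>

definition integral_second_deriv ::
  "('v, 'e) pre_digraph \<Rightarrow> ('e \<Rightarrow> real) \<Rightarrow> (('v, 'e) gpoint \<Rightarrow> 'x) \<Rightarrow> ('x \<Rightarrow> real) \<Rightarrow> ('x \<Rightarrow> real) \<Rightarrow> real" where
  "integral_second_deriv G len \<iota> f \<phi> =
     (\<Sum>\<^sub>\<infinity>e\<in>arcs G. integral {0..len e}
        (\<lambda>t. on_edge G len \<iota> f e t * (deriv ^^ 2) (on_edge G len \<iota> \<phi> e) t))"

text \<open>The description operator expresses that the value is the same for all choices of \<open>\<phi>\<close>.\<close>

definition nu ::
  "('v, 'e) pre_digraph \<Rightarrow> ('e \<Rightarrow> real) \<Rightarrow> 'x::metric_space set \<Rightarrow> (('v, 'e) gpoint \<Rightarrow> 'x) \<Rightarrow> 'v \<Rightarrow> 'x set \<Rightarrow> real" where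
  "nu G len X \<iota> w E =
     (THE c. \<exists>\<phi>. is_cutoff G len X \<iota> w E \<phi> \<and>
        c = integral_second_deriv G len \<iota> (harmonic_extension G len X \<iota> w) \<phi>)"

definition radon_measure_on :: "'x::metric_space set \<Rightarrow> 'x measure \<Rightarrow> bool" where
  "radon_measure_on B \<mu> \<longleftrightarrow>
     sets \<mu> = sets (restrict_space borel B) \<and>
     (\<forall>K. K \<subseteq> B \<and> compact K \<longrightarrow> emeasure \<mu> K < \<infinity>) \<and>
     (\<forall>A\<in>sets \<mu>. emeasure \<mu> A = (SUP K\<in>{K. K \<subseteq> A \<and> compact K}. emeasure \<mu> K)) \<and>
     (\<forall>A\<in>sets \<mu>. emeasure \<mu> A = (INF U\<in>{U. A \<subseteq> U \<and> openin (top_of_set B) U}. emeasure \<mu> U))"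

end

theory Submission
  imports Defs
begin

text \<open>
  The harmonic extension \<open>f\<close> is constructed by Perron's method on the vertices. Finitely supported
  subsolutions have slope at most the conductance of \<open>w\<close> on every edge (compare the flux through a
  superlevel set with the flux out of \<open>w\<close>), so their supremum is Lipschitz for the path metric,
  extends to the completion, and vanishes on the boundary; the maximum principle gives uniqueness.

  Integrating by parts on each edge turns \<open>\<integral> f \<phi>''\<close> into a finite sum that depends only on the
  values of \<open>\<phi>\<close> at the vertices and does not change when finitely many values at interior vertices
  other than \<open>w\<close> are changed. Replacing the level set of \<open>\<phi>\<close> near \<open>E\<close> by its part on which \<open>f\<close> is
  small, all terms of the sum become nonnegative, and one is positive if \<open>E\<close> is nonempty.

  Weak connectedness and compactness provide the functions \<open>\<phi>\<close> and make the boundary totally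
  disconnected, so the finitely additive function on clopen sets extends by Caratheodory's theorem.
\<close>

section \<open>Smooth step functions\<close>

text \<open>The obstacle is the set of completion points outside the graph: no edge ends there, so
  no vertex condition can be imposed. They are reached only through two facts. The graph is dense,
  so a uniform slope bound passes to the completion. A finite union of closed edges is compact, so
  it stays away from such a point; this is why the Perron family is finitely supported: each member
  vanishes near the point, at a rate of decay common to all members, and Green's formula for it is a
  finite sum. Vertices accumulate only at such points, so a compact set inside the graph contains
  finitely many of them. Hence two cutoffs, or a cut set and its part of small \<open>h\<close>,
  differ at finitely many vertices where \<open>h\<close> is harmonic, and Green's formula shows
  that the flux is the same. Strict positivity rests on \<open>h\<close> being positive at every
  interior vertex: the level that counts as small is a minimum of \<open>h\<close> over finitely
  many of them. Countable additivity needs no estimate, because clopen subsets of the compact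
  boundary are compact.\<close>

definition smooth :: "(real \<Rightarrow> real) \<Rightarrow> bool" where
  "smooth f \<longleftrightarrow> (\<forall>n x. (deriv ^^ n) f differentiable (at x))"

text \<open>If a family is stable under taking derivatives, \<open>deriv\<close> of a member is
  again a member, and induction on \<open>n\<close> keeps every \<open>(deriv ^^ n) f\<close> in the
  family. No formula for higher derivatives is ever needed.\<close>

lemma smoothI_class:
  assumes "f \<in> C" and "\<And>g. g \<in> C \<Longrightarrow> \<exists>g'\<in>C. \<forall>x. (g has_real_derivative g' x) (at x)"
  shows "smooth f"
proof -
  have step: "deriv g \<in> C" "\<And>x. g differentiable (at x)" if gC: "g \<in> C" for g
  proof -
    obtain g' where g': "g' \<in> C" "\<And>x. (g has_real_derivative g' x) (at x)"
      using assms(2)[OF gC] by blast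
    then have "deriv g = g'" by (intro ext DERIV_imp_deriv)
    with g' show "deriv g \<in> C" by simp
    show "g differentiable (at x)" for x
      using g'(2) real_differentiable_def by blast
  qed
  have "(deriv ^^ n) f \<in> C" for n
    by (induction n) (simp_all add: assms(1) step(1))
  then show ?thesis using step(2) unfolding smooth_def by blast
qed

lemma smooth_deriv: "smooth f \<Longrightarrow> smooth (deriv f)"
proof -
  assume "smooth f"
  then have "(deriv ^^ Suc n) f differentiable (at x)" for n x unfolding smooth_def by blast
  then show ?thesis by (simp only: smooth_def funpow_Suc_right comp_apply) simp
qed

lemma smooth_has_deriv:
  assumes "smooth f" shows "(f has_real_derivative deriv f x) (at x)"
proof -
  have "(deriv ^^ 0) f differentiable (at x)" using assms unfolding smooth_def by blast
  then show ?thesis by (simp add: DERIV_deriv_iff_real_differentiable)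
qed

lemma smooth_continuous: "smooth f \<Longrightarrow> continuous_on S f"
  by (rule DERIV_continuous_on[OF has_field_derivative_at_within[OF smooth_has_deriv]])

lemma smooth_const: "smooth (\<lambda>_. c)"
  by (rule smoothI_class[of _ "range (\<lambda>c _. c)"]) (auto intro!: derivative_eq_intros)

text \<open>The product rule leads from products to sums of products, so this family is stable under
  derivatives; it replaces the general Leibniz formula.\<close>

inductive_set mult_closure :: "(real \<Rightarrow> real) set" where
  base: "smooth f \<Longrightarrow> smooth g \<Longrightarrow> (\<lambda>x. f x * g x) \<in> mult_closure"
| add: "f \<in> mult_closure \<Longrightarrow> g \<in> mult_closure \<Longrightarrow> (\<lambda>x. f x + g x) \<in> mult_closure"

lemma smooth_mult_closure: "f \<in> mult_closure \<Longrightarrow> smooth f"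
proof (rule smoothI_class)
  fix g assume "g \<in> mult_closure"
  then show "\<exists>g'\<in>mult_closure. \<forall>x. (g has_real_derivative g' x) (at x)"
  proof induction
    case (base f g)
    show ?case
    proof (rule bexI[of _ "\<lambda>x. deriv f x * g x + f x * deriv g x"], rule allI)
      fix x
      show "((\<lambda>x. f x * g x) has_real_derivative deriv f x * g x + f x * deriv g x) (at x)"
        using DERIV_mult'[OF smooth_has_deriv[OF base(1)] smooth_has_deriv[OF base(2)], of x]
        by (simp add: add.commute)
    qed (rule mult_closure.intros smooth_deriv base)+
  next
    case (add f g)
    then obtain f' g' where "f' \<in> mult_closure" "\<And>x. (f has_real_derivative f' x) (at x)"
      "g' \<in> mult_closure" "\<And>x. (g has_real_derivative g' x) (at x)" by blast
    then show ?case
      by (intro bexI[of _ "\<lambda>x. f' x + g' x"] allI DERIV_add mult_closure.add)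
  qed
qed

lemma smooth_mult: "smooth f \<Longrightarrow> smooth g \<Longrightarrow> smooth (\<lambda>x. f x * g x)"
  using smooth_mult_closure mult_closure.base by blast

lemma smooth_add:
  assumes "smooth f" "smooth g" shows "smooth (\<lambda>x. f x + g x)"
proof -
  have "(\<lambda>x. f x * (\<lambda>_. 1) x + g x * (\<lambda>_. 1) x) \<in> mult_closure"
    using assms by (intro mult_closure.intros smooth_const)
  then show ?thesis using smooth_mult_closure by simp
qed

lemma smooth_affine_comp:
  assumes "smooth f" shows "smooth (\<lambda>x. f (a * x + b))"
proof (rule smoothI_class[of _ "{\<lambda>x. c * g (a * x + b) | c g. smooth g}"])
  show "(\<lambda>x. f (a * x + b)) \<in> {\<lambda>x. c * g (a * x + b) | c g. smooth g}"
    using assms by (intro CollectI exI[of _ 1] exI[of _ f]) auto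
next
  fix h assume "h \<in> {\<lambda>x. c * g (a * x + b) | c g. smooth g}"
  then obtain c g where h: "h = (\<lambda>x. c * g (a * x + b))" and g: "smooth g" by blast
  have "(h has_real_derivative (c * a) * deriv g (a * x + b)) (at x)" for x
  proof -
    have "((\<lambda>x. a * x + b) has_real_derivative a) (at x)" by (auto intro!: derivative_eq_intros)
    from DERIV_cmult[OF DERIV_chain2[OF smooth_has_deriv[OF g] this], where c = c]
    show ?thesis unfolding h by (simp only: mult.assoc mult.commute[of a])
  qed
  then show "\<exists>h'\<in>{\<lambda>x. c * g (a * x + b) | c g. smooth g}. \<forall>x. (h has_real_derivative h' x) (at x)"
    using smooth_deriv[OF g] by (intro bexI[of _ "\<lambda>x. (c * a) * deriv g (a * x + b)"]) auto
qed

lemma smooth_antiderivative: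
  assumes "smooth g" "\<And>x. (f has_real_derivative g x) (at x)"
  shows "smooth f"
proof (rule smoothI_class[of _ "insert f (Collect smooth)"])
  fix h assume "h \<in> insert f (Collect smooth)"
  then show "\<exists>h'\<in>insert f (Collect smooth). \<forall>x. (h has_real_derivative h' x) (at x)"
  proof
    assume "h = f"
    then show ?thesis using assms by (intro bexI[of _ g]) auto
  next
    assume "h \<in> Collect smooth"
    then show ?thesis using smooth_has_deriv smooth_deriv by (intro bexI[of _ "deriv h"]) auto
  qed
qed simp

text \<open>All derivatives of the standard flat function exp(-1/x) are of the form p(1/x)
  exp(-1/x), continued by 0, so the range of \<open>flat_exp\<close> is stable under
  derivatives.\<close>

definition flat_exp :: "real poly \<Rightarrow> real \<Rightarrow> real" where
  "flat_exp p x = (if x > 0 then poly p (inverse x) * exp (- inverse x) else 0)"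

lemma poly_exp_decay: "((\<lambda>y. poly p y * exp (- y)) \<longlongrightarrow> 0) (at_top :: real filter)"
proof (induction p)
  case 0
  then show ?case by simp
next
  case (pCons a p)
  have *: "((\<lambda>y. y ^ k * exp (- y)) \<longlongrightarrow> 0) (at_top :: real filter)" for k :: nat
    using tendsto_power_div_exp_0[of k] by (simp add: exp_minus divide_inverse)
  have "((\<lambda>y. poly q y * exp (- y)) \<longlongrightarrow> 0) (at_top :: real filter)" for q :: "real poly"
  proof -
    have "((\<lambda>y. \<Sum>i\<le>Polynomial.degree q. coeff q i * (y ^ i * exp (- y))) \<longlongrightarrow> (\<Sum>i\<le>Polynomial.degree q. coeff q i * 0))
        (at_top :: real filter)"
      by (intro tendsto_intros *)
    then show ?thesis by (simp add: poly_altdef sum_distrib_right mult.assoc)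
  qed
  then show ?case .
qed

lemma flat_exp_has_deriv:
  "(flat_exp p has_real_derivative flat_exp (monom 1 2 * (p - pderiv p)) x) (at x)"
proof -
  consider "x > 0" | "x < 0" | "x = 0" by linarith
  then show ?thesis
  proof cases
    case 1
    have "((\<lambda>x. poly p (inverse x) * exp (- inverse x)) has_real_derivative
        flat_exp (monom 1 2 * (p - pderiv p)) x) (at x)"
      using 1 by (auto intro!: derivative_eq_intros DERIV_chain2[OF poly_DERIV]
          simp: flat_exp_def poly_monom field_simps power2_eq_square)
    then show ?thesis
      by (rule has_field_derivative_transform_within_open[of _ _ _ "{0<..}"])
        (use 1 in \<open>auto simp: flat_exp_def\<close>)
  next
    case 2
    have "((\<lambda>_. 0) has_real_derivative flat_exp (monom 1 2 * (p - pderiv p)) x) (at x)"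
      using 2 by (auto simp: flat_exp_def)
    then show ?thesis
      by (rule has_field_derivative_transform_within_open[of _ _ _ "{..<0}"])
        (use 2 in \<open>auto simp: flat_exp_def\<close>)
  next
    case 3
    \<comment> \<open>In the difference quotient at 0, the division by h multiplies the polynomial
      in 1/h by its variable, hence \<open>pCons 0 p\<close>.\<close>
    have "((\<lambda>h. poly (pCons 0 p) (inverse h) * exp (- inverse h)) \<longlongrightarrow> 0) (at_right 0)"
      using poly_exp_decay filterlim_inverse_at_top_right by (rule filterlim_compose)
    then have "((\<lambda>h. flat_exp p h / h) \<longlongrightarrow> 0) (at_right 0)"
      by (rule Lim_transform_eventually)
        (auto simp: eventually_at_right_less flat_exp_def field_simps
          intro!: eventually_mono[OF eventually_at_right_less[of 0]])
    moreover have "((\<lambda>h. flat_exp p h / h) \<longlongrightarrow> 0) (at_left 0)"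
      by (rule Lim_transform_eventually[OF tendsto_const[of 0]])
        (auto simp: flat_exp_def intro!: eventually_mono[OF eventually_at_left_real[of "-1" 0]])
    ultimately have "((\<lambda>h. flat_exp p h / h) \<longlongrightarrow> 0) (at 0)"
      by (simp add: filterlim_split_at)
    then show ?thesis using 3 by (simp add: DERIV_def flat_exp_def)
  qed
qed

lemma smooth_flat_exp: "smooth (flat_exp p)"
  by (rule smoothI_class[of _ "range flat_exp"]) (auto intro!: flat_exp_has_deriv)

text \<open>A normalised antiderivative of a bump supported between 1/3 and 2/3. The flat outer
  thirds will give vanishing derivatives near vertices; the Lipschitz bound is what lets smoothed
  functions extend to the completion.\<close>

lemma smooth_step_exists:
  obtains \<sigma> L where "smooth \<sigma>" "\<And>t. t \<le> 1/3 \<Longrightarrow> \<sigma> t = 0" "\<And>t. t \<ge> 2/3 \<Longrightarrow> \<sigma> t = 1"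
    "0 \<le> L" "\<And>s t. \<bar>\<sigma> s - \<sigma> t\<bar> \<le> L * \<bar>s - t\<bar>"
proof -
  define h where "h = (\<lambda>x. flat_exp 1 (1 * x + (-1/3)) * flat_exp 1 ((-1) * x + 2/3))"
  have sm: "smooth h"
    unfolding h_def by (intro smooth_mult smooth_affine_comp smooth_flat_exp)
  have cont: "continuous_on S h" for S by (rule smooth_continuous[OF sm])
  have h0: "h x = 0" if "x \<le> 1/3 \<or> 2/3 \<le> x" for x using that by (auto simp: h_def flat_exp_def)
  have hpos: "h x > 0" if "1/3 < x" "x < 2/3" for x using that by (auto simp: h_def flat_exp_def)
  have hnn: "h x \<ge> 0" for x using h0[of x] hpos[of x] by force
  obtain g where g0: "\<And>x. (g has_real_derivative h x) (at x)"
  proof -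
    have "\<exists>g. \<forall>x. (g has_real_derivative h x) (at x)"
    proof -
      \<comment> \<open>\<open>h\<close> vanishes up to 1/3, so the integral from 0, continued by 0,
        is already a global antiderivative.\<close>
      define g where "g x = (if x \<ge> 0 then integral {0..x} h else 0)" for x
      have "(g has_real_derivative h x) (at x)" for x
      proof (cases "x > 0")
        case True
        have "((\<lambda>u. integral {0..u} h) has_real_derivative h x) (at x within {0..x+1})"
          using True by (intro integral_has_real_derivative cont) auto
        then have "((\<lambda>u. integral {0..u} h) has_real_derivative h x) (at x)"
          using True by (simp add: at_within_Icc_at)
        then show ?thesis
          by (rule has_field_derivative_transform_within_open[of _ _ _ "{0<..}"])
            (use True in \<open>auto simp: g_def\<close>)
      next
        case False
        have "g y = 0" if "y < 1/3" for y
        proof -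
          have "integral {0..y} h = integral {0..y} (\<lambda>_. 0)"
            using that by (intro integral_cong) (auto simp: h0)
          then show ?thesis by (simp add: g_def)
        qed
        moreover have "((\<lambda>_. 0) has_real_derivative h x) (at x)" using h0[of x] False by auto
        ultimately show ?thesis
          using has_field_derivative_transform_within_open[of "\<lambda>_. 0" "h x" x "{..<1/3}" g] False by auto
      qed
      then show ?thesis by blast
    qed
    then show ?thesis using that by blast
  qed
  have const: "g x = g y" if "\<And>z. x \<le> z \<Longrightarrow> z \<le> y \<Longrightarrow> h z = 0" "x \<le> y" for x y
  proof -
    have "\<exists>z\<ge>x. z \<le> y \<and> g y - g x = (y - x) * h z" if "x < y"
      using MVT2[OF that g0] less_imp_le by metis
    then show ?thesis using that by (cases "x = y") force+
  qed
  have lt: "g (1/3) < g (2/3)"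
  proof -
    have "\<exists>z>1/3. z < 2/3 \<and> g (2/3) - g (1/3) = (2/3 - 1/3) * h z"
      by (rule MVT2[OF _ g0]) simp
    then obtain z where "z > 1/3" "z < 2/3" "g (2/3) - g (1/3) = (2/3 - 1/3) * h z" by blast
    with hpos[of z] show ?thesis by (auto simp: field_simps)
  qed
  define D where "D = g (2/3) - g (1/3)"
  have D: "D > 0" using lt by (simp add: D_def)
  have "compact (h ` {0..1})" by (intro compact_continuous_image cont) simp
  then have "bounded (h ` {0..1})" by (rule compact_imp_bounded)
  then obtain M where M: "\<And>x. x \<in> {0..1} \<Longrightarrow> \<bar>h x\<bar> \<le> M"
    unfolding bounded_iff real_norm_def by blast
  have M': "\<bar>h x\<bar> \<le> M" for x
    using M[of x] M[of 0] h0[of x] by (cases "x \<in> {0..1}") force+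
  then have Mnn: "M \<ge> 0" using abs_ge_zero order_trans by blast
  define \<sigma> where "\<sigma> t = (g t - g (1/3)) / D" for t
  have der: "(\<sigma> has_real_derivative (inverse D * h t)) (at t)" for t
    unfolding \<sigma>_def using D by (auto intro!: derivative_eq_intros g0 simp: field_simps)
  show thesis
  proof
    show "smooth \<sigma>"
      by (rule smooth_antiderivative[OF _ der]) (intro smooth_mult smooth_const sm)
    show "\<sigma> t = 0" if "t \<le> 1/3" for t
      using const[of t "1/3"] h0 that by (simp add: \<sigma>_def)
    show "\<sigma> t = 1" if "t \<ge> 2/3" for t
      using const[of "2/3" t] h0 that D by (simp add: \<sigma>_def D_def)
    show "0 \<le> M / D" using Mnn D by simp
    have *: "\<bar>\<sigma> s - \<sigma> t\<bar> \<le> M / D * \<bar>s - t\<bar>" if lt: "s < t" for s t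
    proof -
      obtain z where z: "\<sigma> t - \<sigma> s = (t - s) * (inverse D * h z)"
        using MVT2[OF lt der] by blast
      have "\<bar>\<sigma> s - \<sigma> t\<bar> = \<bar>(t - s) * (inverse D * h z)\<bar>"
        unfolding z[symmetric] by (rule abs_minus_commute)
      also have "\<dots> = \<bar>h z\<bar> / D * \<bar>s - t\<bar>"
        using D by (simp add: abs_mult abs_minus_commute[of s] divide_inverse)
      also have "\<dots> \<le> M / D * \<bar>s - t\<bar>"
        using M' D by (intro mult_right_mono divide_right_mono) auto
      finally show ?thesis .
    qed
    show "\<bar>\<sigma> s - \<sigma> t\<bar> \<le> M / D * \<bar>s - t\<bar>" for s t
      using *[of s t] *[of t s] by (cases s t rule: linorder_cases) (auto simp: abs_minus_commute)
  qed
qed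

section \<open>Radon measures on compact totally disconnected spaces\<close>

text \<open>The two-stage compactness argument: finite intersections of separators pass from a point
  to \<open>D\<close>, finite unions from a point to \<open>C\<close>. Open neighbourhoods accompany
  each separator because members of the family need not be open; the lemma is applied to clopen sets
  and to \<open>cuts\<close>.\<close>

lemma compact_separation:
  fixes C D X :: "'a::topological_space set"
  assumes "compact C" "compact D" and empty: "{} \<in> \<A>" and whole: "X \<in> \<A>"
    and Un: "\<And>A B. A \<in> \<A> \<Longrightarrow> B \<in> \<A> \<Longrightarrow> A \<union> B \<in> \<A>"
    and Int: "\<And>A B. A \<in> \<A> \<Longrightarrow> B \<in> \<A> \<Longrightarrow> A \<inter> B \<in> \<A>"
    and sep: "\<And>x y. x \<in> C \<Longrightarrow> y \<in> D \<Longrightarrow>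
      \<exists>A\<in>\<A>. \<exists>U V. open U \<and> open V \<and> x \<in> U \<and> y \<in> V \<and> U \<inter> X \<subseteq> A \<and> V \<inter> X \<inter> A = {}"
  shows "\<exists>A\<in>\<A>. \<exists>U V. open U \<and> open V \<and> C \<subseteq> U \<and> D \<subseteq> V \<and> U \<inter> X \<subseteq> A \<and> V \<inter> X \<inter> A = {}"
proof -
  define P where "P U V \<longleftrightarrow> open U \<and> open V \<and> (\<exists>A\<in>\<A>. U \<inter> X \<subseteq> A \<and> V \<inter> X \<inter> A = {})" for U V
  have PI: "P U V" if "A \<in> \<A>" "open U" "open V" "U \<inter> X \<subseteq> A" "V \<inter> X \<inter> A = {}" for A U V
    unfolding P_def by (intro conjI bexI[of _ A] that)
  have P_open: "open U" "open V" if "P U V" for U V using that unfolding P_def by simp_all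
  have P_cap: "P (\<Inter>i\<in>I. U i) (\<Union>i\<in>I. V i)" if "finite I" "\<And>i. i \<in> I \<Longrightarrow> P (U i) (V i)"
    for I :: "'a set" and U V
    using that
  proof (induction I)
    case empty
    have "\<exists>A\<in>\<A>. UNIV \<inter> X \<subseteq> A \<and> {} \<inter> X \<inter> A = {}" using whole by blast
    then show ?case by (simp add: P_def)
  next
    case (insert i I)
    then have "P (U i) (V i)" "P (\<Inter>i\<in>I. U i) (\<Union>i\<in>I. V i)" by simp_all
    then obtain A B where "A \<in> \<A>" "B \<in> \<A>" "U i \<inter> X \<subseteq> A" "V i \<inter> X \<inter> A = {}"
      "(\<Inter>i\<in>I. U i) \<inter> X \<subseteq> B" "(\<Union>i\<in>I. V i) \<inter> X \<inter> B = {}"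
      and op: "open (U i)" "open (V i)" "open (\<Inter>i\<in>I. U i)" "open (\<Union>i\<in>I. V i)" unfolding P_def by blast
    then have "A \<inter> B \<in> \<A>" "(\<Inter>i\<in>insert i I. U i) \<inter> X \<subseteq> A \<inter> B"
      "(\<Union>i\<in>insert i I. V i) \<inter> X \<inter> (A \<inter> B) = {}" using Int by auto
    moreover have "open (\<Inter>i\<in>insert i I. U i)" "open (\<Union>i\<in>insert i I. V i)"
      using op by (simp_all only: INT_insert UN_insert open_Int open_Un)
    ultimately show ?case unfolding P_def by blast
  qed
  have P_cup: "P (\<Union>i\<in>I. U i) (\<Inter>i\<in>I. V i)" if "finite I" "\<And>i. i \<in> I \<Longrightarrow> P (U i) (V i)"
    for I :: "'a set" and U V
    using that
  proof (induction I)
    case empty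
    have "\<exists>A\<in>\<A>. {} \<inter> X \<subseteq> A \<and> UNIV \<inter> X \<inter> A = {}" using assms(3) by blast
    then show ?case by (simp add: P_def)
  next
    case (insert i I)
    then have "P (U i) (V i)" "P (\<Union>i\<in>I. U i) (\<Inter>i\<in>I. V i)" by simp_all
    then obtain A B where "A \<in> \<A>" "B \<in> \<A>" "U i \<inter> X \<subseteq> A" "V i \<inter> X \<inter> A = {}"
      "(\<Union>i\<in>I. U i) \<inter> X \<subseteq> B" "(\<Inter>i\<in>I. V i) \<inter> X \<inter> B = {}"
      and op: "open (U i)" "open (V i)" "open (\<Union>i\<in>I. U i)" "open (\<Inter>i\<in>I. V i)" unfolding P_def by blast
    then have "A \<union> B \<in> \<A>" "(\<Union>i\<in>insert i I. U i) \<inter> X \<subseteq> A \<union> B"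
      "(\<Inter>i\<in>insert i I. V i) \<inter> X \<inter> (A \<union> B) = {}" using Un by auto
    moreover have "open (\<Union>i\<in>insert i I. U i)" "open (\<Inter>i\<in>insert i I. V i)"
      using op by (simp_all only: INT_insert UN_insert open_Int open_Un)
    ultimately show ?case unfolding P_def by blast
  qed
  have "\<exists>U V. x \<in> U \<and> D \<subseteq> V \<and> P U V" if x: "x \<in> C" for x
  proof -
    have "\<exists>U V. x \<in> U \<and> y \<in> V \<and> P U V" if y: "y \<in> D" for y
    proof -
      obtain A U V where "A \<in> \<A>" "open U" "open V" "x \<in> U" "y \<in> V" "U \<inter> X \<subseteq> A" "V \<inter> X \<inter> A = {}"
        using sep[OF x y] by blast
      then have "x \<in> U \<and> y \<in> V \<and> P U V" using PI by simp
      then show ?thesis by (intro exI)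
    qed
    then obtain U V where UV: "\<And>y. y \<in> D \<Longrightarrow> x \<in> U y \<and> y \<in> V y \<and> P (U y) (V y)" by metis
    then have "\<And>y. y \<in> D \<Longrightarrow> open (V y)" "D \<subseteq> (\<Union>y\<in>D. V y)" using P_open by blast+
    then obtain I where I: "I \<subseteq> D" "finite I" "D \<subseteq> (\<Union>y\<in>I. V y)"
      using compactE_image[OF assms(2)] by metis
    have "P (\<Inter>i\<in>I. U i) (\<Union>i\<in>I. V i)" using I UV by (intro P_cap) blast+
    moreover have "x \<in> (\<Inter>i\<in>I. U i)" using I UV by blast
    moreover have "D \<subseteq> (\<Union>i\<in>I. V i)" by (rule I(3))
    ultimately show ?thesis by (intro exI conjI)
  qed
  then obtain U V where UV: "\<And>x. x \<in> C \<Longrightarrow> x \<in> U x \<and> D \<subseteq> V x \<and> P (U x) (V x)" by metis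
  then have "\<And>x. x \<in> C \<Longrightarrow> open (U x)" "C \<subseteq> (\<Union>x\<in>C. U x)" using P_open by blast+
  then obtain I where I: "I \<subseteq> C" "finite I" "C \<subseteq> (\<Union>x\<in>I. U x)"
    using compactE_image[OF assms(1)] by metis
  have "P (\<Union>i\<in>I. U i) (\<Inter>i\<in>I. V i)" using I UV by (intro P_cup) blast+
  moreover have D: "D \<subseteq> (\<Inter>i\<in>I. V i)" using I UV by blast
  ultimately obtain A where "A \<in> \<A>" "(\<Union>i\<in>I. U i) \<inter> X \<subseteq> A" "(\<Inter>i\<in>I. V i) \<inter> X \<inter> A = {}"
      "open (\<Union>i\<in>I. U i)" "open (\<Inter>i\<in>I. V i)" unfolding P_def by blast
  then show ?thesis using I(3) D by (intro bexI[of _ A] exI conjI)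
qed

text \<open>\<open>C n\<close> keeps distance at least 1/(n+1) from \<open>B - U\<close>. An empty
  \<open>B - U\<close> is treated separately because \<open>infdist\<close> to the empty set is
  0.\<close>

lemma compact_inner_open_union:
  fixes B :: "'x::metric_space set"
  assumes "compact B" "open U"
  obtains C where "\<And>n::nat. compact (C n)" "U \<inter> B = (\<Union>n. C n)"
proof (cases "B - U = {}")
  case True
  then show thesis using assms that[of "\<lambda>_. B"] by blast
next
  case False
  define C where "C n = B \<inter> {x. infdist x (B - U) \<ge> 1 / real (Suc n)}" for n
  have "compact (C n)" for n
  proof -
    have "closed {x. infdist x (B - U) \<ge> 1 / real (Suc n)}"
      by (intro closed_Collect_le continuous_intros)
    then show ?thesis unfolding C_def using assms(1) by (rule compact_Int_closed[rotated])
  qed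
  moreover have "U \<inter> B = (\<Union>n. C n)"
  proof (intro equalityI subsetI)
    fix x assume x: "x \<in> U \<inter> B"
    have "compact (B - U)" using assms by (rule compact_diff)
    then have "closed (B - U)" by (rule compact_imp_closed)
    then have "0 < infdist x (B - U)" using x False infdist_pos_not_in_closed by blast
    then obtain n where "inverse (real (Suc n)) < infdist x (B - U)" using reals_Archimedean by blast
    then show "x \<in> (\<Union>n. C n)" using x by (auto simp: C_def inverse_eq_divide intro!: exI[of _ n])
  next
    fix x assume "x \<in> (\<Union>n. C n)"
    then obtain n where n: "x \<in> B" "infdist x (B - U) \<ge> 1 / real (Suc n)" by (auto simp: C_def)
    have "x \<in> U"
    proof (rule ccontr)
      assume "x \<notin> U"
      then have "infdist x (B - U) = 0" using n by simp
      moreover have "1 / real (Suc n) > 0" by simp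
      ultimately show False using n(2) by linarith
    qed
    with n show "x \<in> U \<inter> B" by blast
  qed
  ultimately show thesis by (rule that)
qed

text \<open>Regularity of finite Borel measures: the sets that can be enclosed between a compact and
  a relatively open set with a gap of arbitrarily small measure include the closed sets and form a
  sigma-algebra.\<close>

lemma radon_measure_on_compact:
  fixes B :: "'x::metric_space set"
  assumes B: "compact B" and sets: "sets M = sets (restrict_space borel B)" and fin: "emeasure M B \<noteq> \<infinity>"
  shows "radon_measure_on B M"
proof -
  have space: "space M = B" using sets_eq_imp_space_eq[OF sets] by (simp add: space_restrict_space)
  interpret finite_measure M using fin space by (intro finite_measureI) simp
  have clB: "closed B" using B by (rule compact_imp_closed)
  have setsI: "A \<in> sets M" if "A \<subseteq> B" "A \<in> sets borel" for A
    using that by (auto simp: sets sets_restrict_space)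
  have cpt: "K \<in> sets M" if "K \<subseteq> B" "compact K" for K
    using that by (intro setsI borel_compact)
  have opn: "U \<in> sets M" if op: "openin (top_of_set B) U" for U
  proof -
    obtain T where "open T" "U = B \<inter> T" using op by (auto simp: openin_open)
    then show ?thesis by (auto simp: sets sets_restrict_space)
  qed
  define P where "P C \<longleftrightarrow> (\<forall>e>0. \<exists>K U. compact K \<and> K \<subseteq> C \<and> C \<subseteq> U \<and> openin (top_of_set B) U \<and>
    measure M (U - K) < e)" for C
  have PD: "\<exists>K U. compact K \<and> K \<subseteq> C \<and> C \<subseteq> U \<and> openin (top_of_set B) U \<and> measure M (U - K) < e"
    if "P C" "e > 0" for C e using that unfolding P_def by blast
  have UB: "U \<subseteq> B" if "openin (top_of_set B) U" for U using openin_imp_subset[OF that] .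
  have approx: "P (B \<inter> A)" if "A \<in> sets borel" for A
  proof -
    have "A \<in> sigma_sets UNIV (Collect closed)" using that by (simp add: borel_eq_closed)
    then show ?thesis
    proof induction
      case (Basic C)
      then have C: "closed C" by simp
      show ?case
      proof (cases "B \<inter> C = {}")
        case True
        show ?thesis unfolding P_def True by (intro allI impI exI[of _ "{}"]) simp
      next
        case False
        \<comment> \<open>The closed set is the decreasing limit of open collars, so continuity from
          above makes the gap small.\<close>
        define U where "U n = B \<inter> {x. infdist x (B \<inter> C) < 1 / real (Suc n)}" for n
        have opU: "openin (top_of_set B) (U n)" for n
        proof -
          have "open {x. infdist x (B \<inter> C) < 1 / real (Suc n)}"
            by (intro open_Collect_less continuous_intros)
          then show ?thesis unfolding U_def by (rule openin_open_Int)
        qed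
        have dec: "decseq U"
        proof (rule decseq_SucI)
          fix n
          have "1 / real (Suc (Suc n)) \<le> 1 / real (Suc n)" by (simp add: field_simps)
          then show "U (Suc n) \<subseteq> U n" unfolding U_def by force
        qed
        have inter: "(\<Inter>n. U n) = B \<inter> C"
        proof (intro equalityI subsetI)
          fix x assume x: "x \<in> (\<Inter>n. U n)"
          have "infdist x (B \<inter> C) = 0"
          proof (rule ccontr)
            assume "infdist x (B \<inter> C) \<noteq> 0"
            then have "infdist x (B \<inter> C) > 0" using infdist_nonneg[of x "B \<inter> C"] by linarith
            then obtain n where n: "inverse (real (Suc n)) < infdist x (B \<inter> C)"
              using reals_Archimedean by blast
            have "x \<in> U n" using x by blast
            with n show False by (auto simp: U_def inverse_eq_divide)
          qed
          moreover have "closed (B \<inter> C)" using clB C by (rule closed_Int)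
          ultimately show "x \<in> B \<inter> C" using False in_closed_iff_infdist_zero by blast
        qed (auto simp: U_def)
        have BC: "B \<inter> C \<in> sets M" using C by (intro setsI) (auto intro!: borel_closed clB)
        have lim: "(\<lambda>n. measure M (U n)) \<longlonglongrightarrow> measure M (B \<inter> C)"
          using finite_Lim_measure_decseq[of U] dec opU opn inter by auto
        show ?thesis unfolding P_def
        proof (intro allI impI)
          fix e :: real assume "e > 0"
          then obtain n where n: "measure M (U n) < measure M (B \<inter> C) + e"
            using order_tendstoD(2)[OF lim, of "measure M (B \<inter> C) + e"] by (auto simp: eventually_sequentially)
          have sub: "B \<inter> C \<subseteq> U n" using inter by blast
          have "measure M (U n - B \<inter> C) < e"
            using finite_measure_Diff[OF opn[OF opU[of n]] BC sub] n by linarith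
          moreover have "compact (B \<inter> C)" using B C by (rule compact_Int_closed)
          ultimately show "\<exists>K U. compact K \<and> K \<subseteq> B \<inter> C \<and> B \<inter> C \<subseteq> U \<and> openin (top_of_set B) U \<and>
              measure M (U - K) < e" using opU sub by blast
        qed
      qed
    next
      case Empty
      show ?case unfolding P_def by (intro allI impI exI[of _ "{}"]) simp
    next
      case (Compl A)
      show ?case unfolding P_def
      proof (intro allI impI)
        fix e :: real assume e: "e > 0"
        obtain K U where KU: "compact K" "K \<subseteq> B \<inter> A" "B \<inter> A \<subseteq> U" "openin (top_of_set B) U"
          "measure M (U - K) < e" using PD[OF Compl.IH e] by blast
        obtain T where T: "open T" "U = B \<inter> T" using KU(4) by (auto simp: openin_open)
        have "compact (B - U)"
        proof -
          have "B - U = B - T" using T by blast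
          then show ?thesis using compact_diff[OF B T(1)] by simp
        qed
        moreover have "openin (top_of_set B) (B - K)"
          unfolding Diff_eq using compact_imp_closed[OF KU(1)] by (intro openin_open_Int open_Compl)
        \<comment> \<open>Complementation exchanges inner and outer approximation and preserves the
          gap.\<close>
        moreover have "(B - K) - (B - U) = U - K" using UB[OF KU(4)] by blast
        ultimately show "\<exists>K U. compact K \<and> K \<subseteq> B \<inter> (UNIV - A) \<and> B \<inter> (UNIV - A) \<subseteq> U \<and>
            openin (top_of_set B) U \<and> measure M (U - K) < e"
          using KU by (intro exI[of _ "B - U"] exI[of _ "B - K"]) auto
      qed
    next
      case (Union A)
      show ?case unfolding P_def
      proof (intro allI impI)
        fix e :: real assume e: "e > 0"
        \<comment> \<open>These gaps sum to \<open>e / 2\<close>. The other half pays for replacing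
          the union of the \<open>K i\<close>, which need not be compact, by a finite
          subunion.\<close>
        have "\<exists>K U. compact K \<and> K \<subseteq> B \<inter> A i \<and> B \<inter> A i \<subseteq> U \<and> openin (top_of_set B) U \<and>
            measure M (U - K) < e / 4 * (1/2) ^ i" for i
          using PD[OF Union.IH[of i], of "e / 4 * (1/2) ^ i"] e by simp
        then obtain K U where KU: "\<And>i. compact (K i)" "\<And>i. K i \<subseteq> B \<inter> A i" "\<And>i. B \<inter> A i \<subseteq> U i"
          "\<And>i. openin (top_of_set B) (U i)" "\<And>i. measure M (U i - K i) < e / 4 * (1/2) ^ i" by metis
        have KM: "K i \<in> sets M" for i using KU(1,2) by (intro cpt) auto
        have UM: "U i \<in> sets M" for i using KU(4) opn by blast
        let ?U = "\<Union>i. U i" and ?L = "\<Union>i. K i" and ?F = "\<lambda>n. \<Union>i<n. K i"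
        have sm: "summable (\<lambda>i. e / 4 * (1/2) ^ i)" by (intro summable_mult summable_geometric) simp
        have s1: "summable (\<lambda>i. measure M (U i - K i))"
          by (rule summable_comparison_test'[OF sm, of 0]) (use KU(5) less_imp_le in auto)
        have "measure M (\<Union>i. U i - K i) \<le> (\<Sum>i. measure M (U i - K i))"
          using KM UM by (intro finite_measure_subadditive_countably s1) auto
        also have "\<dots> \<le> (\<Sum>i. e / 4 * (1/2) ^ i)"
          using KU(5) by (intro suminf_le s1 sm) (auto intro: less_imp_le)
        also have "\<dots> = e / 2"
          using suminf_mult[OF summable_geometric[of "1/2::real"], of "e/4"] suminf_geometric[of "1/2::real"] by simp
        finally have 1: "measure M (\<Union>i. U i - K i) \<le> e / 2" .
        have "(\<lambda>n. measure M (?F n)) \<longlonglongrightarrow> measure M (\<Union>n. ?F n)"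
        proof (rule finite_Lim_measure_incseq)
          show "range ?F \<subseteq> sets M" using KM by auto
          show "incseq ?F" unfolding incseq_def by (intro allI impI UN_mono) auto
        qed
        also have "(\<Union>n. ?F n) = ?L" by blast
        finally have "eventually (\<lambda>n. measure M (?F n) > measure M ?L - e / 2) sequentially"
          using e by (intro order_tendstoD(1)) auto
        then obtain n where n: "measure M (?F n) > measure M ?L - e / 2"
          using eventually_sequentially by auto
        have "measure M (?L - ?F n) = measure M ?L - measure M (?F n)"
          using KM by (intro finite_measure_Diff) auto
        then have 2: "measure M (?L - ?F n) < e / 2" using n by linarith
        have "measure M (?U - ?F n) \<le> measure M ((\<Union>i. U i - K i) \<union> (?L - ?F n))"
          using KM UM by (intro finite_measure_mono) auto
        also have "\<dots> \<le> measure M (\<Union>i. U i - K i) + measure M (?L - ?F n)"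
          using KM UM by (intro measure_Un_le) auto
        finally have "measure M (?U - ?F n) < e" using 1 2 by linarith
        moreover have "compact (?F n)" using KU(1) by (intro compact_UN) auto
        moreover have "openin (top_of_set B) ?U" using KU(4) by (intro openin_Union) auto
        moreover have "?F n \<subseteq> B \<inter> (\<Union>i. A i)" "B \<inter> (\<Union>i. A i) \<subseteq> ?U" using KU(2,3) by blast+
        ultimately show "\<exists>K U. compact K \<and> K \<subseteq> B \<inter> \<Union> (range A) \<and> B \<inter> \<Union> (range A) \<subseteq> U \<and>
            openin (top_of_set B) U \<and> measure M (U - K) < e" by blast
      qed
    qed
  qed
  have PM: "P A" if "A \<in> sets M" for A using that approx by (auto simp: sets sets_restrict_space)
  have mono_U: "measure M U \<le> measure M K + e"
    if "compact K" "K \<subseteq> U" "openin (top_of_set B) U" "measure M (U - K) < e" for K U e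
  proof -
    have "K \<in> sets M" using that UB by (intro cpt) auto
    then show ?thesis using finite_measure_Diff[OF opn[OF that(3)] _ that(2)] that(4) by linarith
  qed
  show ?thesis unfolding radon_measure_on_def
  proof (intro conjI allI impI ballI sets)
    show "emeasure M K < \<infinity>" for K by (simp add: emeasure_eq_measure)
  next
    fix A assume A: "A \<in> sets M"
    show "emeasure M A = (SUP K\<in>{K. K \<subseteq> A \<and> compact K}. emeasure M K)"
    proof (rule antisym)
      show "emeasure M A \<le> (SUP K\<in>{K. K \<subseteq> A \<and> compact K}. emeasure M K)"
      proof (rule ennreal_le_epsilon)
        fix e :: real assume e: "0 < e"
        obtain K U where KU: "compact K" "K \<subseteq> A" "A \<subseteq> U" "openin (top_of_set B) U" "measure M (U - K) < e"
          using PD[OF PM[OF A] e] by blast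
        have "measure M A \<le> measure M U" using KU opn by (intro finite_measure_mono)
        also have "\<dots> \<le> measure M K + e" using KU by (intro mono_U) auto
        finally have "emeasure M A \<le> emeasure M K + ennreal e"
          using e by (simp add: emeasure_eq_measure flip: ennreal_plus)
        also have "\<dots> \<le> (SUP K\<in>{K. K \<subseteq> A \<and> compact K}. emeasure M K) + ennreal e"
          using KU by (intro add_right_mono SUP_upper) auto
        finally show "emeasure M A \<le> (SUP K\<in>{K. K \<subseteq> A \<and> compact K}. emeasure M K) + ennreal e" .
      qed
      show "(SUP K\<in>{K. K \<subseteq> A \<and> compact K}. emeasure M K) \<le> emeasure M A"
        using A by (intro SUP_least emeasure_mono) auto
    qed
    show "emeasure M A = (INF U\<in>{U. A \<subseteq> U \<and> openin (top_of_set B) U}. emeasure M U)"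
    proof (rule antisym)
      show "emeasure M A \<le> (INF U\<in>{U. A \<subseteq> U \<and> openin (top_of_set B) U}. emeasure M U)"
        using opn by (intro INF_greatest emeasure_mono) auto
      show "(INF U\<in>{U. A \<subseteq> U \<and> openin (top_of_set B) U}. emeasure M U) \<le> emeasure M A"
      proof (rule ennreal_le_epsilon)
        fix e :: real assume e: "0 < e"
        obtain K U where KU: "compact K" "K \<subseteq> A" "A \<subseteq> U" "openin (top_of_set B) U" "measure M (U - K) < e"
          using PD[OF PM[OF A] e] by blast
        have "(INF U\<in>{U. A \<subseteq> U \<and> openin (top_of_set B) U}. emeasure M U) \<le> emeasure M U"
          using KU by (intro INF_lower) auto
        also have "measure M U \<le> measure M K + e" using KU by (intro mono_U) auto
        then have "emeasure M U \<le> emeasure M K + ennreal e"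
          using e by (simp add: emeasure_eq_measure flip: ennreal_plus)
        also have "\<dots> \<le> emeasure M A + ennreal e"
          using KU A by (intro add_right_mono emeasure_mono) auto
        finally show "(INF U\<in>{U. A \<subseteq> U \<and> openin (top_of_set B) U}. emeasure M U) \<le> emeasure M A + ennreal e" .
      qed
    qed
  qed
qed

section \<open>Clopen subsets and the extension theorem\<close>

lemma clopen_in_subset: "clopen_in B S \<Longrightarrow> S \<subseteq> B"
  by (auto simp: clopen_in_def dest: openin_imp_subset)

lemma clopen_in_empty: "clopen_in B {}" and clopen_in_self: "clopen_in B B"
  by (auto simp: clopen_in_def)

lemma clopen_in_Un: "clopen_in B S \<Longrightarrow> clopen_in B T \<Longrightarrow> clopen_in B (S \<union> T)"
  and clopen_in_Int: "clopen_in B S \<Longrightarrow> clopen_in B T \<Longrightarrow> clopen_in B (S \<inter> T)"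
  and clopen_in_Diff: "clopen_in B S \<Longrightarrow> clopen_in B T \<Longrightarrow> clopen_in B (S - T)"
  by (auto simp: clopen_in_def openin_diff closedin_diff)

text \<open>On an algebra of compact clopen sets, finite additivity already implies continuity at
  the empty set, the condition in Caratheodory's theorem. The separation hypothesis makes the clopen
  sets generate the Borel sets.\<close>

lemma radon_extension:
  fixes B :: "'x::metric_space set" and m :: "'x set \<Rightarrow> real"
  assumes B: "compact B"
    and sep: "\<And>x y. x \<in> B \<Longrightarrow> y \<in> B \<Longrightarrow> x \<noteq> y \<Longrightarrow> \<exists>S. clopen_in B S \<and> x \<in> S \<and> y \<notin> S"
    and nonneg: "\<And>S. clopen_in B S \<Longrightarrow> 0 \<le> m S"
    and add: "\<And>S T. clopen_in B S \<Longrightarrow> clopen_in B T \<Longrightarrow> S \<inter> T = {} \<Longrightarrow> m (S \<union> T) = m S + m T"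
  shows "\<exists>\<mu>. radon_measure_on B \<mu> \<and> (\<forall>S. clopen_in B S \<longrightarrow> emeasure \<mu> S = ennreal (m S))"
proof -
  let ?C = "Collect (clopen_in B)"
  have clB: "closed B" using B by (rule compact_imp_closed)
  have rep: "\<exists>T. open T \<and> S = B \<inter> T" if "clopen_in B S" for S
    using that by (auto simp: clopen_in_def openin_open)
  have cpt: "compact S" if "clopen_in B S" for S
    using that B closedin_compact by (auto simp: clopen_in_def)
  interpret ring_of_sets B ?C
    by (rule ring_of_setsI) (auto dest: clopen_in_subset simp: clopen_in_empty clopen_in_Un clopen_in_Diff)
  have m0: "m {} = 0" using add[OF clopen_in_empty clopen_in_empty] by simp
  have "\<exists>\<mu>. (\<forall>S\<in>?C. \<mu> S = ennreal (m S)) \<and> measure_space B (sigma_sets B ?C) \<mu>"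
  proof (rule caratheodory_empty_continuous)
    show "positive ?C (\<lambda>S. ennreal (m S))" by (simp add: positive_def m0)
    show "additive ?C (\<lambda>S. ennreal (m S))"
      unfolding additive_def using add nonneg by (auto simp: ennreal_plus)
  next
    fix A :: "nat \<Rightarrow> 'x set"
    assume A: "range A \<subseteq> ?C" "decseq A" "(\<Inter>i. A i) = {}"
    \<comment> \<open>By the finite intersection property, a decreasing sequence of compact sets
      with empty intersection reaches the empty set.\<close>
    have "\<exists>n. A n = {}"
    proof (rule ccontr)
      assume "\<nexists>n. A n = {}"
      then have ne: "A n \<noteq> {}" for n by blast
      have "A 0 \<inter> (\<Inter>i\<in>UNIV. A i) \<noteq> {}"
      proof (rule compact_imp_fip_image)
        show "compact (A 0)" "closed (A i)" for i using A(1) cpt compact_imp_closed by blast+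
        fix I :: "nat set" assume "finite I"
        let ?k = "Max (insert 0 I)"
        have "A ?k \<subseteq> A i" if "i \<in> insert 0 I" for i
          using \<open>finite I\<close> that by (intro decseqD[OF A(2)] Max_ge) auto
        then show "A 0 \<inter> (\<Inter>i\<in>I. A i) \<noteq> {}" using ne[of ?k] by blast
      qed
      with A(3) show False by simp
    qed
    then obtain n where "A n = {}" ..
    then have "A k = {}" if "k \<ge> n" for k using decseqD[OF A(2) that] by simp
    then have "eventually (\<lambda>k. 0 = ennreal (m (A k))) sequentially"
      unfolding eventually_sequentially by (intro exI[of _ n]) (simp add: m0)
    then show "(\<lambda>i. ennreal (m (A i))) \<longlonglongrightarrow> 0" by (rule Lim_transform_eventually[OF tendsto_const])
  qed simp
  then obtain \<mu> where \<mu>: "\<And>S. clopen_in B S \<Longrightarrow> \<mu> S = ennreal (m S)" "measure_space B (sigma_sets B ?C) \<mu>"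
    by auto
  define M where "M = measure_of B ?C \<mu>"
  have sub: "?C \<subseteq> Pow B" using space_closed .
  have setsM: "sets M = sigma_sets B ?C"
    unfolding M_def using sub by (rule sets_measure_of)
  have em: "emeasure M S = ennreal (m S)" if "clopen_in B S" for S
  proof -
    have "emeasure M S = \<mu> S"
      using \<mu>(2) that by (intro emeasure_measure_of[OF M_def sub]) (auto simp: measure_space_def setsM)
    then show ?thesis using \<mu>(1)[OF that] by simp
  qed
  have opens: "B \<inter> U \<in> sigma_sets B ?C" if U: "open U" for U
  proof -
    obtain C where C: "\<And>n::nat. compact (C n)" "U \<inter> B = (\<Union>n. C n)"
      using compact_inner_open_union[OF B U] by blast
    \<comment> \<open>A clopen set fits between the compact \<open>C n\<close> and \<open>U\<close>,
      so \<open>B \<inter> U\<close> becomes a countable union of clopen sets.\<close>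
    have "\<exists>T. clopen_in B T \<and> C n \<subseteq> T \<and> T \<subseteq> U" for n
    proof -
      have D: "compact (B - U)" using compact_diff[OF B U] .
      have "\<exists>A\<in>?C. \<exists>U' V. open U' \<and> open V \<and> x \<in> U' \<and> y \<in> V \<and> U' \<inter> B \<subseteq> A \<and> V \<inter> B \<inter> A = {}"
        if "x \<in> C n" "y \<in> B - U" for x y
      proof -
        have "x \<in> B" "y \<in> B" "x \<noteq> y" using that C(2) by blast+
        then obtain S where S: "clopen_in B S" "x \<in> S" "y \<notin> S" using sep by blast
        obtain T where T: "open T" "S = B \<inter> T" using rep[OF S(1)] by blast
        obtain T' where T': "open T'" "B - S = B \<inter> T'"
          using rep[OF clopen_in_Diff[OF clopen_in_self S(1)]] by blast
        show ?thesis
        proof (rule bexI[of _ S], rule exI[of _ T], rule exI[of _ T'], intro conjI)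
          show "x \<in> T" "y \<in> T'" "T \<inter> B \<subseteq> S" "T' \<inter> B \<inter> S = {}"
            using S(2,3) T(2) T'(2) \<open>x \<in> B\<close> \<open>y \<in> B\<close> by blast+
        qed (use S T T' in simp_all)
      qed
      then have "\<exists>A\<in>?C. \<exists>U' V. open U' \<and> open V \<and> C n \<subseteq> U' \<and> B - U \<subseteq> V \<and> U' \<inter> B \<subseteq> A \<and> V \<inter> B \<inter> A = {}"
        by (intro compact_separation C(1) D)
          (simp_all add: clopen_in_empty clopen_in_self clopen_in_Un clopen_in_Int)
      then obtain A U' V where A: "clopen_in B A" "C n \<subseteq> U'" "B - U \<subseteq> V" "U' \<inter> B \<subseteq> A" "V \<inter> B \<inter> A = {}"
        unfolding mem_Collect_eq by (elim bexE exE conjE) simp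
      have "C n \<subseteq> B" using C(2) by blast
      then have "C n \<subseteq> A" using A(2,4) by blast
      moreover have "A \<subseteq> U" using A(3,5) clopen_in_subset[OF A(1)] by blast
      ultimately show ?thesis using A(1) by blast
    qed
    then obtain T where T: "\<And>n. clopen_in B (T n)" "\<And>n. C n \<subseteq> T n" "\<And>n. T n \<subseteq> U" by metis
    have "B \<inter> U = (\<Union>n. T n)"
    proof
      show "B \<inter> U \<subseteq> (\<Union>n. T n)" using C(2) T(2) by blast
      show "(\<Union>n. T n) \<subseteq> B \<inter> U" using T(3) clopen_in_subset[OF T(1)] by blast
    qed
    then show ?thesis using T(1) by (simp add: sigma_sets.Union sigma_sets.Basic)
  qed
  have "sets M = sets (restrict_space borel B)"
  proof
    have "S \<in> sets (restrict_space borel B)" if S: "clopen_in B S" for S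
    proof -
      obtain T where "open T" "S = B \<inter> T" using rep[OF S] by blast
      then show ?thesis unfolding sets_restrict_space by (intro image_eqI[of _ _ T] borel_open)
    qed
    then show "sets M \<subseteq> sets (restrict_space borel B)"
      unfolding setsM using sets.sigma_sets_subset[of ?C "restrict_space borel B"]
      by (auto simp: space_restrict_space)
  next
    interpret S: sigma_algebra B "sigma_sets B ?C" using sub by (rule sigma_algebra_sigma_sets)
    have "B \<inter> A \<in> sigma_sets B ?C" if "A \<in> sets borel" for A
    proof -
      have "A \<in> sigma_sets UNIV (Collect open)" using that by (simp add: borel_def)
      then show ?thesis
      proof induction
        case (Compl A)
        have "B \<inter> (UNIV - A) = B - (B \<inter> A)" by blast
        then show ?case using S.compl_sets[OF Compl.IH] by simp
      next
        case (Union A)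
        have "B \<inter> (\<Union>i. A i) = (\<Union>i. B \<inter> A i)" by blast
        then show ?case using sigma_sets.Union[OF Union.IH] by simp
      qed (auto simp: opens sigma_sets.Empty)
    qed
    then show "sets (restrict_space borel B) \<subseteq> sets M" unfolding setsM by (auto simp: sets_restrict_space)
  qed
  then have "radon_measure_on B M"
    using em[OF clopen_in_self] by (intro radon_measure_on_compact B) auto
  then show ?thesis using em by blast
qed

section \<open>The vertex Laplacian and Perron's method\<close>

text \<open>Arc directions are arbitrary, so the step is an equivalence. Used below to spread
  reachability, maximal values and positivity over the graph.\<close>

lemma (in wf_digraph) connected_induct:
  assumes "Digraph_Component.connected G" and "v \<in> verts G" "w \<in> verts G" and "P w"
    and step: "\<And>e. e \<in> arcs G \<Longrightarrow> P (tail G e) \<longleftrightarrow> P (head G e)"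
  shows "P v"
proof -
  have "w \<rightarrow>\<^sup>*\<^bsub>with_proj (mk_symmetric G)\<^esub> v"
    using assms(1-3) by (auto simp: connected_def strongly_connected_def)
  then show ?thesis unfolding reachable_def
  proof (induction rule: rtrancl_on_induct)
    case base
    then show ?case using \<open>P w\<close> by simp
  next
    case (step a b)
    then show ?case using assms(5) by (auto simp: arcs_ends_def arc_to_ends_def parcs_mk_symmetric)
  qed
qed

context metric_graph
begin

text \<open>The weighted graph Laplacian with edge weights 1/length. A loop contributes 0 to both
  sums.\<close>

definition lap :: "('v \<Rightarrow> real) \<Rightarrow> 'v \<Rightarrow> real" where
  "lap u v = (\<Sum>e\<in>in_arcs G v. (u (tail G e) - u v) / len e)
    + (\<Sum>e\<in>out_arcs G v. (u (head G e) - u v) / len e)"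

text \<open>Unlike \<open>lap\<close>, this counts a loop, and twice. It is thus an upper bound for
  the weight of \<open>u v\<close> in \<open>lap u v\<close>, which is enough for the inequalities
  below.\<close>

definition conductance :: "'v \<Rightarrow> real" where
  "conductance v = (\<Sum>e\<in>in_arcs G v. 1 / len e) + (\<Sum>e\<in>out_arcs G v. 1 / len e)"

lemma conductance_nonneg: "0 \<le> conductance v"
  unfolding conductance_def by (intro add_nonneg_nonneg sum_nonneg) (auto simp: len_pos less_imp_le)

definition incr :: "('v \<Rightarrow> real) \<Rightarrow> 'e \<Rightarrow> real" where
  "incr u e = u (head G e) - u (tail G e)"

definition arcs_at :: "'v set \<Rightarrow> 'e set" where
  "arcs_at D = (\<Union>v\<in>D. in_arcs G v \<union> out_arcs G v)"

lemma finite_arcs_at: "finite D \<Longrightarrow> D \<subseteq> verts G \<Longrightarrow> finite (arcs_at D)"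
  unfolding arcs_at_def using locally_finite by blast

lemma arcs_at_subset: "arcs_at D \<subseteq> arcs G"
  by (auto simp: arcs_at_def)

lemma mem_arcs_at: "e \<in> arcs_at D \<longleftrightarrow> e \<in> arcs G \<and> (head G e \<in> D \<or> tail G e \<in> D)"
  by (auto simp: arcs_at_def)

lemma finite_inc: "v \<in> verts G \<Longrightarrow> finite (in_arcs G v)" "v \<in> verts G \<Longrightarrow> finite (out_arcs G v)"
  using locally_finite by blast+

lemma len_pos_in: "e \<in> in_arcs G v \<Longrightarrow> 0 < len e" and len_pos_out: "e \<in> out_arcs G v \<Longrightarrow> 0 < len e"
  using len_pos by auto

text \<open>The discrete Green formula: each arc term splits into a head and a tail part, and these
  are regrouped by vertex. Since \<open>\<psi>\<close> vanishes off the finite set \<open>D\<close>,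
  there is no boundary term.\<close>

lemma summation_by_parts:
  assumes D: "finite D" "D \<subseteq> verts G" and \<psi>: "\<And>v. v \<in> verts G \<Longrightarrow> v \<notin> D \<Longrightarrow> \<psi> v = 0"
    and F: "finite F" "F \<subseteq> arcs G" "arcs_at D \<subseteq> F"
  shows "(\<Sum>e\<in>F. incr u e * incr \<psi> e / len e) = - (\<Sum>v\<in>D. \<psi> v * lap u v)"
proof -
  have z: "\<psi> (head G e) = 0 \<or> head G e \<in> D" "\<psi> (tail G e) = 0 \<or> tail G e \<in> D" if "e \<in> F" for e
    using \<psi> F(2) that by auto
  have 1: "(\<Sum>v\<in>D. \<Sum>e\<in>in_arcs G v. \<psi> (head G e) * (incr u e / len e))
      = (\<Sum>e\<in>F. \<psi> (head G e) * (incr u e / len e))"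
  proof -
    have "{e \<in> {e\<in>F. head G e \<in> D}. head G e = v} = in_arcs G v" if "v \<in> D" for v
      using F that by (auto simp: arcs_at_def)
    then have "(\<Sum>v\<in>D. \<Sum>e\<in>in_arcs G v. \<psi> (head G e) * (incr u e / len e))
        = (\<Sum>e\<in>{e\<in>F. head G e \<in> D}. \<psi> (head G e) * (incr u e / len e))"
      using sum.group[of "{e\<in>F. head G e \<in> D}" D "head G" "\<lambda>e. \<psi> (head G e) * (incr u e / len e)"] D F
      by auto
    also have "\<dots> = (\<Sum>e\<in>F. \<psi> (head G e) * (incr u e / len e))"
      using F z by (intro sum.mono_neutral_left) auto
    finally show ?thesis .
  qed
  have 2: "(\<Sum>v\<in>D. \<Sum>e\<in>out_arcs G v. \<psi> (tail G e) * (incr u e / len e))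
      = (\<Sum>e\<in>F. \<psi> (tail G e) * (incr u e / len e))"
  proof -
    have "{e \<in> {e\<in>F. tail G e \<in> D}. tail G e = v} = out_arcs G v" if "v \<in> D" for v
      using F that by (auto simp: arcs_at_def)
    then have "(\<Sum>v\<in>D. \<Sum>e\<in>out_arcs G v. \<psi> (tail G e) * (incr u e / len e))
        = (\<Sum>e\<in>{e\<in>F. tail G e \<in> D}. \<psi> (tail G e) * (incr u e / len e))"
      using sum.group[of "{e\<in>F. tail G e \<in> D}" D "tail G" "\<lambda>e. \<psi> (tail G e) * (incr u e / len e)"] D F
      by auto
    also have "\<dots> = (\<Sum>e\<in>F. \<psi> (tail G e) * (incr u e / len e))"
      using F z by (intro sum.mono_neutral_left) auto
    finally show ?thesis .
  qed
  have "- (\<psi> v * lap u v) = (\<Sum>e\<in>in_arcs G v. \<psi> (head G e) * (incr u e / len e))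
      - (\<Sum>e\<in>out_arcs G v. \<psi> (tail G e) * (incr u e / len e))" for v
  proof -
    have A: "(\<Sum>e\<in>in_arcs G v. \<psi> (head G e) * (incr u e / len e))
        = - \<psi> v * (\<Sum>e\<in>in_arcs G v. (u (tail G e) - u v) / len e)"
      unfolding sum_distrib_left by (intro sum.cong) (auto simp: incr_def field_simps)
    have B: "(\<Sum>e\<in>out_arcs G v. \<psi> (tail G e) * (incr u e / len e))
        = \<psi> v * (\<Sum>e\<in>out_arcs G v. (u (head G e) - u v) / len e)"
      unfolding sum_distrib_left by (intro sum.cong) (auto simp: incr_def)
    show ?thesis unfolding lap_def A B by (simp add: algebra_simps)
  qed
  then have "- (\<Sum>v\<in>D. \<psi> v * lap u v) = (\<Sum>v\<in>D. (\<Sum>e\<in>in_arcs G v. \<psi> (head G e) * (incr u e / len e))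
      - (\<Sum>e\<in>out_arcs G v. \<psi> (tail G e) * (incr u e / len e)))"
    by (simp flip: sum_negf)
  also have "\<dots> = (\<Sum>e\<in>F. \<psi> (head G e) * (incr u e / len e)) - (\<Sum>e\<in>F. \<psi> (tail G e) * (incr u e / len e))"
    by (simp only: sum_subtractf 1 2)
  also have "\<dots> = (\<Sum>e\<in>F. incr u e * incr \<psi> e / len e)"
    unfolding sum_subtractf[symmetric]
    by (intro sum.cong) (auto simp: incr_def[of \<psi>] algebra_simps diff_divide_distrib)
  finally show ?thesis by simp
qed

text \<open>Only an inequality, because raising \<open>u v\<close> leaves the loop terms at
  \<open>v\<close> unchanged while \<open>conductance v\<close> counts them.\<close>

lemma lap_bump:
  assumes "v \<in> verts G" "0 \<le> \<delta>"
  shows "lap u v - \<delta> * conductance v \<le> lap (u(v := u v + \<delta>)) v"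
proof -
  have "(\<Sum>e\<in>in_arcs G v. (u (tail G e) - u v) / len e) - (\<Sum>e\<in>in_arcs G v. \<delta> * (1 / len e))
      \<le> (\<Sum>e\<in>in_arcs G v. ((u(v := u v + \<delta>)) (tail G e) - (u(v := u v + \<delta>)) v) / len e)"
    unfolding sum_subtractf[symmetric]
    by (intro sum_mono) (use assms in \<open>auto simp: diff_divide_distrib add_divide_distrib len_pos less_imp_le\<close>)
  moreover have "(\<Sum>e\<in>out_arcs G v. (u (head G e) - u v) / len e) - (\<Sum>e\<in>out_arcs G v. \<delta> * (1 / len e))
      \<le> (\<Sum>e\<in>out_arcs G v. ((u(v := u v + \<delta>)) (head G e) - (u(v := u v + \<delta>)) v) / len e)"
    unfolding sum_subtractf[symmetric]
    by (intro sum_mono) (use assms in \<open>auto simp: diff_divide_distrib add_divide_distrib len_pos less_imp_le\<close>)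
  ultimately show ?thesis
    unfolding lap_def conductance_def distrib_left sum_distrib_left by linarith
qed

text \<open>The slack has several uses: 0 gives monotonicity, a small value compares
  \<open>perron\<close> with an approximating subsolution, and 1 compares a function with values in
  [0,1] to a constant.\<close>

lemma lap_le:
  assumes "\<And>e. e \<in> in_arcs G v \<Longrightarrow> u (tail G e) - u v \<le> u' (tail G e) - u' v + \<delta>"
    and "\<And>e. e \<in> out_arcs G v \<Longrightarrow> u (head G e) - u v \<le> u' (head G e) - u' v + \<delta>"
  shows "lap u v \<le> lap u' v + \<delta> * conductance v"
proof -
  have "(\<Sum>e\<in>in_arcs G v. (u (tail G e) - u v) / len e)
      \<le> (\<Sum>e\<in>in_arcs G v. (u' (tail G e) - u' v) / len e + \<delta> * (1 / len e))"
    using divide_right_mono[OF assms(1) less_imp_le[OF len_pos_in]]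
    by (intro sum_mono) (simp add: add_divide_distrib)
  moreover have "(\<Sum>e\<in>out_arcs G v. (u (head G e) - u v) / len e)
      \<le> (\<Sum>e\<in>out_arcs G v. (u' (head G e) - u' v) / len e + \<delta> * (1 / len e))"
    using divide_right_mono[OF assms(2) less_imp_le[OF len_pos_out]]
    by (intro sum_mono) (simp add: add_divide_distrib)
  ultimately show ?thesis
    unfolding lap_def conductance_def distrib_left sum_distrib_left sum.distrib by linarith
qed

lemma lap_mono:
  assumes "\<And>x. x \<in> verts G \<Longrightarrow> u x \<le> u' x" "u v = u' v"
  shows "lap u v \<le> lap u' v"
  using lap_le[of v u u' 0] assms by simp

text \<open>The local strong maximum principle: at a maximum every term of the Laplacian is
  nonpositive, so a zero sum forces each term to vanish.\<close>

lemma lap_eq_0_extremal: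
  assumes "lap u v = 0" "v \<in> verts G" "\<And>x. x \<in> verts G \<Longrightarrow> u x \<le> u v" "e \<in> arcs G"
  shows "tail G e = v \<Longrightarrow> u (head G e) = u v" "head G e = v \<Longrightarrow> u (tail G e) = u v"
proof -
  have le: "(u (tail G e) - u v) / len e \<le> 0" "(u (head G e) - u v) / len e \<le> 0" if "e \<in> arcs G" for e
    using assms(3) that len_pos[of e] by (auto simp: divide_le_0_iff)
  have "(\<Sum>e\<in>in_arcs G v. (u (tail G e) - u v) / len e) \<le> 0"
    "(\<Sum>e\<in>out_arcs G v. (u (head G e) - u v) / len e) \<le> 0"
    by (intro sum_nonpos; use le in auto)+
  then have z: "(\<Sum>e\<in>in_arcs G v. (u (tail G e) - u v) / len e) = 0"
    "(\<Sum>e\<in>out_arcs G v. (u (head G e) - u v) / len e) = 0"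
    using assms(1) unfolding lap_def by linarith+
  have eq: "(g e - u v) / len e = 0" if "finite A" "(\<Sum>e\<in>A. (g e - u v) / len e) = 0"
    "\<And>e. e \<in> A \<Longrightarrow> (g e - u v) / len e \<le> 0" "e \<in> A" for A g e
  proof -
    have "(\<Sum>e\<in>A. - ((g e - u v) / len e)) = 0" using that(2) by (simp only: sum_negf)
    then have "- ((g e - u v) / len e) = 0"
      using sum_nonneg_eq_0_iff[OF that(1), of "\<lambda>e. - ((g e - u v) / len e)"] that(3,4) by auto
    then show ?thesis by simp
  qed
  show "u (head G e) = u v" if "tail G e = v"
    using eq[OF finite_inc(2)[OF assms(2)] z(2), of e] le that assms(4) len_pos[OF assms(4)] by auto
  show "u (tail G e) = u v" if "head G e = v"
    using eq[OF finite_inc(1)[OF assms(2)] z(1), of e] le that assms(4) len_pos[OF assms(4)] by auto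
qed

lemma lap_uminus: "lap (\<lambda>x. - u x) v = - lap u v"
  by (simp add: lap_def sum_negf[symmetric] minus_divide_left)

lemma lap_diff: "lap (\<lambda>x. u x - u' x) v = lap u v - lap u' v"
proof -
  have "(\<Sum>e\<in>A. (u (g e) - u' (g e) - (u v - u' v)) / len e)
      = (\<Sum>e\<in>A. (u (g e) - u v) / len e) - (\<Sum>e\<in>A. (u' (g e) - u' v) / len e)" for A g
    unfolding sum_subtractf[symmetric] by (intro sum.cong refl) (simp add: diff_divide_distrib)
  then show ?thesis unfolding lap_def by simp
qed

end

section \<open>Subsolutions and the Perron function\<close>

locale pointed_metric_graph = metric_graph +
  fixes w
  assumes w_vert: "w \<in> verts G" and w_degree: "degree G w \<noteq> 1"
begin

text \<open>Finite support stands in for the value 0 at completion points outside the graph. A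
  nonnegative function has nonnegative Laplacian at its zeros, so the condition at positive values
  captures subharmonicity.\<close>

definition subsolutions :: "('a \<Rightarrow> real) set" where
  "subsolutions = {u. (\<forall>v. 0 \<le> u v \<and> u v \<le> 1) \<and> finite {v \<in> verts G. u v \<noteq> 0} \<and> u w = 1 \<and>
     (\<forall>v\<in>verts G. degree G v = 1 \<longrightarrow> u v = 0) \<and> (\<forall>v\<in>verts G. v \<noteq> w \<and> 0 < u v \<longrightarrow> 0 \<le> lap u v)}"

lemma indicator_subsolution: "(\<lambda>v. if v = w then 1 else 0) \<in> subsolutions"
  using w_degree by (auto simp: subsolutions_def)

lemma subsolutionD:
  assumes "u \<in> subsolutions"
  shows "0 \<le> u v" "u v \<le> 1" "finite {v \<in> verts G. u v \<noteq> 0}" "u w = 1"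
    "v \<in> verts G \<Longrightarrow> degree G v = 1 \<Longrightarrow> u v = 0" "v \<in> verts G \<Longrightarrow> v \<noteq> w \<Longrightarrow> 0 < u v \<Longrightarrow> 0 \<le> lap u v"
  using assms by (auto simp: subsolutions_def)

text \<open>The total flux out of a superlevel set is at most the flux out of \<open>w\<close>,
  which bounds the slope on every edge.\<close>

lemma subsolution_slope:
  assumes u: "u \<in> subsolutions" and e: "e \<in> arcs G"
  shows "\<bar>incr u e\<bar> \<le> conductance w * len e"
proof (cases "incr u e = 0")
  case True
  then show ?thesis using conductance_nonneg[of w] len_pos[OF e] by simp
next
  case False
  \<comment> \<open>With \<open>c\<close> the larger end value, exactly one end of \<open>e\<close>
    lies in the superlevel set \<open>D\<close>, so flux leaves \<open>D\<close> through
    \<open>e\<close>.\<close>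
  define c where "c = max (u (head G e)) (u (tail G e))"
  define D where "D = {v \<in> verts G. c \<le> u v}"
  define \<psi> :: "'a \<Rightarrow> real" where "\<psi> v = (if c \<le> u v then 1 else 0)" for v
  have c: "0 < c" "c \<le> 1"
    using False subsolutionD(1)[OF u, of "head G e"] subsolutionD(1)[OF u, of "tail G e"] subsolutionD(2)[OF u]
    by (auto simp: c_def incr_def max_def)
  have D: "finite D" "D \<subseteq> verts G"
    using c(1) by (auto simp: D_def intro: finite_subset[OF _ subsolutionD(3)[OF u]])
  have "(\<Sum>e\<in>arcs_at D. incr u e * incr \<psi> e / len e) = - (\<Sum>v\<in>D. \<psi> v * lap u v)"
    using D by (intro summation_by_parts finite_arcs_at arcs_at_subset) (auto simp: \<psi>_def D_def)
  also have "(\<Sum>v\<in>D. \<psi> v * lap u v) = (\<Sum>v\<in>D. lap u v)"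
    by (intro sum.cong) (auto simp: \<psi>_def D_def)
  also have "\<dots> = lap u w + (\<Sum>v\<in>D - {w}. lap u v)"
    using D c subsolutionD(4)[OF u] w_vert by (intro sum.remove) (auto simp: D_def)
  also have "- (lap u w + (\<Sum>v\<in>D - {w}. lap u v)) \<le> - lap u w"
  proof -
    have "0 \<le> lap u v" if "v \<in> D - {w}" for v
      using that c by (intro subsolutionD(6)[OF u]) (auto simp: D_def)
    then have "0 \<le> (\<Sum>v\<in>D - {w}. lap u v)" by (rule sum_nonneg)
    then show ?thesis by simp
  qed
  also have "\<dots> \<le> conductance w"
  proof -
    \<comment> \<open>Since \<open>u w = 1\<close> and values are nonnegative, no neighbour is more
      than 1 below \<open>w\<close>; this is where the constant \<open>conductance w\<close> comes
      from.\<close>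
    have "lap (\<lambda>_. 0) w \<le> lap u w + 1 * conductance w"
      using subsolutionD(1,2,4)[OF u] by (intro lap_le) auto
    then show ?thesis by (simp add: lap_def)
  qed
  finally have le: "(\<Sum>e\<in>arcs_at D. incr u e * incr \<psi> e / len e) \<le> conductance w" .
  have ends: "tail G e \<in> verts G" "head G e \<in> verts G" using e by auto
  have "incr u e * incr \<psi> e / len e \<le> (\<Sum>e\<in>arcs_at D. incr u e * incr \<psi> e / len e)"
  proof (rule member_le_sum)
    show "e \<in> arcs_at D" using e ends by (auto simp: mem_arcs_at D_def c_def)
    show "0 \<le> incr u x * incr \<psi> x / len x" if "x \<in> arcs_at D - {e}" for x
      using that len_pos[of x] by (auto simp: incr_def \<psi>_def mem_arcs_at zero_le_mult_iff)
  qed (use D in \<open>simp add: finite_arcs_at\<close>)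
  moreover have "incr u e * incr \<psi> e = \<bar>incr u e\<bar>"
    using False by (auto simp: incr_def \<psi>_def c_def)
  ultimately have "\<bar>incr u e\<bar> / len e \<le> conductance w" using le by (metis order_trans)
  then show ?thesis using len_pos[OF e] by (simp add: pos_divide_le_eq)
qed

text \<open>At each vertex the function realising the maximum keeps its value while its neighbours
  can only rise, so the Laplacian does not decrease.\<close>

lemma subsolution_max:
  assumes u: "u \<in> subsolutions" and u': "u' \<in> subsolutions"
  shows "(\<lambda>v. max (u v) (u' v)) \<in> subsolutions"
proof -
  have "0 \<le> lap (\<lambda>v. max (u v) (u' v)) v" if "v \<in> verts G" "v \<noteq> w" "0 < max (u v) (u' v)" for v
  proof (cases "u' v \<le> u v")
    case True
    then have "0 \<le> lap u v" using subsolutionD(6)[OF u] that by simp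
    also have "\<dots> \<le> lap (\<lambda>v. max (u v) (u' v)) v" using True by (intro lap_mono) auto
    finally show ?thesis .
  next
    case False
    then have "0 \<le> lap u' v" using subsolutionD(6)[OF u'] that by simp
    also have "\<dots> \<le> lap (\<lambda>v. max (u v) (u' v)) v" using False by (intro lap_mono) auto
    finally show ?thesis .
  qed
  moreover have "{v \<in> verts G. max (u v) (u' v) \<noteq> 0} \<subseteq> {v \<in> verts G. u v \<noteq> 0} \<union> {v \<in> verts G. u' v \<noteq> 0}"
    by auto
  then have "finite {v \<in> verts G. max (u v) (u' v) \<noteq> 0}"
    using subsolutionD(3)[OF u] subsolutionD(3)[OF u'] by (meson finite_Un finite_subset)
  ultimately show ?thesis
    using subsolutionD(1,2,4,5)[OF u] subsolutionD(1,2,4,5)[OF u']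
    unfolding subsolutions_def by (auto simp: le_max_iff_disj)
qed

text \<open>Perron's local improvement: the raise is small enough to keep the Laplacian nonnegative
  at \<open>v\<close>, and it cannot lower the Laplacian at any other vertex. It is what makes the
  supremum superharmonic.\<close>

lemma subsolution_bump:
  assumes u: "u \<in> subsolutions" and v: "v \<in> verts G" "v \<noteq> w" "degree G v \<noteq> 1" "0 \<le> lap u v" "0 < conductance v"
  shows "u(v := u v + lap u v / conductance v) \<in> subsolutions"
proof -
  let ?\<delta> = "lap u v / conductance v" and ?u = "u(v := u v + lap u v / conductance v)"
  have \<delta>: "0 \<le> ?\<delta>" using v by simp
  have ge: "u x \<le> ?u x" for x using \<delta> by simp
  have "0 \<le> lap ?u x" if "x \<in> verts G" "x \<noteq> w" "0 < ?u x" for x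
  proof (cases "x = v")
    case True
    have "lap u v - ?\<delta> * conductance v \<le> lap ?u v" by (rule lap_bump[OF v(1) \<delta>])
    then show ?thesis using v(5) True by simp
  next
    case False
    then have "0 \<le> lap u x" using subsolutionD(6)[OF u] that by simp
    also have "\<dots> \<le> lap ?u x" using ge False by (intro lap_mono) auto
    finally show ?thesis .
  qed
  moreover have "?u v \<le> 1"
  proof -
    \<comment> \<open>All neighbours are at most 1, which caps the Laplacian at \<open>v\<close> and
      keeps the raised value at most 1.\<close>
    have "lap u v \<le> lap (\<lambda>_. 0) v + (1 - u v) * conductance v"
      using subsolutionD(2)[OF u] by (intro lap_le) auto
    then have "?\<delta> \<le> 1 - u v" using v(5) by (simp add: lap_def pos_divide_le_eq)
    then show ?thesis by simp
  qed
  moreover have "{x \<in> verts G. ?u x \<noteq> 0} \<subseteq> insert v {x \<in> verts G. u x \<noteq> 0}" by auto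
  then have "finite {x \<in> verts G. ?u x \<noteq> 0}"
    using subsolutionD(3)[OF u] by (meson finite_insert finite_subset)
  ultimately show ?thesis
    using subsolutionD(1,2,4,5)[OF u] v(2,3) order_trans[OF subsolutionD(1)[OF u] ge]
    unfolding subsolutions_def by auto
qed

definition perron :: "'a \<Rightarrow> real" where
  "perron v = (SUP u\<in>subsolutions. u v)"

lemma perron_upper: "u \<in> subsolutions \<Longrightarrow> u v \<le> perron v"
  unfolding perron_def by (intro cSUP_upper bdd_aboveI2[of _ _ 1]) (auto dest: subsolutionD)

lemma perron_least: "(\<And>u. u \<in> subsolutions \<Longrightarrow> u v \<le> c) \<Longrightarrow> perron v \<le> c"
  unfolding perron_def using indicator_subsolution by (intro cSUP_least) auto

lemma perron_approx1: "0 < \<epsilon> \<Longrightarrow> \<exists>u\<in>subsolutions. perron v - \<epsilon> < u v"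
  using perron_least[of v "perron v - \<epsilon>"] by (meson diff_less_eq less_add_same_cancel1 linorder_not_less not_le)

text \<open>Stability under maxima yields one subsolution that is close to the supremum at finitely
  many vertices simultaneously.\<close>

lemma perron_approx:
  assumes "finite D" "0 < \<epsilon>"
  shows "\<exists>u\<in>subsolutions. \<forall>v\<in>D. perron v - \<epsilon> < u v"
  using assms(1)
proof induction
  case empty
  then show ?case using indicator_subsolution by blast
next
  case (insert x D)
  then obtain u where u: "u \<in> subsolutions" "\<forall>v\<in>D. perron v - \<epsilon> < u v" by blast
  obtain u' where u': "u' \<in> subsolutions" "perron x - \<epsilon> < u' x" using perron_approx1[OF assms(2)] by blast
  show ?case
    using u u' by (intro bexI[of _ "\<lambda>v. max (u v) (u' v)"] subsolution_max) (auto simp: less_max_iff_disj)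
qed

lemma perron_nonneg: "0 \<le> perron v"
  using perron_upper[OF indicator_subsolution, of v] by (auto split: if_splits)

lemma perron_w: "perron w = 1"
  using perron_upper[OF indicator_subsolution, of w] perron_least[of w 1] subsolutionD(2) by fastforce

lemma perron_boundary: "v \<in> verts G \<Longrightarrow> degree G v = 1 \<Longrightarrow> perron v = 0"
  using perron_least[of v 0] perron_nonneg[of v] subsolutionD(5) by force

lemma perron_slope:
  assumes e: "e \<in> arcs G"
  shows "\<bar>incr perron e\<bar> \<le> conductance w * len e"
proof -
  have *: "\<bar>u (head G e) - u (tail G e)\<bar> \<le> conductance w * len e" if "u \<in> subsolutions" for u
    using subsolution_slope[OF that e] by (simp add: incr_def)
  have "perron (head G e) \<le> perron (tail G e) + conductance w * len e"
  proof (rule perron_least)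
    fix u assume u: "u \<in> subsolutions"
    show "u (head G e) \<le> perron (tail G e) + conductance w * len e"
      using *[OF u] perron_upper[OF u, of "tail G e"] by linarith
  qed
  moreover have "perron (tail G e) \<le> perron (head G e) + conductance w * len e"
  proof (rule perron_least)
    fix u assume u: "u \<in> subsolutions"
    show "u (tail G e) \<le> perron (head G e) + conductance w * len e"
      using *[OF u] perron_upper[OF u, of "head G e"] by linarith
  qed
  ultimately show ?thesis by (auto simp: incr_def)
qed

text \<open>If a good approximation had a large Laplacian at \<open>v\<close>, the bump would lift
  it above the supremum. Conversely, the supremum inherits a nonnegative Laplacian from subsolutions
  that almost attain it at \<open>v\<close>.\<close>

lemma perron_harmonic:
  assumes v: "v \<in> verts G" "v \<noteq> w" "degree G v \<noteq> 1"
  shows "lap perron v = 0"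
proof (rule antisym)
  show "lap perron v \<le> 0"
  proof (rule field_le_epsilon)
    fix \<epsilon> :: real assume \<epsilon>: "0 < \<epsilon>"
    show "lap perron v \<le> 0 + \<epsilon>"
    \<comment> \<open>Zero conductance means that no arc is incident, so the Laplacian is an empty
      sum; otherwise division by the conductance is legitimate.\<close>
    proof (cases "conductance v = 0")
      case True
      have "e \<notin> in_arcs G v \<union> out_arcs G v" for e
      proof
        assume e: "e \<in> in_arcs G v \<union> out_arcs G v"
        have nn: "0 \<le> (\<Sum>e\<in>in_arcs G v. 1 / len e)" "0 \<le> (\<Sum>e\<in>out_arcs G v. 1 / len e)"
          by (intro sum_nonneg; auto simp: len_pos less_imp_le)+
        have "1 / len e \<le> (\<Sum>e\<in>in_arcs G v. 1 / len e)" if "e \<in> in_arcs G v"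
          by (rule member_le_sum) (use that finite_inc[OF v(1)] in \<open>auto simp: len_pos less_imp_le\<close>)
        moreover have "1 / len e \<le> (\<Sum>e\<in>out_arcs G v. 1 / len e)" if "e \<in> out_arcs G v"
          by (rule member_le_sum) (use that finite_inc[OF v(1)] in \<open>auto simp: len_pos less_imp_le\<close>)
        moreover have "0 < 1 / len e" using e len_pos by auto
        ultimately show False using e nn True unfolding conductance_def by auto
      qed
      then have "in_arcs G v = {}" "out_arcs G v = {}" by blast+
      then have "lap perron v = 0" unfolding lap_def by simp
      then show ?thesis using \<epsilon> by simp
    next
      case False
      then have c: "0 < conductance v" using conductance_nonneg[of v] by linarith
      \<comment> \<open>Two errors of size \<open>\<eta> * conductance v\<close> occur: in the bound
        for \<open>lap u v\<close> and in the passage from \<open>u\<close> to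
        \<open>perron\<close>.\<close>
      define \<eta> where "\<eta> = \<epsilon> / (2 * conductance v)"
      have \<eta>: "0 < \<eta>" using \<epsilon> c by (simp add: \<eta>_def)
      obtain u where u: "u \<in> subsolutions"
        "\<And>x. x \<in> insert v (tail G ` in_arcs G v \<union> head G ` out_arcs G v) \<Longrightarrow> perron x - \<eta> < u x"
        using perron_approx[of "insert v (tail G ` in_arcs G v \<union> head G ` out_arcs G v)" \<eta>] \<eta> finite_inc[OF v(1)] by auto
      have "lap u v \<le> \<eta> * conductance v"
      proof (cases "0 \<le> lap u v")
        case True
        have "(u(v := u v + lap u v / conductance v)) v \<le> perron v"
          by (rule perron_upper[OF subsolution_bump[OF u(1) v True c]])
        then have "lap u v / conductance v \<le> \<eta>" using u(2)[of v] by simp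
        then show ?thesis using c by (simp add: pos_divide_le_eq)
      next
        case False
        moreover have "0 \<le> \<eta> * conductance v" using c \<eta> by simp
        ultimately show ?thesis by linarith
      qed
      moreover have "lap perron v \<le> lap u v + \<eta> * conductance v"
      proof (rule lap_le)
        fix e assume "e \<in> in_arcs G v"
        then show "perron (tail G e) - perron v \<le> u (tail G e) - u v + \<eta>"
          using u(2)[of "tail G e"] perron_upper[OF u(1), of v] by fastforce
      next
        fix e assume "e \<in> out_arcs G v"
        then show "perron (head G e) - perron v \<le> u (head G e) - u v + \<eta>"
          using u(2)[of "head G e"] perron_upper[OF u(1), of v] by fastforce
      qed
      moreover have "\<eta> * conductance v = \<epsilon> / 2" using c by (simp add: \<eta>_def)
      ultimately show ?thesis by linarith
    qed
  qed
next
  show "0 \<le> lap perron v"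
  proof (cases "perron v = 0")
    case True
    then have "lap (\<lambda>_. 0) v \<le> lap perron v" by (intro lap_mono perron_nonneg) simp
    then show ?thesis by (simp add: lap_def)
  next
    case False
    show ?thesis
    proof (rule field_le_epsilon)
      fix \<epsilon> :: real assume \<epsilon>: "0 < \<epsilon>"
      have p: "0 < perron v" using False perron_nonneg[of v] by linarith
      \<comment> \<open>The first bound forces \<open>u v\<close> to be positive, so subharmonicity
        applies at \<open>v\<close>; the summand 1 guards against zero conductance.\<close>
      define \<eta> where "\<eta> = min (perron v) (\<epsilon> / (conductance v + 1))"
      have c: "0 < conductance v + 1" using conductance_nonneg[of v] by linarith
      then have \<eta>: "0 < \<eta>" using \<epsilon> p by (simp add: \<eta>_def)
      obtain u where u: "u \<in> subsolutions" "perron v - \<eta> < u v" using perron_approx1[OF \<eta>] by blast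
      have "0 < u v" using u(2) by (simp add: \<eta>_def)
      then have "0 \<le> lap u v" using subsolutionD(6)[OF u(1)] v by simp
      also have "\<dots> \<le> lap perron v + \<eta> * conductance v"
      proof (rule lap_le)
        show "u (tail G e) - u v \<le> perron (tail G e) - perron v + \<eta>" for e
          using perron_upper[OF u(1), of "tail G e"] u(2) by linarith
        show "u (head G e) - u v \<le> perron (head G e) - perron v + \<eta>" for e
          using perron_upper[OF u(1), of "head G e"] u(2) by linarith
      qed
      also have "\<eta> * conductance v \<le> \<epsilon>"
      proof -
        have "\<eta> * conductance v \<le> \<eta> * (conductance v + 1)" using \<eta> by simp
        also have "\<dots> \<le> \<epsilon>" using c by (simp add: \<eta>_def pos_le_divide_eq[symmetric])
        finally show ?thesis .
      qed
      finally show "0 \<le> lap perron v + \<epsilon>" by simp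
    qed
  qed
qed

end

section \<open>Topology of the completion\<close>

locale graph_completion = metric_graph G len
  for G :: "('v, 'e) pre_digraph" and len :: "'e \<Rightarrow> real" +
  fixes X :: "'x::metric_space set" and \<iota> :: "('v, 'e) gpoint \<Rightarrow> 'x"
  assumes completion: "is_completion G len X \<iota>" and compact_X: "compact X"
begin

abbreviation "gp \<equiv> graph_points G len"
abbreviation "ep \<equiv> edge_point G len"

lemma vertex_in_gp [simp]: "Vertex v \<in> gp \<longleftrightarrow> v \<in> verts G"
  by (auto simp: graph_points_def)

lemma inner_in_gp [simp]: "Inner e t \<in> gp \<longleftrightarrow> e \<in> arcs G \<and> 0 < t \<and> t < len e"
  by (auto simp: graph_points_def)

lemma gp_cases:
  assumes "p \<in> gp"
  obtains v where "v \<in> verts G" "p = Vertex v"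
  | e t where "e \<in> arcs G" "0 < t" "t < len e" "p = Inner e t"
  using assms by (auto simp: graph_points_def)

lemma ep_ends [simp]: "ep e 0 = Vertex (tail G e)" "e \<in> arcs G \<Longrightarrow> ep e (len e) = Vertex (head G e)"
  using len_pos[of e] by (auto simp: edge_point_def)

lemma ep_inner [simp]: "0 < t \<Longrightarrow> t < len e \<Longrightarrow> ep e t = Inner e t"
  by (auto simp: edge_point_def)

lemma ep_clamp: "e \<in> arcs G \<Longrightarrow> ep e t = ep e (max 0 (min t (len e)))"
  using len_pos[of e] by (auto simp: edge_point_def max_def min_def)

lemma ep_in_gp [simp]: "e \<in> arcs G \<Longrightarrow> ep e t \<in> gp"
  by (auto simp: edge_point_def)

lemma \<iota>_in_X: "p \<in> gp \<Longrightarrow> \<iota> p \<in> X"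
  using completion by (auto simp: is_completion_def)

lemma \<iota>_dense: "X \<subseteq> closure (\<iota> ` gp)"
  using completion by (auto simp: is_completion_def)

lemma \<iota>_dist: "p \<in> gp \<Longrightarrow> q \<in> gp \<Longrightarrow> dist (\<iota> p) (\<iota> q) = gdist G len p q"
  using completion by (auto simp: is_completion_def)

text \<open>The condition looks at one edge at a time, yet bounds differences along every path. Such
  functions are the means of bounding the infimum \<open>gdist\<close> from below.\<close>

definition edge_lipschitz :: "real \<Rightarrow> (('v, 'e) gpoint \<Rightarrow> real) \<Rightarrow> bool" where
  "edge_lipschitz L F \<longleftrightarrow> 0 \<le> L \<and>
     (\<forall>e\<in>arcs G. \<forall>s\<in>{0..len e}. \<forall>t\<in>{0..len e}. \<bar>F (ep e s) - F (ep e t)\<bar> \<le> L * \<bar>s - t\<bar>)"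

lemma gpath_nonneg: "gpath G len p q l \<Longrightarrow> 0 \<le> l"
  by (induction rule: gpath.induct) auto

lemma gpath_lipschitz:
  assumes F: "edge_lipschitz L F" and "gpath G len p q l"
  shows "\<bar>F p - F q\<bar> \<le> L * l"
  using assms(2)
proof (induction rule: gpath.induct)
  case (gpath_step p e s l t)
  have "\<bar>F (ep e s) - F (ep e t)\<bar> \<le> L * \<bar>s - t\<bar>"
    using F gpath_step by (auto simp: edge_lipschitz_def)
  then show ?case using gpath_step.IH by (simp add: distrib_left abs_minus_commute[of t s])
qed simp

lemma gpath_exists:
  assumes p: "p \<in> gp" and q: "q \<in> gp"
  shows "\<exists>l. gpath G len p q l"
proof -
  have edge: "\<exists>l. gpath G len p (ep e t) l" if asm: "\<exists>l. gpath G len p (ep e s) l" "e \<in> arcs G"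
    "s \<in> {0..len e}" "t \<in> {0..len e}" for e s t
  proof -
    obtain l where "gpath G len p (ep e s) l" using asm(1) by blast
    from gpath.gpath_step[OF this asm(2-4)] show ?thesis by blast
  qed
  obtain w where w: "w \<in> verts G" "\<exists>l. gpath G len p (Vertex w) l"
    using p
  proof (cases rule: gp_cases)
    case (1 v)
    then show ?thesis using that gpath.gpath_refl p by blast
  next
    case (2 e t)
    have "\<exists>l. gpath G len p (ep e t) l" using 2 gpath.gpath_refl[OF p] by auto
    then have "\<exists>l. gpath G len p (ep e 0) l" by (rule edge) (use 2 in auto)
    then show ?thesis using that[of "tail G e"] 2 by simp
  qed
  have V: "\<exists>l. gpath G len p (Vertex v) l" if "v \<in> verts G" for v
  proof (rule connected_induct[OF graph_connected that w(1)])
    show "\<exists>l. gpath G len p (Vertex w) l" by (rule w(2))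
    fix e assume e: "e \<in> arcs G"
    show "(\<exists>l. gpath G len p (Vertex (tail G e)) l) = (\<exists>l. gpath G len p (Vertex (head G e)) l)"
      using edge[of e 0 "len e"] edge[of e "len e" 0] e len_pos[OF e] by auto
  qed
  show ?thesis
    using q
  proof (cases rule: gp_cases)
    case (2 e t)
    have "\<exists>l. gpath G len p (ep e t) l"
      by (rule edge[of e 0]) (use 2 V[of "tail G e"] in auto)
    then show ?thesis using 2 by simp
  qed (use V in auto)
qed

lemma dist_lipschitz:
  assumes F: "edge_lipschitz L F" and "p \<in> gp" "q \<in> gp"
  shows "\<bar>F p - F q\<bar> \<le> L * dist (\<iota> p) (\<iota> q)"
\<comment> \<open>Division by \<open>L\<close> is impossible here, but the existence of a path
  already forces equal values.\<close>
proof (cases "L = 0")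
  case True
  then show ?thesis using gpath_exists[OF assms(2,3)] gpath_lipschitz[OF F] by fastforce
next
  case False
  then have L: "0 < L" using F by (auto simp: edge_lipschitz_def)
  have "\<bar>F p - F q\<bar> / L \<le> gdist G len p q"
    unfolding gdist_def
  proof (rule cInf_greatest)
    show "{l. gpath G len p q l} \<noteq> {}" using gpath_exists[OF assms(2,3)] by blast
    show "\<bar>F p - F q\<bar> / L \<le> l" if "l \<in> {l. gpath G len p q l}" for l
      using gpath_lipschitz[OF F, of p q l] that L by (simp add: pos_divide_le_eq mult.commute)
  qed
  then show ?thesis using L assms by (simp add: \<iota>_dist pos_divide_le_eq mult.commute)
qed

lemma dist_edge:
  assumes "e \<in> arcs G" "s \<in> {0..len e}" "t \<in> {0..len e}"
  shows "dist (\<iota> (ep e s)) (\<iota> (ep e t)) \<le> \<bar>s - t\<bar>"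
proof -
  have "gpath G len (ep e s) (ep e t) (0 + \<bar>t - s\<bar>)"
    using assms by (intro gpath.gpath_step gpath.gpath_refl) auto
  then have "gdist G len (ep e s) (ep e t) \<le> \<bar>t - s\<bar>"
    unfolding gdist_def by (intro cInf_lower bdd_belowI[of _ 0]) (auto dest: gpath_nonneg)
  then show ?thesis using assms by (simp add: \<iota>_dist abs_minus_commute)
qed

lemma edge_continuous:
  assumes "e \<in> arcs G"
  shows "continuous_on S (\<lambda>t. \<iota> (ep e t))"
proof -
  have "dist (\<iota> (ep e s)) (\<iota> (ep e t)) \<le> 1 * dist s t" for s t
  proof -
    have "dist (\<iota> (ep e s)) (\<iota> (ep e t)) \<le> \<bar>max 0 (min s (len e)) - max 0 (min t (len e))\<bar>"
      using assms len_pos[OF assms] dist_edge[of e "max 0 (min s (len e))" "max 0 (min t (len e))"]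
      by (simp flip: ep_clamp)
    also have "\<dots> \<le> \<bar>s - t\<bar>" by linarith
    finally show ?thesis by (simp add: dist_real_def)
  qed
  then have "1-lipschitz_on S (\<lambda>t. \<iota> (ep e t))" by (intro lipschitz_onI) auto
  then show ?thesis by (rule lipschitz_on_continuous_on)
qed

lemma edge_compact: "e \<in> arcs G \<Longrightarrow> compact ((\<lambda>t. \<iota> (ep e t)) ` {0..len e})"
  by (intro compact_continuous_image edge_continuous) auto

section \<open>Test functions near a vertex or inside an edge\<close>

primrec interp :: "('v \<Rightarrow> real) \<Rightarrow> ('v, 'e) gpoint \<Rightarrow> real" where
  "interp u (Vertex v) = u v"
| "interp u (Inner e t) = u (tail G e) + t / len e * incr u e"

lemma interp_ep:
  assumes "e \<in> arcs G" "t \<in> {0..len e}"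
  shows "interp u (ep e t) = u (tail G e) + t / len e * incr u e"
  using assms len_pos[OF assms(1)] by (auto simp: edge_point_def incr_def)

lemma interp_lipschitz:
  assumes "0 \<le> L" "\<And>e. e \<in> arcs G \<Longrightarrow> \<bar>incr u e\<bar> \<le> L * len e"
  shows "edge_lipschitz L (interp u)"
  unfolding edge_lipschitz_def
proof (intro conjI ballI assms(1))
  fix e s t assume e: "e \<in> arcs G" and st: "s \<in> {0..len e}" "t \<in> {0..len e}"
  have "interp u (ep e s) - interp u (ep e t) = incr u e / len e * (s - t)"
    using e st by (simp add: interp_ep diff_divide_distrib algebra_simps)
  then have "\<bar>interp u (ep e s) - interp u (ep e t)\<bar> = \<bar>incr u e\<bar> / len e * \<bar>s - t\<bar>"
    using len_pos[OF e] by (simp add: abs_mult)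
  also have "\<dots> \<le> L * \<bar>s - t\<bar>"
    using assms(2)[OF e] len_pos[OF e] by (intro mult_right_mono) (auto simp: pos_divide_le_eq)
  finally show "\<bar>interp u (ep e s) - interp u (ep e t)\<bar> \<le> L * \<bar>s - t\<bar>" .
qed

lemma finite_incr_bound:
  assumes "finite {e \<in> arcs G. incr u e \<noteq> 0}"
  obtains L where "0 \<le> L" "\<And>e. e \<in> arcs G \<Longrightarrow> \<bar>incr u e\<bar> \<le> L * len e"
proof
  let ?A = "{e \<in> arcs G. incr u e \<noteq> 0}" and ?L = "\<Sum>e\<in>{e \<in> arcs G. incr u e \<noteq> 0}. \<bar>incr u e\<bar> / len e"
  have nn: "0 \<le> \<bar>incr u e\<bar> / len e" if "e \<in> arcs G" for e using len_pos[OF that] by simp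
  then show L: "0 \<le> ?L" by (intro sum_nonneg) auto
  show "\<bar>incr u e\<bar> \<le> ?L * len e" if "e \<in> arcs G" for e
  proof (cases "incr u e = 0")
    case True
    then show ?thesis using L len_pos[OF that] by simp
  next
    case False
    have "\<bar>incr u e\<bar> / len e \<le> ?L"
      by (rule member_le_sum[of e ?A "\<lambda>e. \<bar>incr u e\<bar> / len e"]) (use False that assms nn in auto)
    then show ?thesis using len_pos[OF that] by (simp add: pos_divide_le_eq)
  qed
qed

definition delta :: "'v \<Rightarrow> 'v \<Rightarrow> real" where
  "delta v x = (if x = v then 1 else 0)"

lemma delta_lipschitz:
  assumes "v \<in> verts G"
  obtains L where "edge_lipschitz L (interp (delta v))"
proof -
  have "{e \<in> arcs G. incr (delta v) e \<noteq> 0} \<subseteq> arcs_at {v}"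
    by (auto simp: incr_def delta_def mem_arcs_at split: if_splits)
  then have "finite {e \<in> arcs G. incr (delta v) e \<noteq> 0}"
    using finite_arcs_at[of "{v}"] assms finite_subset by blast
  then show ?thesis using finite_incr_bound interp_lipschitz that by metis
qed

text \<open>A hat of height \<open>r\<close> around the point at \<open>t0\<close>. It fits into the
  edge if \<open>r\<close> is at most the distance to either end, which is the hypothesis of
  \<open>tent_lipschitz\<close>.\<close>

primrec tent :: "'e \<Rightarrow> real \<Rightarrow> real \<Rightarrow> ('v, 'e) gpoint \<Rightarrow> real" where
  "tent e0 t0 r (Vertex v) = 0"
| "tent e0 t0 r (Inner e t) = (if e = e0 then max 0 (r - \<bar>t - t0\<bar>) else 0)"

lemma tent_lipschitz:
  assumes "r \<le> t0" "r \<le> len e0 - t0"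
  shows "edge_lipschitz 1 (tent e0 t0 r)"
proof -
  have "tent e0 t0 r (ep e t) = (if e = e0 then max 0 (r - \<bar>t - t0\<bar>) else 0)" if "t \<in> {0..len e}" for e t
    using that assms by (auto simp: edge_point_def)
  then show ?thesis by (auto simp: edge_lipschitz_def)
qed

text \<open>That an infimum over paths separates points is not evident. Local finiteness makes the
  hat at a vertex Lipschitz, tents handle inner points, and points at distance 0 must agree on all
  these functions.\<close>

lemma \<iota>_eq_iff:
  assumes "p \<in> gp" "q \<in> gp"
  shows "\<iota> p = \<iota> q \<longleftrightarrow> p = q"
proof
  assume eq: "\<iota> p = \<iota> q"
  have sep: "F p = F q" if "edge_lipschitz L F" for L F
    using dist_lipschitz[OF that assms] eq by simp
  have inner: "q' = Inner e t" if "tent e t (min t (len e - t)) (Inner e t) = tent e t (min t (len e - t)) q'"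
    "0 < t" "t < len e" for e t and q' :: "('v, 'e) gpoint"
    using that by (cases q') (auto simp: max_def min_def split: if_splits)
  show "p = q"
    using assms(1)
  proof (cases rule: gp_cases)
    case (1 v)
    show ?thesis using assms(2)
    proof (cases rule: gp_cases)
      case (1 v')
      obtain L where "edge_lipschitz L (interp (delta v))" using delta_lipschitz \<open>v \<in> verts G\<close> by blast
      from sep[OF this] show ?thesis using 1 \<open>p = Vertex v\<close> by (simp add: delta_def split: if_splits)
    next
      case (2 e t)
      then show ?thesis using sep[OF tent_lipschitz, of "min t (len e - t)" t e] inner[of e t p] by auto
    qed
  next
    case (2 e t)
    then show ?thesis using sep[OF tent_lipschitz, of "min t (len e - t)" t e] inner[of e t q] by auto
  qed
qed simp

lemma inj_\<iota>: "inj_on \<iota> gp"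
  by (auto simp: inj_on_def \<iota>_eq_iff)

lemma dense_point:
  assumes "open T" "x \<in> X" "x \<in> T"
  obtains q where "q \<in> gp" "\<iota> q \<in> T"
proof -
  have "T \<inter> closure (\<iota> ` gp) \<noteq> {}" using assms \<iota>_dense by blast
  then have "T \<inter> \<iota> ` gp \<noteq> {}" using open_Int_closure_eq_empty[OF assms(1)] by blast
  then show thesis using that by blast
qed

text \<open>The finitely many closed edges carrying \<open>F\<close> form a compact, hence closed,
  set. So a completion point outside the graph cannot come close to a point where \<open>F\<close>
  is positive.\<close>

lemma open_superlevel:
  assumes F: "edge_lipschitz L F" and A: "finite A" "A \<subseteq> arcs G" and D: "finite D" "D \<subseteq> verts G"
    and sub: "{p \<in> gp. 0 < F p} \<subseteq> Vertex ` D \<union> (\<Union>e\<in>A. ep e ` {0..len e})"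
  shows "openin (top_of_set X) (\<iota> ` {p \<in> gp. 0 < F p})"
proof -
  define K where "K = \<iota> ` Vertex ` D \<union> (\<Union>e\<in>A. (\<lambda>t. \<iota> (ep e t)) ` {0..len e})"
  have "compact K" unfolding K_def
    using A D by (intro compact_Un compact_UN edge_compact finite_imp_compact) auto
  then have K: "closed K" by (rule compact_imp_closed)
  have K_gp: "K \<subseteq> \<iota> ` gp" using A D by (auto simp: K_def)
  have in_K: "\<iota> q \<in> K" if "q \<in> gp" "0 < F q" for q
  proof -
    have "q \<in> Vertex ` D \<union> (\<Union>e\<in>A. ep e ` {0..len e})" using sub that by auto
    then show ?thesis unfolding K_def by blast
  qed
  have "\<exists>\<delta>>0. \<forall>y\<in>X. dist y x < \<delta> \<longrightarrow> y \<in> \<iota> ` {p \<in> gp. 0 < F p}" if x: "x \<in> \<iota> ` {p \<in> gp. 0 < F p}" for x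
  proof -
    obtain p where p: "p \<in> gp" "0 < F p" "x = \<iota> p" using x by blast
    have L: "0 \<le> L" using F by (simp add: edge_lipschitz_def)
    define \<delta> where "\<delta> = F p / (L + 1)"
    have near: "0 < F q" if "q \<in> gp" "dist (\<iota> q) x < \<delta>" for q
    proof -
      have "L * dist (\<iota> p) (\<iota> q) \<le> L * \<delta>"
        using that p L by (intro mult_left_mono) (auto simp: dist_commute)
      also have "L * \<delta> < F p" using L p(2) by (simp add: \<delta>_def field_simps)
      finally show ?thesis using dist_lipschitz[OF F p(1) that(1)] by linarith
    qed
    have "y \<in> \<iota> ` {p \<in> gp. 0 < F p}" if y: "y \<in> X" "dist y x < \<delta>" for y
    proof -
      \<comment> \<open>Otherwise density gives a graph point near \<open>x\<close> and outside
        \<open>K\<close>: \<open>F\<close> is positive there by nearness, yet \<open>K\<close>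
        contains all points where \<open>F\<close> is positive.\<close>
      have "y \<in> K"
      proof (rule ccontr)
        assume "y \<notin> K"
        then have "y \<in> ball x \<delta> \<inter> - K" using y by (simp add: dist_commute)
        moreover have "open (ball x \<delta> \<inter> - K)" using K by (intro open_Int open_ball open_Compl)
        ultimately obtain q where q: "q \<in> gp" "\<iota> q \<in> ball x \<delta> \<inter> - K"
          using dense_point y(1) by blast
        then have "dist (\<iota> q) x < \<delta>" by (simp add: dist_commute)
        then show False using in_K[OF q(1)] near[OF q(1)] q(2) by blast
      qed
      then obtain q where "q \<in> gp" "y = \<iota> q" using K_gp by blast
      then show ?thesis using near y(2) by blast
    qed
    moreover have "\<delta> > 0" using p(2) L by (simp add: \<delta>_def)
    ultimately show ?thesis by blast
  qed
  then show ?thesis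
    unfolding openin_euclidean_subtopology_iff using \<iota>_in_X by blast
qed

text \<open>Superlevel sets of the hat at \<open>v\<close>: level 0 gives the open star, level 2/3
  the part near \<open>v\<close> on which smoothed cut functions will be constant.\<close>

definition star :: "real \<Rightarrow> 'v \<Rightarrow> ('v, 'e) gpoint set" where
  "star c v = {p \<in> gp. c < interp (delta v) p}"

lemma openin_star:
  assumes "v \<in> verts G" "0 \<le> c"
  shows "openin (top_of_set X) (\<iota> ` star c v)"
proof -
  obtain L where L: "edge_lipschitz L (interp (delta v))" using delta_lipschitz[OF assms(1)] .
  have "openin (top_of_set X) (\<iota> ` {p \<in> gp. 0 < interp (delta v) p - c})"
  proof (rule open_superlevel[of L _ "arcs_at {v}" "{v}"])
    show "edge_lipschitz L (\<lambda>p. interp (delta v) p - c)" using L by (simp add: edge_lipschitz_def)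
    show "{p \<in> gp. 0 < interp (delta v) p - c} \<subseteq> Vertex ` {v} \<union> (\<Union>e\<in>arcs_at {v}. ep e ` {0..len e})"
    proof
      fix p assume "p \<in> {p \<in> gp. 0 < interp (delta v) p - c}"
      then have p: "p \<in> gp" "0 < interp (delta v) p" using assms(2) by auto
      from p(1) show "p \<in> Vertex ` {v} \<union> (\<Union>e\<in>arcs_at {v}. ep e ` {0..len e})"
      proof (cases rule: gp_cases)
        case (1 x)
        then show ?thesis using p(2) by (auto simp: delta_def split: if_splits)
      next
        case (2 e t)
        then have "e \<in> arcs_at {v}" using p(2) by (auto simp: mem_arcs_at incr_def delta_def split: if_splits)
        moreover have "p = ep e t" "t \<in> {0..len e}" using 2 by auto
        ultimately show ?thesis by blast
      qed
    qed
  qed (use assms finite_arcs_at[of "{v}"] arcs_at_subset in auto)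
  then show ?thesis by (simp add: star_def)
qed

lemma vertex_in_star [simp]: "x \<in> verts G \<Longrightarrow> 0 \<le> c \<Longrightarrow> c < 1 \<Longrightarrow> Vertex x \<in> star c v \<longleftrightarrow> x = v"
  by (auto simp: star_def delta_def)

definition open_ball_in_edge :: "'e \<Rightarrow> real \<Rightarrow> real \<Rightarrow> ('v, 'e) gpoint set" where
  "open_ball_in_edge e t r = {p \<in> gp. 0 < tent e t r p}"

lemma openin_ball_in_edge:
  assumes "e \<in> arcs G" "r \<le> t" "r \<le> len e - t"
  shows "openin (top_of_set X) (\<iota> ` open_ball_in_edge e t r)"
  unfolding open_ball_in_edge_def
proof (rule open_superlevel[OF tent_lipschitz[OF assms(2,3)], of "{e}" "{}"])
  show "{p \<in> gp. 0 < tent e t r p} \<subseteq> Vertex ` {} \<union> (\<Union>e\<in>{e}. ep e ` {0..len e})"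
  proof
    fix p assume p: "p \<in> {p \<in> gp. 0 < tent e t r p}"
    then obtain s where "p = Inner e s" "0 < s" "s < len e" by (cases p) (auto split: if_splits)
    then have "p = ep e s" "s \<in> {0..len e}" by auto
    then show "p \<in> Vertex ` {} \<union> (\<Union>e\<in>{e}. ep e ` {0..len e})" by blast
  qed
qed (use assms in auto)

lemma in_ball_in_edge:
  "p \<in> open_ball_in_edge e t r \<longleftrightarrow> e \<in> arcs G \<and> (\<exists>s. p = Inner e s \<and> 0 < s \<and> s < len e \<and> \<bar>s - t\<bar> < r)"
  by (cases p) (auto simp: open_ball_in_edge_def)

text \<open>The graph is open in its completion and has isolated vertices, so vertices can
  accumulate only at completion points outside the graph.\<close>

lemma graph_point_nhd:
  assumes "p \<in> gp"
  obtains T where "open T" "\<iota> p \<in> T" "T \<inter> X \<subseteq> \<iota> ` gp" "\<And>v. v \<in> verts G \<Longrightarrow> \<iota> (Vertex v) \<in> T \<Longrightarrow> p = Vertex v"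
proof -
  have "\<exists>S\<subseteq>gp. openin (top_of_set X) (\<iota> ` S) \<and> p \<in> S \<and> (\<forall>v\<in>verts G. Vertex v \<in> S \<longrightarrow> p = Vertex v)"
    using assms
  proof (cases rule: gp_cases)
    case (1 v)
    then show ?thesis using openin_star[of v 0] by (intro exI[of _ "star 0 v"]) (auto simp: star_def delta_def)
  next
    case (2 e t)
    then show ?thesis using openin_ball_in_edge[of e "min t (len e - t)" t]
      by (intro exI[of _ "open_ball_in_edge e t (min t (len e - t))"]) (auto simp: in_ball_in_edge)
  qed
  then obtain S where S: "S \<subseteq> gp" "openin (top_of_set X) (\<iota> ` S)" "p \<in> S"
    "\<And>v. v \<in> verts G \<Longrightarrow> Vertex v \<in> S \<Longrightarrow> p = Vertex v" by blast
  then obtain T where T: "open T" "\<iota> ` S = X \<inter> T" by (auto simp: openin_open)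
  have "p = Vertex v" if "v \<in> verts G" "\<iota> (Vertex v) \<in> T" for v
  proof -
    have "\<iota> (Vertex v) \<in> \<iota> ` S" using that T \<iota>_in_X by auto
    then have "Vertex v \<in> S" using S(1) that(1) by (subst (asm) inj_on_image_mem_iff[OF inj_\<iota>]) auto
    then show ?thesis using S(4) that by blast
  qed
  moreover have "\<iota> p \<in> T" "T \<inter> X \<subseteq> \<iota> ` gp" using T S by blast+
  ultimately show thesis using that[of T] T(1) by blast
qed

lemma finite_vertices_in_compact:
  assumes "compact C" "C \<subseteq> \<iota> ` gp"
  shows "finite {v \<in> verts G. \<iota> (Vertex v) \<in> C}"
proof -
  have "\<exists>T. open T \<and> \<iota> p \<in> T \<and> (\<forall>v\<in>verts G. \<iota> (Vertex v) \<in> T \<longrightarrow> p = Vertex v)" if "p \<in> gp" for p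
    using graph_point_nhd[OF that] by metis
  then obtain T where T: "\<And>p. p \<in> gp \<Longrightarrow> open (T p)" "\<And>p. p \<in> gp \<Longrightarrow> \<iota> p \<in> T p"
    "\<And>p v. p \<in> gp \<Longrightarrow> v \<in> verts G \<Longrightarrow> \<iota> (Vertex v) \<in> T p \<Longrightarrow> p = Vertex v" by metis
  have "C \<subseteq> (\<Union>p\<in>gp. T p)" using assms(2) T(2) by blast
  then obtain I where I: "I \<subseteq> gp" "finite I" "C \<subseteq> (\<Union>p\<in>I. T p)"
    using compactE_image[OF assms(1), of gp T] T(1) by metis
  have "Vertex ` {v \<in> verts G. \<iota> (Vertex v) \<in> C} \<subseteq> I"
  proof
    fix p :: "('v, 'e) gpoint" assume "p \<in> Vertex ` {v \<in> verts G. \<iota> (Vertex v) \<in> C}"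
    then obtain v where v: "p = Vertex v" "v \<in> verts G" "\<iota> (Vertex v) \<in> C" by blast
    then obtain q where "q \<in> I" "\<iota> (Vertex v) \<in> T q" using I(3) by blast
    then show "p \<in> I" using T(3)[of q v] v I(1) by blast
  qed
  then have "finite (Vertex ` {v \<in> verts G. \<iota> (Vertex v) \<in> C} :: ('v, 'e) gpoint set)"
    using I(2) by (rule finite_subset)
  then show ?thesis by (rule finite_imageD) (simp add: inj_on_def)
qed

section \<open>The boundary of the completion\<close>

lemma interior_iff: "Vertex v \<in> graph_interior G len \<longleftrightarrow> v \<in> verts G \<and> degree G v \<noteq> 1"
  "Inner e t \<in> graph_interior G len \<longleftrightarrow> Inner e t \<in> gp"
  by (auto simp: graph_interior_def graph_boundary_def)

abbreviation "bd \<equiv> completion_boundary G len X \<iota>"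

lemma boundary_vertex: "v \<in> verts G \<Longrightarrow> \<iota> (Vertex v) \<in> bd \<longleftrightarrow> degree G v = 1"
proof -
  assume v: "v \<in> verts G"
  have "\<iota> (Vertex v) \<in> \<iota> ` graph_interior G len \<longleftrightarrow> Vertex v \<in> graph_interior G len"
    using v by (intro inj_on_image_mem_iff[OF inj_\<iota>]) (auto simp: graph_interior_def)
  then show ?thesis using v \<iota>_in_X by (simp add: completion_boundary_def interior_iff)
qed

lemma boundary_inner: "Inner e t \<in> gp \<Longrightarrow> \<iota> (Inner e t) \<notin> bd"
  using interior_iff by (auto simp: completion_boundary_def)

lemma boundary_cases:
  assumes "x \<in> bd"
  obtains v where "v \<in> verts G" "degree G v = 1" "x = \<iota> (Vertex v)" | "x \<in> X" "x \<notin> \<iota> ` gp"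
proof (cases "x \<in> \<iota> ` gp")
  case True
  then obtain p where p: "p \<in> gp" "x = \<iota> p" by blast
  from p(1) show ?thesis
  proof (cases rule: gp_cases)
    case (1 v)
    then show ?thesis using that(1)[of v] assms p boundary_vertex by auto
  next
    case (2 e t)
    then show ?thesis using boundary_inner assms p by auto
  qed
qed (use assms that(2) in \<open>auto simp: completion_boundary_def\<close>)

lemma openin_interior: "openin (top_of_set X) (\<iota> ` graph_interior G len)"
proof -
  have "\<exists>S. openin (top_of_set X) S \<and> \<iota> p \<in> S \<and> S \<subseteq> \<iota> ` graph_interior G len" if "p \<in> graph_interior G len" for p
  proof -
    have "p \<in> gp" using that by (simp add: graph_interior_def)
    then show ?thesis
    proof (cases rule: gp_cases)
      case (1 v)
      have "star 0 v \<subseteq> graph_interior G len"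
      proof
        fix q assume q: "q \<in> star 0 v"
        then have "q \<in> gp" by (simp add: star_def)
        then show "q \<in> graph_interior G len"
        proof (cases rule: gp_cases)
          case (1 x)
          then show ?thesis using q that \<open>p = Vertex v\<close> by auto
        qed (simp add: interior_iff)
      qed
      then show ?thesis using 1 openin_star[of v 0] by (intro exI[of _ "\<iota> ` star 0 v"]) auto
    next
      case (2 e t)
      have "open_ball_in_edge e t (min t (len e - t)) \<subseteq> graph_interior G len"
        using 2 by (auto simp: in_ball_in_edge interior_iff)
      then show ?thesis using 2 openin_ball_in_edge[of e "min t (len e - t)" t]
        by (intro exI[of _ "\<iota> ` open_ball_in_edge e t (min t (len e - t))"]) (auto simp: in_ball_in_edge)
    qed
  qed
  then show ?thesis by (subst openin_subopen) blast
qed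

lemma compact_boundary: "compact bd"
proof -
  obtain T where T: "open T" "\<iota> ` graph_interior G len = X \<inter> T"
    using openin_interior by (auto simp: openin_open)
  then have "bd = X - T" by (auto simp: completion_boundary_def)
  then show ?thesis using compact_diff[OF compact_X T(1)] by simp
qed

lemma boundary_subset: "bd \<subseteq> X"
  by (auto simp: completion_boundary_def)

lemma lipschitz_extension:
  assumes F: "edge_lipschitz L F"
  obtains f where "L-lipschitz_on X f" "\<And>p. p \<in> gp \<Longrightarrow> f (\<iota> p) = F p"
proof -
  have "L-lipschitz_on (\<iota> ` gp) (\<lambda>x. F (inv_into gp \<iota> x))"
  proof (rule lipschitz_onI)
    fix x y assume "x \<in> \<iota> ` gp" "y \<in> \<iota> ` gp"
    then obtain p q where "p \<in> gp" "q \<in> gp" "x = \<iota> p" "y = \<iota> q" by blast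
    then show "dist (F (inv_into gp \<iota> x)) (F (inv_into gp \<iota> y)) \<le> L * dist x y"
      using dist_lipschitz[OF F, of p q] inv_into_f_f[OF inj_\<iota>] by (simp add: dist_real_def)
  qed (use F in \<open>simp add: edge_lipschitz_def\<close>)
  from lipschitz_extend_closure[OF this] obtain f where
    f: "L-lipschitz_on (closure (\<iota> ` gp)) f" "\<And>x. x \<in> \<iota> ` gp \<Longrightarrow> f x = F (inv_into gp \<iota> x)" by blast
  show thesis
    by (rule that[of f]) (use f lipschitz_on_subset[OF f(1) \<iota>_dense] inv_into_f_f[OF inj_\<iota>] in auto)
qed

lemma constant_by_density:
  assumes f: "continuous_on X f" and T: "open T" and eq: "\<And>q. q \<in> gp \<Longrightarrow> \<iota> q \<in> T \<Longrightarrow> f (\<iota> q) = (c::real)"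
    and x: "x \<in> X" "x \<in> T"
  shows "f x = c"
proof (rule ccontr)
  assume "f x \<noteq> c"
  have "openin (top_of_set X) (X \<inter> f -` (- {c}))"
    by (rule continuous_openin_preimage_gen[OF f]) (simp add: open_Compl)
  then obtain S where S: "open S" "X \<inter> f -` (- {c}) = X \<inter> S" by (auto simp: openin_open)
  then have "x \<in> S \<inter> T" using x \<open>f x \<noteq> c\<close> by blast
  moreover have "open (S \<inter> T)" using S T by blast
  ultimately obtain q where q: "q \<in> gp" "\<iota> q \<in> S" "\<iota> q \<in> T"
    using dense_point[OF _ x(1)] by (metis IntD1 IntD2)
  then have "f (\<iota> q) \<noteq> c" using S(2) \<iota>_in_X by blast
  then show False using eq q by blast
qed

end

section \<open>The harmonic extension\<close>

context graph_completion
begin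

definition vals :: "('x \<Rightarrow> real) \<Rightarrow> 'v \<Rightarrow> real" where
  "vals f v = f (\<iota> (Vertex v))"

definition edge_affine :: "('x \<Rightarrow> real) \<Rightarrow> bool" where
  "edge_affine f \<longleftrightarrow> (\<forall>p\<in>gp. f (\<iota> p) = interp (vals f) p)"

lemma on_edge_affine:
  assumes "e \<in> arcs G" "edge_affine f" "t \<in> {0..len e}"
  shows "on_edge G len \<iota> f e t = incr (vals f) e / len e * t + vals f (tail G e)"
  using assms interp_ep[of e t "vals f"] by (auto simp: on_edge_def edge_affine_def)

lemma edge_affineI:
  assumes "\<forall>e\<in>arcs G. \<exists>a b. \<forall>t\<in>{0..len e}. on_edge G len \<iota> f e t = a * t + b"
  shows "edge_affine f"
  unfolding edge_affine_def
proof
  fix p assume "p \<in> gp"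
  then show "f (\<iota> p) = interp (vals f) p"
  proof (cases rule: gp_cases)
    case (2 e t)
    then obtain a b where ab: "\<And>t. t \<in> {0..len e} \<Longrightarrow> f (\<iota> (ep e t)) = a * t + b"
      using assms unfolding on_edge_def by blast
    have "vals f (tail G e) = b" "vals f (head G e) = a * len e + b" "f (\<iota> p) = a * t + b"
      using ab[of 0] ab[of "len e"] ab[of t] 2 len_pos[of e] by (auto simp: vals_def)
    then show ?thesis using 2 by (simp add: incr_def)
  qed (simp add: vals_def)
qed

text \<open>The sign comes from orientation: \<open>vertex_flux\<close> takes derivatives directed
  towards \<open>v\<close>, \<open>lap\<close> takes differences directed away from it.\<close>

lemma vertex_flux_eq:
  assumes f: "edge_affine f"
  shows "vertex_flux G len \<iota> f v = - lap (vals f) v"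
proof -
  have der: "vector_derivative (on_edge G len \<iota> f e) (at t within {0..len e}) = incr (vals f) e / len e"
    if e: "e \<in> arcs G" and t: "t \<in> {0..len e}" for e t
  proof (rule vector_derivative_within_closed_interval)
    let ?g = "\<lambda>t. incr (vals f) e / len e * t + vals f (tail G e)"
    have "(?g has_vector_derivative incr (vals f) e / len e) (at t within {0..len e})"
      unfolding has_real_derivative_iff_has_vector_derivative[symmetric]
      using len_pos[OF e] by (auto intro!: derivative_eq_intros)
    then show "(on_edge G len \<iota> f e has_vector_derivative incr (vals f) e / len e) (at t within {0..len e})"
      by (rule has_vector_derivative_transform[OF t, rotated]) (simp add: on_edge_affine e f)
  qed (use t len_pos[OF e] in auto)
  have "(\<Sum>e\<in>in_arcs G v. vector_derivative (on_edge G len \<iota> f e) (at (len e) within {0..len e}))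
      = (\<Sum>e\<in>in_arcs G v. - ((vals f (tail G e) - vals f v) / len e))"
    by (intro sum.cong refl) (auto simp: der len_pos less_imp_le incr_def minus_divide_left)
  moreover have "(\<Sum>e\<in>out_arcs G v. - vector_derivative (on_edge G len \<iota> f e) (at 0 within {0..len e}))
      = (\<Sum>e\<in>out_arcs G v. - ((vals f (head G e) - vals f v) / len e))"
    by (intro sum.cong refl) (auto simp: der len_pos less_imp_le incr_def)
  ultimately show ?thesis by (simp add: vertex_flux_def lap_def sum_negf)
qed

lemma interp_inner:
  "interp u (Inner e t) = (1 - t / len e) * u (tail G e) + t / len e * u (head G e)"
  by (simp add: incr_def algebra_simps)

lemma interp_mono:
  assumes "p \<in> gp" "\<And>v. v \<in> verts G \<Longrightarrow> u v \<le> u' v"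
  shows "interp u p \<le> interp u' p"
  using assms(1)
proof (cases rule: gp_cases)
  case (2 e t)
  then show ?thesis
    unfolding \<open>p = _\<close> interp_inner
    by (intro add_mono mult_left_mono assms(2)) auto
qed (use assms in auto)

end

locale pointed_completion = graph_completion G len X \<iota> + pointed_metric_graph G len w
  for G :: "('v, 'e) pre_digraph" and len and X :: "'x::metric_space set" and \<iota> and w
begin

lemma w_gp: "Vertex w \<in> gp" and \<iota>_w_X: "\<iota> (Vertex w) \<in> X"
  using w_vert \<iota>_in_X by auto

text \<open>A positive maximum is attained at an interior graph point, hence at a vertex, as edges
  are affine. The strong maximum principle spreads it from vertex to vertex; degree-1 vertices do
  not interrupt this, since values there are at most 0. It thus arrives at \<open>w\<close>, a
  contradiction.\<close>

lemma maximum_principle: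
  assumes g: "continuous_on X g" "edge_affine g"
    and harm: "\<And>v. v \<in> verts G \<Longrightarrow> degree G v \<noteq> 1 \<Longrightarrow> v \<noteq> w \<Longrightarrow> lap (vals g) v = 0"
    and w: "g (\<iota> (Vertex w)) \<le> 0" and bd: "\<And>x. x \<in> bd \<Longrightarrow> g x \<le> 0" and x: "x \<in> X"
  shows "g x \<le> 0"
proof -
  obtain m where m: "m \<in> X" "\<And>y. y \<in> X \<Longrightarrow> g y \<le> g m"
    using continuous_attains_sup[OF compact_X _ g(1)] x by blast
  have "g m \<le> 0"
  proof (rule ccontr)
    assume "\<not> g m \<le> 0"
    then have pos: "0 < g m" by simp
    have le: "vals g v \<le> g m" if "v \<in> verts G" for v using m(2) \<iota>_in_X that by (simp add: vals_def)
    have "m \<notin> bd" using bd pos by force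
    then obtain p where p: "p \<in> graph_interior G len" "m = \<iota> p" using m(1) by (auto simp: completion_boundary_def)
    have "p \<in> gp" using p(1) by (simp add: graph_interior_def)
    then obtain v where v: "v \<in> verts G" "vals g v = g m"
    proof (cases rule: gp_cases)
      case (1 v)
      then show ?thesis using that p(2) by (simp add: vals_def)
    next
      case (2 e t)
      \<comment> \<open>An affine function that is maximal at an inner point of an edge is maximal
        at the tail too.\<close>
      let ?s = "t / len e"
      have s: "0 < ?s" "?s < 1" using 2 by auto
      have "g m = (1 - ?s) * vals g (tail G e) + ?s * vals g (head G e)"
        using g(2) \<open>p \<in> gp\<close> p(2) 2 unfolding edge_affine_def by (simp add: interp_inner del: interp.simps)
      moreover have "?s * vals g (head G e) \<le> ?s * g m"
        using s 2 by (intro mult_left_mono le) auto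
      ultimately have "(1 - ?s) * g m \<le> (1 - ?s) * vals g (tail G e)" by (simp add: algebra_simps)
      then have "g m \<le> vals g (tail G e)" using s by simp
      then show ?thesis using that[of "tail G e"] le[of "tail G e"] 2 by simp
    qed
    have "vals g w = g m"
    proof (rule connected_induct[OF graph_connected w_vert v(1)])
      fix e assume e: "e \<in> arcs G"
      have int: "lap (vals g) y = 0" if "y \<in> verts G" "vals g y = g m" for y
      proof (rule harm[OF that(1)])
        show "degree G y \<noteq> 1" using bd[of "\<iota> (Vertex y)"] boundary_vertex[OF that(1)] that(2) pos by (auto simp: vals_def)
        show "y \<noteq> w" using w that(2) pos by (auto simp: vals_def)
      qed
      show "(vals g (tail G e) = g m) = (vals g (head G e) = g m)"
      proof
        assume t: "vals g (tail G e) = g m"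
        show "vals g (head G e) = g m"
          using lap_eq_0_extremal(1)[OF int[OF _ t] _ _ e refl] e le t by simp
      next
        assume t: "vals g (head G e) = g m"
        show "vals g (tail G e) = g m"
          using lap_eq_0_extremal(2)[OF int[OF _ t] _ _ e refl] e le t by simp
      qed
    qed (rule v(2))
    then show False using w pos by (simp add: vals_def)
  qed
  then show ?thesis using m(2)[OF x] by linarith
qed

text \<open>The edges carrying \<open>u\<close> form a compact set that misses \<open>x\<close>, so
  \<open>u\<close> vanishes at graph points arbitrarily close to \<open>x\<close>. The slope bound
  turns this into a rate that does not depend on \<open>u\<close> and so survives the
  supremum.\<close>

lemma subsolution_decay:
  assumes u: "u \<in> subsolutions" and x: "x \<in> X" "x \<notin> \<iota> ` gp" and p: "p \<in> gp"
  shows "interp u p \<le> conductance w * dist (\<iota> p) x"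
proof (rule field_le_epsilon)
  fix \<epsilon> :: real assume \<epsilon>: "0 < \<epsilon>"
  define L where "L = conductance w"
  have L: "0 \<le> L" using conductance_nonneg by (simp add: L_def)
  define \<delta> where "\<delta> = \<epsilon> / (L + 1)"
  have \<delta>: "0 < \<delta>" using L \<epsilon> by (simp add: \<delta>_def)
  define D where "D = {v \<in> verts G. u v \<noteq> 0}"
  have D: "finite D" "D \<subseteq> verts G" using subsolutionD(3)[OF u] by (auto simp: D_def)
  define K where "K = \<iota> ` Vertex ` D \<union> (\<Union>e\<in>arcs_at D. (\<lambda>t. \<iota> (ep e t)) ` {0..len e})"
  have "compact K" unfolding K_def using D finite_arcs_at[OF D] arcs_at_subset[of D]
    by (intro compact_Un compact_UN edge_compact finite_imp_compact) auto
  then have K: "closed K" by (rule compact_imp_closed)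
  have "K \<subseteq> \<iota> ` gp" using D arcs_at_subset[of D] by (auto simp: K_def)
  then have "x \<notin> K" using x by blast
  then have "x \<in> ball x \<delta> \<inter> - K" using \<delta> by simp
  moreover have "open (ball x \<delta> \<inter> - K)" using K by (intro open_Int open_ball open_Compl)
  ultimately obtain q where q: "q \<in> gp" "\<iota> q \<in> ball x \<delta> \<inter> - K" using dense_point x(1) by blast
  have "interp u q = 0"
    using q(1)
  proof (cases rule: gp_cases)
    case (1 v)
    then show ?thesis using q(2) by (auto simp: K_def D_def)
  next
    case (2 e t)
    have "e \<notin> arcs_at D"
    proof
      assume "e \<in> arcs_at D"
      moreover have "\<iota> q = \<iota> (ep e t)" "t \<in> {0..len e}" using 2 by auto
      ultimately show False using q(2) unfolding K_def by blast
    qed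
    then have "u (tail G e) = 0" "u (head G e) = 0" using 2 by (auto simp: mem_arcs_at D_def)
    then show ?thesis using 2 by (simp add: incr_def)
  qed
  moreover have "\<bar>interp u p - interp u q\<bar> \<le> L * dist (\<iota> p) (\<iota> q)"
    using subsolution_slope[OF u] L
    by (intro dist_lipschitz interp_lipschitz p q) (auto simp: L_def)
  moreover have "L * dist (\<iota> p) (\<iota> q) \<le> L * (dist (\<iota> p) x + \<delta>)"
    using q(2) dist_triangle[of "\<iota> p" "\<iota> q" x] L by (intro mult_left_mono) (auto simp: dist_commute)
  moreover have "L * \<delta> \<le> \<epsilon>" using L \<epsilon> by (simp add: \<delta>_def field_simps)
  ultimately show "interp u p \<le> conductance w * dist (\<iota> p) x + \<epsilon>"
    by (simp add: L_def[symmetric] distrib_left)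
qed

lemma perron_decay:
  assumes x: "x \<in> X" "x \<notin> \<iota> ` gp" and p: "p \<in> gp"
  shows "interp perron p \<le> conductance w * dist (\<iota> p) x"
proof (rule field_le_epsilon)
  fix \<epsilon> :: real assume \<epsilon>: "0 < \<epsilon>"
  have "\<exists>u\<in>subsolutions. interp perron p \<le> interp u p + \<epsilon>"
    using p
  proof (cases rule: gp_cases)
    case (1 v)
    then show ?thesis using perron_approx1[OF \<epsilon>, of v] by (force intro: less_imp_le)
  next
    case (2 e t)
    obtain u where u: "u \<in> subsolutions" "\<And>v. v \<in> {tail G e, head G e} \<Longrightarrow> perron v - \<epsilon> < u v"
      using perron_approx[OF _ \<epsilon>, of "{tail G e, head G e}"] by blast
    let ?s = "t / len e"
    have "interp perron p = (1 - ?s) * perron (tail G e) + ?s * perron (head G e)"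
      using 2 by (simp only: interp_inner)
    also have "\<dots> \<le> (1 - ?s) * (u (tail G e) + \<epsilon>) + ?s * (u (head G e) + \<epsilon>)"
      using u(2)[of "tail G e"] u(2)[of "head G e"] 2 by (intro add_mono mult_left_mono) auto
    also have "\<dots> = interp u p + \<epsilon>" unfolding \<open>p = _\<close> interp_inner by (simp add: algebra_simps)
    finally show ?thesis using u(1) by blast
  qed
  then show "interp perron p \<le> conductance w * dist (\<iota> p) x + \<epsilon>"
    using subsolution_decay[OF _ x p] by force
qed

lemma harmonic_extension_exists:
  obtains f where "is_harmonic_extension G len X \<iota> w f"
proof -
  define L where "L = conductance w"
  have L: "0 \<le> L" using conductance_nonneg by (simp add: L_def)
  have "edge_lipschitz L (interp perron)"
    using perron_slope L by (intro interp_lipschitz) (auto simp: L_def)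
  then obtain f where f: "L-lipschitz_on X f" "\<And>p. p \<in> gp \<Longrightarrow> f (\<iota> p) = interp perron p"
    using lipschitz_extension by blast
  have nonneg: "0 \<le> interp perron p" if "p \<in> gp" for p
  proof -
    have "interp (\<lambda>_. 0) p \<le> interp perron p" using that perron_nonneg by (intro interp_mono)
    then show ?thesis using that by (cases p) (auto simp: incr_def)
  qed
  have vals: "vals f v = perron v" if "v \<in> verts G" for v using f(2)[of "Vertex v"] that by (simp add: vals_def)
  have "interp (vals f) p = interp perron p" if "p \<in> gp" for p
    using that vals by (cases p) (auto simp: incr_def)
  then have aff: "edge_affine f" using f(2) by (simp add: edge_affine_def)
  have "is_harmonic_extension G len X \<iota> w f"
    unfolding is_harmonic_extension_def
  proof (intro conjI ballI impI)
    show "continuous_on X f" using f(1) by (rule lipschitz_on_continuous_on)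
    show "f (\<iota> (Vertex w)) = 1" using f(2)[OF w_gp] perron_w by simp
    show "\<exists>a b. \<forall>t\<in>{0..len e}. on_edge G len \<iota> f e t = a * t + b" if "e \<in> arcs G" for e
      using on_edge_affine[OF that aff] by blast
    show "vertex_flux G len \<iota> f v = 0" if v: "v \<in> verts G" "Vertex v \<in> graph_interior G len \<and> v \<noteq> w" for v
    proof -
      have "lap (vals f) v = lap perron v"
        using lap_mono[of "vals f" perron v] lap_mono[of perron "vals f" v] vals v(1) by force
      also have "\<dots> = 0" using v by (intro perron_harmonic) (auto simp: interior_iff)
      finally show ?thesis by (simp add: vertex_flux_eq[OF aff])
    qed
    show "f x = 0" if "x \<in> bd" for x
      using that
    proof (cases rule: boundary_cases)
      case (1 v)
      then show ?thesis using f(2)[of "Vertex v"] perron_boundary by simp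
    next
      case 2
      have "\<bar>f x\<bar> \<le> 0"
      proof (rule field_le_epsilon)
        fix \<epsilon> :: real assume \<epsilon>: "0 < \<epsilon>"
        \<comment> \<open>One \<open>L * \<delta>\<close> pays for moving from \<open>x\<close> to a
          nearby graph point, another for the size of the value at that point.\<close>
        define \<delta> where "\<delta> = \<epsilon> / (2 * L + 1)"
        have "0 < \<delta>" using \<epsilon> L by (simp add: \<delta>_def)
        then obtain p where p: "p \<in> gp" "\<iota> p \<in> ball x \<delta>" using dense_point[of "ball x \<delta>" x] 2 by auto
        have "\<bar>f x - f (\<iota> p)\<bar> \<le> L * dist x (\<iota> p)"
          using lipschitz_onD[OF f(1) 2(1) \<iota>_in_X[OF p(1)]] by (simp add: dist_real_def)
        moreover have "\<bar>f (\<iota> p)\<bar> \<le> L * dist x (\<iota> p)"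
          using f(2)[OF p(1)] nonneg[OF p(1)] perron_decay[OF 2 p(1)] by (simp add: L_def dist_commute)
        moreover have "L * dist x (\<iota> p) \<le> L * \<delta>" using p(2) L by (intro mult_left_mono) auto
        moreover have "2 * (L * \<delta>) \<le> \<epsilon>" using L \<epsilon> by (simp add: \<delta>_def field_simps)
        ultimately show "\<bar>f x\<bar> \<le> 0 + \<epsilon>" by linarith
      qed
      then show ?thesis by simp
    qed
  qed
  then show thesis by (rule that)
qed

lemma harmonicD:
  assumes "is_harmonic_extension G len X \<iota> w f"
  shows "continuous_on X f" "f (\<iota> (Vertex w)) = 1" "x \<in> bd \<Longrightarrow> f x = 0" "edge_affine f"
    "v \<in> verts G \<Longrightarrow> degree G v \<noteq> 1 \<Longrightarrow> v \<noteq> w \<Longrightarrow> lap (vals f) v = 0"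
proof -
  show aff: "edge_affine f" using assms by (intro edge_affineI) (simp add: is_harmonic_extension_def)
  show "continuous_on X f" "f (\<iota> (Vertex w)) = 1" "x \<in> bd \<Longrightarrow> f x = 0"
    using assms by (auto simp: is_harmonic_extension_def)
  show "v \<in> verts G \<Longrightarrow> degree G v \<noteq> 1 \<Longrightarrow> v \<noteq> w \<Longrightarrow> lap (vals f) v = 0"
    using assms vertex_flux_eq[OF aff, of v] by (auto simp: is_harmonic_extension_def interior_iff)
qed

text \<open>The difference is 0 on the boundary and at \<open>w\<close>, and harmonic at the other
  vertices. Applied in both directions, this is uniqueness.\<close>

lemma harmonic_le:
  assumes f: "is_harmonic_extension G len X \<iota> w f" and g: "is_harmonic_extension G len X \<iota> w g" and x: "x \<in> X"
  shows "f x \<le> g x"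
proof -
  have v: "vals (\<lambda>x. f x - g x) = (\<lambda>v. vals f v - vals g v)" by (simp add: vals_def fun_eq_iff)
  have "(\<lambda>x. f x - g x) x \<le> 0"
  proof (rule maximum_principle[OF _ _ _ _ _ x])
    show "continuous_on X (\<lambda>x. f x - g x)" by (intro continuous_intros harmonicD f g)
    have "interp (\<lambda>v. vals f v - vals g v) p = interp (vals f) p - interp (vals g) p" for p
      by (cases p) (auto simp: incr_def algebra_simps)
    then show "edge_affine (\<lambda>x. f x - g x)"
      using harmonicD(4)[OF f] harmonicD(4)[OF g] by (simp add: edge_affine_def v)
    show "lap (vals (\<lambda>x. f x - g x)) v = 0" if "v \<in> verts G" "degree G v \<noteq> 1" "v \<noteq> w" for v
      using harmonicD(5)[OF f that] harmonicD(5)[OF g that] by (simp add: \<open>vals _ = _\<close> lap_diff)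
  qed (simp_all add: harmonicD(2,3)[OF f] harmonicD(2,3)[OF g])
  then show ?thesis by simp
qed

section \<open>The canonical harmonic extension and its positivity\<close>

abbreviation "h \<equiv> harmonic_extension G len X \<iota> w"

text \<open>Restriction to \<open>X\<close> selects the extensional representative. The conditions
  survive because they evaluate the function only on \<open>X\<close>: \<open>edge_point\<close>
  clamps its parameter, so even \<open>on_edge\<close> beyond an end stays in
  \<open>X\<close>.\<close>

lemma harmonic_extension_harmonic: "is_harmonic_extension G len X \<iota> w h"
proof -
  obtain f where f: "is_harmonic_extension G len X \<iota> w f" using harmonic_extension_exists .
  let ?f = "restrict f X"
  have on: "on_edge G len \<iota> ?f e = on_edge G len \<iota> f e" if "e \<in> arcs G" for e
    using that \<iota>_in_X by (auto simp: on_edge_def fun_eq_iff)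
  have fl: "vertex_flux G len \<iota> ?f v = vertex_flux G len \<iota> f v" for v
    unfolding vertex_flux_def by (intro arg_cong2[where f = "(+)"] sum.cong refl) (auto simp: on)
  have harm: "is_harmonic_extension G len X \<iota> w ?f"
    using f \<iota>_w_X boundary_subset
    by (auto simp: is_harmonic_extension_def on fl cong: continuous_on_cong)
  have "?f \<in> extensional X \<and> is_harmonic_extension G len X \<iota> w ?f" using harm by simp
  moreover have "g = ?f" if "g \<in> extensional X \<and> is_harmonic_extension G len X \<iota> w g" for g
  proof (rule extensionalityI[of _ X])
    show "g x = ?f x" if "x \<in> X" for x
      using harmonic_le[OF harm _ that] harmonic_le[OF _ harm that] \<open>g \<in> extensional X \<and> _\<close> by (intro antisym) auto
  qed (use that in auto)
  ultimately show ?thesis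
    unfolding harmonic_extension_def using theI[of "\<lambda>f. f \<in> extensional X \<and> is_harmonic_extension G len X \<iota> w f" ?f]
    by blast
qed

lemmas h_cont = harmonicD(1)[OF harmonic_extension_harmonic]
  and h_w = harmonicD(2)[OF harmonic_extension_harmonic]
  and h_bd = harmonicD(3)[OF harmonic_extension_harmonic]
  and h_affine = harmonicD(4)[OF harmonic_extension_harmonic]
  and h_lap = harmonicD(5)[OF harmonic_extension_harmonic]

lemma h_nonneg:
  assumes "x \<in> X" shows "0 \<le> h x"
proof -
  have v: "vals (\<lambda>x. - h x) = (\<lambda>v. - vals h v)" by (simp add: vals_def fun_eq_iff)
  have "(\<lambda>x. - h x) x \<le> 0"
  proof (rule maximum_principle[OF _ _ _ _ _ assms])
    show "continuous_on X (\<lambda>x. - h x)" by (intro continuous_intros h_cont)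
    have "interp (\<lambda>v. - vals h v) p = - interp (vals h) p" for p
      by (cases p) (auto simp: incr_def algebra_simps)
    then show "edge_affine (\<lambda>x. - h x)" using h_affine by (simp add: edge_affine_def v)
    show "lap (vals (\<lambda>x. - h x)) v = 0" if "v \<in> verts G" "degree G v \<noteq> 1" "v \<noteq> w" for v
      using h_lap[OF that] by (simp add: \<open>vals _ = _\<close> lap_uminus)
  qed (simp_all add: h_w h_bd)
  then show ?thesis by simp
qed

lemma h_vertex_nonneg: "v \<in> verts G \<Longrightarrow> 0 \<le> vals h v"
  using h_nonneg \<iota>_in_X by (simp add: vals_def)

lemma degree_one_unique_neighbour:
  assumes "degree G v = 1" "e \<in> in_arcs G v \<union> out_arcs G v" "e' \<in> in_arcs G v \<union> out_arcs G v" "v \<in> verts G"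
  shows "e = e'" "tail G e \<noteq> head G e"
proof -
  have f: "finite (in_arcs G v)" "finite (out_arcs G v)" using finite_inc assms(4) by auto
  have c: "card (in_arcs G v) + card (out_arcs G v) = 1"
    using assms(1) by (simp add: degree_def in_degree_def out_degree_def)
  have "(\<exists>a. in_arcs G v = {a} \<and> out_arcs G v = {}) \<or> (\<exists>a. out_arcs G v = {a} \<and> in_arcs G v = {})"
  proof (cases "card (in_arcs G v) = 1")
    case True
    then show ?thesis using c f by (auto simp: card_1_singleton_iff)
  next
    case False
    then have "card (in_arcs G v) = 0" "card (out_arcs G v) = 1" using c by linarith+
    then show ?thesis using f by (auto simp: card_1_singleton_iff)
  qed
  then have 1: "e = e'" and 2: "\<not> (e \<in> in_arcs G v \<and> e \<in> out_arcs G v)"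
    using assms(2,3) by (elim disjE exE conjE; simp del: in_in_arcs_conv in_out_arcs_conv)+
  show "e = e'" by (rule 1)
  show "tail G e \<noteq> head G e" using 2 assms(2) by auto
qed

text \<open>The zeros of \<open>h\<close> at interior vertices propagate to all neighbours; a vertex of degree 1
  cannot be passed through, so the invariant at such a vertex speaks about its only neighbour.\<close>

lemma h_pos:
  assumes "v \<in> verts G" "degree G v \<noteq> 1"
  shows "0 < vals h v"
proof -
  define nb where "nb a b \<longleftrightarrow> (\<exists>e\<in>arcs G. (tail G e = a \<and> head G e = b) \<or> (tail G e = b \<and> head G e = a))" for a b
  have nb_sym: "nb b a" if "nb a b" for a b using that by (auto simp: nb_def)
  have nb_verts: "a \<in> verts G" "b \<in> verts G" if "nb a b" for a b using that by (auto simp: nb_def)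
  have nb_uniq: "b = c" if "degree G a = 1" "nb a b" "nb a c" for a b c
  proof -
    obtain e where e: "e \<in> arcs G" "(tail G e = a \<and> head G e = b) \<or> (tail G e = b \<and> head G e = a)"
      using \<open>nb a b\<close> by (auto simp: nb_def)
    obtain e' where e': "e' \<in> arcs G" "(tail G e' = a \<and> head G e' = c) \<or> (tail G e' = c \<and> head G e' = a)"
      using \<open>nb a c\<close> by (auto simp: nb_def)
    have m: "e \<in> in_arcs G a \<union> out_arcs G a" "e' \<in> in_arcs G a \<union> out_arcs G a" using e e' by auto
    show ?thesis
      using degree_one_unique_neighbour[OF that(1) m] nb_verts[OF that(2)] e(2) e'(2) by auto
  qed
  have zero: "vals h b = 0" if "nb a b" "degree G a \<noteq> 1" "vals h a = 0" for a b
  proof -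
    have "a \<noteq> w" using that(3) h_w by (auto simp: vals_def)
    \<comment> \<open>At a zero of \<open>h\<close> the function \<open>-h\<close> is maximal among
      the vertices, so the strong maximum principle makes all neighbours zeros.\<close>
    then have "lap (\<lambda>v. - vals h v) a = 0" using h_lap nb_verts[OF that(1)] that(2) by (simp add: lap_uminus)
    moreover have "- vals h x \<le> - vals h a" if "x \<in> verts G" for x
      using h_vertex_nonneg[OF that] \<open>vals h a = 0\<close> by simp
    ultimately show ?thesis
      using lap_eq_0_extremal[of "\<lambda>v. - vals h v" a] nb_verts[OF that(1)] that(1,3) by (auto simp: nb_def)
  qed
  define P where "P a \<longleftrightarrow> (degree G a \<noteq> 1 \<and> 0 < vals h a) \<or>
    (degree G a = 1 \<and> (\<forall>b. nb a b \<longrightarrow> degree G b \<noteq> 1 \<longrightarrow> 0 < vals h b))" for a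
  have step: "P b" if "P a" "nb a b" for a b
  proof (cases "degree G b = 1")
    case True
    have "0 < vals h c" if "nb b c" "degree G c \<noteq> 1" for c
    proof -
      have "c = a" using nb_uniq[OF True that(1) nb_sym[OF \<open>nb a b\<close>]] .
      then show ?thesis using \<open>P a\<close> that(2) by (auto simp: P_def)
    qed
    then show ?thesis using True by (auto simp: P_def)
  next
    case False
    have "0 < vals h b"
    proof (cases "degree G a = 1")
      case True
      then show ?thesis using that False by (auto simp: P_def)
    next
      case a: False
      then have "vals h a \<noteq> 0" using that by (auto simp: P_def)
      then have "vals h b \<noteq> 0" using zero[OF nb_sym[OF that(2)] False] by blast
      then show ?thesis using h_vertex_nonneg nb_verts[OF that(2)] by (simp add: less_le)
    qed
    then show ?thesis using False by (simp add: P_def)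
  qed
  have "P v"
  proof (rule connected_induct[OF graph_connected assms(1) w_vert])
    show "P w" using w_degree h_w by (simp add: P_def vals_def)
    show "P (tail G e) = P (head G e)" if "e \<in> arcs G" for e
      using step[of "tail G e" "head G e"] step[of "head G e" "tail G e"] that by (auto simp: nb_def)
  qed
  then show ?thesis using assms(2) by (simp add: P_def)
qed

end

section \<open>Flux and cut sets\<close>

context graph_completion
begin

section \<open>Integration by parts for eventually flat functions\<close>

lemma open_edge_preimage:
  assumes e: "e \<in> arcs G" and U: "openin (top_of_set X) U"
  shows "open {t. \<iota> (ep e t) \<in> U}"
proof -
  obtain T where T: "open T" "U = X \<inter> T" using U by (auto simp: openin_open)
  have "{t. \<iota> (ep e t) \<in> U} = (\<lambda>t. \<iota> (ep e t)) -` T" using T(2) e \<iota>_in_X by auto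
  moreover have "open ((\<lambda>t. \<iota> (ep e t)) -` T)"
    using edge_continuous[OF e, of UNIV] T(1) by (simp add: open_vimage)
  ultimately show ?thesis by simp
qed

lemma on_edge_continuous:
  assumes "e \<in> arcs G" "continuous_on X \<phi>"
  shows "continuous_on S (on_edge G len \<iota> \<phi> e)"
proof -
  have "continuous_on S (\<lambda>t. \<phi> (\<iota> (ep e t)))"
    using assms \<iota>_in_X by (intro continuous_on_compose2[OF assms(2) edge_continuous]) auto
  then show ?thesis by (simp add: on_edge_def[abs_def])
qed

lemma eventually_flat_deriv_ends:
  assumes \<phi>: "\<phi> \<in> eventually_flat G len X \<iota>" and e: "e \<in> arcs G"
  obtains \<delta> where "0 < \<delta>" "\<And>t. 0 < t \<Longrightarrow> t < len e \<Longrightarrow> t < \<delta> \<or> len e - \<delta> < t \<Longrightarrow>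
    deriv (on_edge G len \<iota> \<phi> e) t = 0"
proof -
  have "\<exists>\<delta>>0. \<forall>t. 0 < t \<and> t < len e \<and> \<bar>t - s\<bar> < \<delta> \<longrightarrow> deriv (on_edge G len \<iota> \<phi> e) t = 0"
    if s: "ep e s = Vertex v" "v \<in> verts G" for s v
  proof -
    obtain U where U: "openin (top_of_set X) U" "\<iota> (Vertex v) \<in> U"
      "\<And>t. t \<in> {0<..<len e} \<Longrightarrow> \<iota> (ep e t) \<in> U \<Longrightarrow> deriv (on_edge G len \<iota> \<phi> e) t = 0"
    proof -
      have "\<exists>U. openin (top_of_set X) U \<and> \<iota> (Vertex v) \<in> U \<and> (\<forall>e\<in>arcs G. \<forall>t\<in>{0<..<len e}.
          \<iota> (ep e t) \<in> U \<longrightarrow> deriv (on_edge G len \<iota> \<phi> e) t = 0)"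
        using \<phi> unfolding eventually_flat_def mem_Collect_eq by (elim conjE) (erule bspec[OF _ s(2)])
      then show thesis using that e by metis
    qed
    have "open {t. \<iota> (ep e t) \<in> U}" by (rule open_edge_preimage[OF e U(1)])
    moreover have "s \<in> {t. \<iota> (ep e t) \<in> U}" using s U(2) by simp
    ultimately obtain \<delta> where "0 < \<delta>" "ball s \<delta> \<subseteq> {t. \<iota> (ep e t) \<in> U}" using openE by blast
    then show ?thesis using U(3) by (intro exI[of _ \<delta>]) (auto simp: subset_iff dist_real_def abs_minus_commute)
  qed
  from this[of 0 "tail G e"] this[of "len e" "head G e"] e obtain \<delta> \<delta>' where
    "0 < \<delta>" "\<And>t. 0 < t \<Longrightarrow> t < len e \<Longrightarrow> \<bar>t - 0\<bar> < \<delta> \<Longrightarrow> deriv (on_edge G len \<iota> \<phi> e) t = 0"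
    "0 < \<delta>'" "\<And>t. 0 < t \<Longrightarrow> t < len e \<Longrightarrow> \<bar>t - len e\<bar> < \<delta>' \<Longrightarrow> deriv (on_edge G len \<iota> \<phi> e) t = 0"
    by auto
  then show thesis by (intro that[of "min \<delta> \<delta>'"]) auto
qed

lemma eventually_flat_has_deriv:
  assumes \<phi>: "\<phi> \<in> eventually_flat G len X \<iota>" and e: "e \<in> arcs G" and t: "0 < t" "t < len e"
  shows "(on_edge G len \<iota> \<phi> e has_real_derivative deriv (on_edge G len \<iota> \<phi> e) t) (at t)"
    "(deriv (on_edge G len \<iota> \<phi> e) has_real_derivative (deriv ^^ 2) (on_edge G len \<iota> \<phi> e) t) (at t)"
proof -
  have "(deriv ^^ n) (on_edge G len \<iota> \<phi> e) differentiable (at t)" for n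
    using \<phi> e t unfolding eventually_flat_def by auto
  from this[of 0] this[of 1] show
    "(on_edge G len \<iota> \<phi> e has_real_derivative deriv (on_edge G len \<iota> \<phi> e) t) (at t)"
    "(deriv (on_edge G len \<iota> \<phi> e) has_real_derivative (deriv ^^ 2) (on_edge G len \<iota> \<phi> e) t) (at t)"
    by (simp_all add: DERIV_deriv_iff_real_differentiable numeral_2_eq_2)
qed

lemma on_edge_ends:
  "on_edge G len \<iota> \<phi> e 0 = vals \<phi> (tail G e)"
  "e \<in> arcs G \<Longrightarrow> on_edge G len \<iota> \<phi> e (len e) = vals \<phi> (head G e)"
  by (simp_all add: on_edge_def vals_def)

text \<open>Integration by parts on one edge: \<open>\<phi>'\<close> vanishes near both ends and \<open>f'\<close> is constant.\<close>

lemma edge_integral: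
  assumes f: "edge_affine f" and \<phi>: "\<phi> \<in> eventually_flat G len X \<iota>" and e: "e \<in> arcs G"
  shows "integral {0..len e} (\<lambda>t. on_edge G len \<iota> f e t * (deriv ^^ 2) (on_edge G len \<iota> \<phi> e) t)
    = - (incr (vals f) e * incr (vals \<phi>) e / len e)"
proof -
  let ?g = "on_edge G len \<iota> \<phi> e" and ?a = "incr (vals f) e / len e" and ?b = "vals f (tail G e)"
  \<comment> \<open>\<open>eventually_flat\<close> speaks of the derivative only on the open edge.
    Cut off by 0, it is continuous everywhere because it vanishes near both ends.\<close>
  define d where "d t = (if 0 < t \<and> t < len e then deriv ?g t else 0)" for t
  obtain \<delta> where \<delta>: "0 < \<delta>" "\<And>t. 0 < t \<Longrightarrow> t < len e \<Longrightarrow> t < \<delta> \<or> len e - \<delta> < t \<Longrightarrow> deriv ?g t = 0"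
    using eventually_flat_deriv_ends[OF \<phi> e] by blast
  have d_der: "(d has_real_derivative (deriv ^^ 2) ?g t) (at t)" if "0 < t" "t < len e" for t
    by (rule has_field_derivative_transform_within_open[OF eventually_flat_has_deriv(2)[OF \<phi> e that], of "{0<..<len e}"])
      (use that in \<open>auto simp: d_def\<close>)
  have d0: "d t = 0" if "t < \<delta> \<or> len e - \<delta> < t" for t
    using \<delta>(2)[of t] that by (auto simp: d_def)
  have "isCont d t" for t
  proof -
    consider "t < \<delta>" | "len e - \<delta> < t" | "0 < t" "t < len e" using \<delta>(1) len_pos[OF e] by linarith
    then show ?thesis
    proof cases
      case 1
      have "(d has_real_derivative 0) (at t)"
        by (rule has_field_derivative_transform_within_open[of "\<lambda>_. 0" _ _ "{..<\<delta>}"]) (use 1 d0 in auto)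
      then show ?thesis by (rule DERIV_isCont)
    next
      case 2
      have "(d has_real_derivative 0) (at t)"
        by (rule has_field_derivative_transform_within_open[of "\<lambda>_. 0" _ _ "{len e - \<delta><..}"]) (use 2 d0 in auto)
      then show ?thesis by (rule DERIV_isCont)
    next
      case 3
      then show ?thesis using d_der DERIV_isCont by blast
    qed
  qed
  then have d_cont: "continuous_on {0..len e} d" by (simp add: continuous_at_imp_continuous_on)
  \<comment> \<open>For affine f, the function f phi' - f' phi is an antiderivative of f phi''; its
    first term vanishes at both ends.\<close>
  let ?H = "\<lambda>t. (?a * t + ?b) * d t - ?a * ?g t"
  have "((\<lambda>t. (?a * t + ?b) * (deriv ^^ 2) ?g t) has_integral (?H (len e) - ?H 0)) {0..len e}"
  proof (rule fundamental_theorem_of_calculus_interior)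
    have "continuous_on X \<phi>" using \<phi> by (simp add: eventually_flat_def)
    then show "continuous_on {0..len e} ?H"
      by (intro continuous_intros d_cont on_edge_continuous e)
    fix t assume t: "t \<in> {0<..<len e}"
    have lin: "((\<lambda>t. ?a * t + ?b) has_real_derivative ?a) (at t)"
      using len_pos[OF e] by (auto intro!: derivative_eq_intros)
    have d1: "(d has_real_derivative (deriv ^^ 2) ?g t) (at t)" using t by (intro d_der) auto
    have g1: "(?g has_real_derivative d t) (at t)"
      using eventually_flat_has_deriv(1)[OF \<phi> e, of t] t by (simp add: d_def)
    show "(?H has_vector_derivative (?a * t + ?b) * (deriv ^^ 2) ?g t) (at t)"
      unfolding has_real_derivative_iff_has_vector_derivative[symmetric]
      using DERIV_diff[OF DERIV_mult'[OF lin d1] DERIV_cmult[OF g1, of ?a]] by simp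
  qed (use len_pos[OF e] in simp)
  then have "((\<lambda>t. on_edge G len \<iota> f e t * (deriv ^^ 2) ?g t) has_integral (?H (len e) - ?H 0)) {0..len e}"
    by (rule has_integral_eq[rotated]) (simp add: on_edge_affine[OF e f])
  moreover have "?H (len e) - ?H 0 = - (incr (vals f) e * incr (vals \<phi>) e / len e)"
    using e by (simp add: d_def on_edge_ends incr_def[of "vals \<phi>"] algebra_simps diff_divide_distrib)
  ultimately show ?thesis by (simp add: integral_unique)
qed

lemma eventually_flat_finite_incr:
  assumes \<phi>: "\<phi> \<in> eventually_flat G len X \<iota>"
  shows "finite {e \<in> arcs G. incr (vals \<phi>) e \<noteq> 0}"
proof -
  obtain F where F: "finite F" "F \<subseteq> arcs G"
    "\<And>e t. e \<in> arcs G - F \<Longrightarrow> t \<in> {0<..<len e} \<Longrightarrow> deriv (on_edge G len \<iota> \<phi> e) t = 0"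
  proof -
    have "\<exists>F. finite F \<and> F \<subseteq> arcs G \<and>
        (\<forall>e\<in>arcs G - F. \<forall>t\<in>{0<..<len e}. deriv (on_edge G len \<iota> \<phi> e) t = 0)"
      using \<phi> unfolding eventually_flat_def mem_Collect_eq by (elim conjE)
    then show thesis using that by metis
  qed
  have "incr (vals \<phi>) e = 0" if e: "e \<in> arcs G - F" for e
  proof -
    have "on_edge G len \<iota> \<phi> e (len e) = on_edge G len \<iota> \<phi> e 0"
    proof (rule DERIV_isconst_end[of 0 "len e" "on_edge G len \<iota> \<phi> e"])
      show "0 < len e" using e len_pos by blast
      show "continuous_on {0..len e} (on_edge G len \<iota> \<phi> e)"
        using \<phi> e by (intro on_edge_continuous) (auto simp: eventually_flat_def)
      show "(on_edge G len \<iota> \<phi> e has_real_derivative 0) (at t)" if "0 < t" "t < len e" for t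
        using eventually_flat_has_deriv(1)[OF \<phi>, of e t] F(3)[OF e, of t] that e by simp
    qed
    then show ?thesis using e by (simp add: on_edge_ends incr_def)
  qed
  then have "{e \<in> arcs G. incr (vals \<phi>) e \<noteq> 0} \<subseteq> F" by blast
  then show ?thesis using F(1) by (rule finite_subset)
qed

text \<open>Minus the Dirichlet pairing of \<open>u\<close> and \<open>\<theta>\<close>, summed over
  the arcs on which \<open>\<theta>\<close> jumps. The HOL sum over an infinite jump set would be 0,
  hence the finiteness conditions in the rules below.\<close>

definition flux :: "('v \<Rightarrow> real) \<Rightarrow> ('v \<Rightarrow> real) \<Rightarrow> real" where
  "flux u \<theta> = - (\<Sum>e\<in>{e \<in> arcs G. incr \<theta> e \<noteq> 0}. incr u e * incr \<theta> e / len e)"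

lemma flux_eq:
  assumes "finite F" "F \<subseteq> arcs G" "\<And>e. e \<in> arcs G \<Longrightarrow> incr \<theta> e \<noteq> 0 \<Longrightarrow> e \<in> F"
  shows "flux u \<theta> = - (\<Sum>e\<in>F. incr u e * incr \<theta> e / len e)"
  unfolding flux_def using assms by (intro arg_cong[of _ _ uminus] sum.mono_neutral_left) auto

lemma incr_plus: "incr (\<lambda>v. \<theta> v + \<psi> v) e = incr \<theta> e + incr \<psi> e"
  by (simp add: incr_def)

lemma flux_add:
  assumes "finite {e \<in> arcs G. incr \<theta> e \<noteq> 0}" "finite {e \<in> arcs G. incr \<psi> e \<noteq> 0}"
  shows "flux u (\<lambda>v. \<theta> v + \<psi> v) = flux u \<theta> + flux u \<psi>"
proof -
  let ?F = "{e \<in> arcs G. incr \<theta> e \<noteq> 0} \<union> {e \<in> arcs G. incr \<psi> e \<noteq> 0}"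
  have F: "finite ?F" "?F \<subseteq> arcs G" using assms by auto
  have "flux u (\<lambda>v. \<theta> v + \<psi> v) = - (\<Sum>e\<in>?F. incr u e * incr (\<lambda>v. \<theta> v + \<psi> v) e / len e)"
    by (rule flux_eq[OF F]) (auto simp: incr_plus)
  also have "\<dots> = - (\<Sum>e\<in>?F. incr u e * incr \<theta> e / len e) + - (\<Sum>e\<in>?F. incr u e * incr \<psi> e / len e)"
    unfolding incr_plus by (simp add: distrib_left add_divide_distrib sum.distrib)
  also have "- (\<Sum>e\<in>?F. incr u e * incr \<theta> e / len e) = flux u \<theta>" by (rule flux_eq[symmetric, OF F]) auto
  also have "- (\<Sum>e\<in>?F. incr u e * incr \<psi> e / len e) = flux u \<psi>" by (rule flux_eq[symmetric, OF F]) auto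
  finally show ?thesis .
qed

lemma flux_cong:
  assumes "\<And>v. v \<in> verts G \<Longrightarrow> \<theta> v = \<psi> v"
  shows "flux u \<theta> = flux u \<psi>"
proof -
  have "incr \<theta> e = incr \<psi> e" if "e \<in> arcs G" for e using assms that by (simp add: incr_def)
  then show ?thesis unfolding flux_def by (intro arg_cong[of _ _ uminus] sum.cong) auto
qed

lemma finite_support_incr:
  assumes \<psi>: "\<And>v. v \<in> verts G \<Longrightarrow> v \<notin> D \<Longrightarrow> \<psi> v = 0" and e: "e \<in> arcs G" "incr \<psi> e \<noteq> 0"
  shows "e \<in> arcs_at D"
proof (rule ccontr)
  assume "e \<notin> arcs_at D"
  then have "\<psi> (head G e) = 0" "\<psi> (tail G e) = 0" using e(1) by (auto simp: mem_arcs_at intro!: \<psi>)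
  then show False using e(2) by (simp add: incr_def)
qed

lemma finite_support_finite_incr:
  assumes D: "finite D" "D \<subseteq> verts G" and \<psi>: "\<And>v. v \<in> verts G \<Longrightarrow> v \<notin> D \<Longrightarrow> \<psi> v = 0"
  shows "finite {e \<in> arcs G. incr \<psi> e \<noteq> 0}"
proof -
  have "{e \<in> arcs G. incr \<psi> e \<noteq> 0} \<subseteq> arcs_at D"
  proof
    fix e assume "e \<in> {e \<in> arcs G. incr \<psi> e \<noteq> 0}"
    then show "e \<in> arcs_at D" using finite_support_incr[OF \<psi>] by simp
  qed
  then show ?thesis using finite_arcs_at[OF D] finite_subset by blast
qed

text \<open>Green's formula moves the Laplacian to \<open>u\<close>. With \<open>flux_add\<close>, a
  change at finitely many vertices where \<open>u\<close> is harmonic leaves the flux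
  unchanged.\<close>

lemma flux_finite_support:
  assumes D: "finite D" "D \<subseteq> verts G" and \<psi>: "\<And>v. v \<in> verts G \<Longrightarrow> v \<notin> D \<Longrightarrow> \<psi> v = 0"
    and u: "\<And>v. v \<in> D \<Longrightarrow> lap u v = 0"
  shows "flux u \<psi> = 0"
proof -
  have "flux u \<psi> = - (\<Sum>e\<in>arcs_at D. incr u e * incr \<psi> e / len e)"
    by (rule flux_eq[OF finite_arcs_at[OF D] arcs_at_subset finite_support_incr[OF \<psi>]])
  also have "\<dots> = (\<Sum>v\<in>D. \<psi> v * lap u v)"
    using summation_by_parts[OF D \<psi> finite_arcs_at[OF D] arcs_at_subset order_refl] by simp
  also have "\<dots> = 0" using u by simp
  finally show ?thesis .
qed

lemma integral_second_deriv_eq: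
  assumes f: "edge_affine f" and \<phi>: "\<phi> \<in> eventually_flat G len X \<iota>"
  shows "integral_second_deriv G len \<iota> f \<phi> = flux (vals f) (vals \<phi>)"
proof -
  let ?F = "{e \<in> arcs G. incr (vals \<phi>) e \<noteq> 0}"
  have "integral_second_deriv G len \<iota> f \<phi> = (\<Sum>\<^sub>\<infinity>e\<in>arcs G. - (incr (vals f) e * incr (vals \<phi>) e / len e))"
    unfolding integral_second_deriv_def by (intro infsum_cong edge_integral f \<phi>)
  also have "\<dots> = (\<Sum>\<^sub>\<infinity>e\<in>?F. - (incr (vals f) e * incr (vals \<phi>) e / len e))"
    by (intro infsum_cong_neutral) auto
  also have "\<dots> = flux (vals f) (vals \<phi>)"
    using eventually_flat_finite_incr[OF \<phi>] by (simp add: flux_def sum_negf)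
  finally show ?thesis .
qed

text \<open>The sets whose frontier in \<open>X\<close> lies in a finite set of graph points. The
  points of \<open>W\<close> may belong to either side, which makes this an algebra of sets and
  allows single graph points to be removed.\<close>

definition cuts :: "'x set set" where
  "cuts = {A. A \<subseteq> X \<and> (\<exists>W. finite W \<and> W \<subseteq> \<iota> ` gp \<and>
     openin (top_of_set X) (A - W) \<and> openin (top_of_set X) (X - A - W))}"

lemma cutsI:
  "A \<subseteq> X \<Longrightarrow> finite W \<Longrightarrow> W \<subseteq> \<iota> ` gp \<Longrightarrow> openin (top_of_set X) (A - W) \<Longrightarrow>
    openin (top_of_set X) (X - A - W) \<Longrightarrow> A \<in> cuts"
  by (auto simp: cuts_def)

lemma cutsE:
  assumes "A \<in> cuts"
  obtains W where "A \<subseteq> X" "finite W" "W \<subseteq> \<iota> ` gp" "openin (top_of_set X) (A - W)"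
    "openin (top_of_set X) (X - A - W)"
  using assms by (auto simp: cuts_def)

lemma cuts_subset: "A \<in> cuts \<Longrightarrow> A \<subseteq> X"
  by (simp add: cuts_def)

lemma openin_Diff_finite:
  assumes "openin (top_of_set X) S" "finite W"
  shows "openin (top_of_set X) (S - W)"
proof -
  obtain T where "open T" "S = X \<inter> T" using assms(1) by (auto simp: openin_open)
  then have "open (T - W)" "S - W = X \<inter> (T - W)" using assms(2) by (auto simp: finite_imp_closed open_Diff)
  then show ?thesis unfolding openin_open by blast
qed

lemma cuts_empty: "{} \<in> cuts" and cuts_whole: "X \<in> cuts"
  by (rule cutsI[of _ "{}"]; simp)+

lemma cuts_compl:
  assumes "A \<in> cuts" shows "X - A \<in> cuts"
proof -
  obtain W where W: "A \<subseteq> X" "finite W" "W \<subseteq> \<iota> ` gp" "openin (top_of_set X) (A - W)"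
    "openin (top_of_set X) (X - A - W)" using assms by (rule cutsE)
  have "X - (X - A) = A" using W(1) by blast
  then show ?thesis using W by (intro cutsI[of _ W]) auto
qed

lemma cuts_Un:
  assumes "A \<in> cuts" "B \<in> cuts" shows "A \<union> B \<in> cuts"
proof -
  obtain W where W: "A \<subseteq> X" "finite W" "W \<subseteq> \<iota> ` gp" "openin (top_of_set X) (A - W)"
    "openin (top_of_set X) (X - A - W)" using assms(1) by (rule cutsE)
  obtain W' where W': "B \<subseteq> X" "finite W'" "W' \<subseteq> \<iota> ` gp" "openin (top_of_set X) (B - W')"
    "openin (top_of_set X) (X - B - W')" using assms(2) by (rule cutsE)
  have 1: "A \<union> B - (W \<union> W') = (A - W - W') \<union> (B - W' - W)" by blast
  have 2: "X - (A \<union> B) - (W \<union> W') = (X - A - W) \<inter> (X - B - W')" by blast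
  have "openin (top_of_set X) (A \<union> B - (W \<union> W'))"
    unfolding 1 by (rule openin_Un[OF openin_Diff_finite[OF W(4) W'(2)] openin_Diff_finite[OF W'(4) W(2)]])
  moreover have "openin (top_of_set X) (X - (A \<union> B) - (W \<union> W'))"
    unfolding 2 using W W' by (intro openin_Int)
  ultimately show ?thesis using W W' by (intro cutsI[of _ "W \<union> W'"]) auto
qed

lemma cuts_Diff:
  assumes "A \<in> cuts" "B \<in> cuts" shows "A - B \<in> cuts"
proof -
  have "A - B = X - ((X - A) \<union> B)" using cuts_subset[OF assms(1)] by blast
  then show ?thesis using assms by (simp add: cuts_compl cuts_Un)
qed

lemma cuts_Int:
  assumes "A \<in> cuts" "B \<in> cuts" shows "A \<inter> B \<in> cuts"
proof -
  have "A \<inter> B = A - (X - B)" using cuts_subset[OF assms(1)] by blast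
  then show ?thesis using assms by (simp add: cuts_compl cuts_Diff)
qed

lemma cuts_singleton:
  assumes "p \<in> gp" shows "{\<iota> p} \<in> cuts"
proof -
  have "openin (top_of_set X) (X - {\<iota> p})" by (intro openin_Diff_finite) auto
  then show ?thesis using assms \<iota>_in_X by (intro cutsI[of _ "{\<iota> p}"]) auto
qed

lemma finite_edges_through:
  assumes "p \<in> gp" shows "finite {e \<in> arcs G. \<exists>t\<in>{0..len e}. ep e t = p}"
proof -
  have "\<exists>F. finite F \<and> {e \<in> arcs G. \<exists>t\<in>{0..len e}. ep e t = p} \<subseteq> F"
    using assms
  proof (cases rule: gp_cases)
    case (1 v)
    then show ?thesis using finite_arcs_at[of "{v}"]
      by (intro exI[of _ "arcs_at {v}"]) (auto simp: mem_arcs_at edge_point_def split: if_splits)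
  next
    case (2 e t)
    then show ?thesis by (intro exI[of _ "{e}"]) (auto simp: edge_point_def split: if_splits)
  qed
  then show ?thesis using finite_subset by blast
qed

text \<open>By local finiteness only finitely many closed edges meet \<open>W\<close>. Any other
  closed edge is a connected subset of the two open sides, so it lies in one of them.\<close>

lemma cut_edges:
  assumes "A \<in> cuts"
  obtains F where "finite F" "F \<subseteq> arcs G"
    "\<And>e t. e \<in> arcs G \<Longrightarrow> e \<notin> F \<Longrightarrow> t \<in> {0..len e} \<Longrightarrow> \<iota> (ep e t) \<in> A \<longleftrightarrow> \<iota> (Vertex (tail G e)) \<in> A"
proof -
  obtain W where W: "A \<subseteq> X" "finite W" "W \<subseteq> \<iota> ` gp" "openin (top_of_set X) (A - W)"
    "openin (top_of_set X) (X - A - W)" using assms by (rule cutsE)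
  define F where "F = {e \<in> arcs G. \<exists>t\<in>{0..len e}. \<iota> (ep e t) \<in> W}"
  have "F \<subseteq> (\<Union>x\<in>W. {e \<in> arcs G. \<exists>t\<in>{0..len e}. ep e t = inv_into gp \<iota> x})"
  proof
    fix e assume "e \<in> F"
    then obtain t where t: "e \<in> arcs G" "t \<in> {0..len e}" "\<iota> (ep e t) \<in> W" by (auto simp: F_def)
    then have "inv_into gp \<iota> (\<iota> (ep e t)) = ep e t" by (intro inv_into_f_f[OF inj_\<iota>]) simp
    then show "e \<in> (\<Union>x\<in>W. {e \<in> arcs G. \<exists>t\<in>{0..len e}. ep e t = inv_into gp \<iota> x})"
      using t by (intro UN_I[OF t(3)]) auto
  qed
  moreover have "finite (\<Union>x\<in>W. {e \<in> arcs G. \<exists>t\<in>{0..len e}. ep e t = inv_into gp \<iota> x})"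
    using W(2,3) by (intro finite_UN_I finite_edges_through) (auto intro: inv_into_into)
  ultimately have finF: "finite F" by (rule finite_subset)
  have const: "\<iota> (ep e t) \<in> A \<longleftrightarrow> \<iota> (Vertex (tail G e)) \<in> A" if e: "e \<in> arcs G" "e \<notin> F" and t: "t \<in> {0..len e}" for e t
  proof -
    let ?S = "(\<lambda>t. \<iota> (ep e t)) ` {0..len e}"
    have conn: "Topological_Spaces.connected ?S" by (intro connected_continuous_image edge_continuous e) simp
    obtain T1 where T1: "open T1" "A - W = X \<inter> T1" using W(4) by (auto simp: openin_open)
    obtain T2 where T2: "open T2" "X - A - W = X \<inter> T2" using W(5) by (auto simp: openin_open)
    have SX: "?S \<subseteq> X - W" using e \<iota>_in_X by (auto simp: F_def)
    have "T1 \<inter> ?S = {} \<or> T2 \<inter> ?S = {}"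
    proof (rule connectedD[OF conn T1(1) T2(1)])
      show "T1 \<inter> T2 \<inter> ?S = {}" using T1(2) T2(2) SX by blast
      show "?S \<subseteq> T1 \<union> T2" using T1(2) T2(2) SX by blast
    qed
    moreover have "\<iota> (ep e t) \<in> ?S" using t by blast
    moreover have "\<iota> (Vertex (tail G e)) \<in> ?S" using len_pos[OF e(1)] by (intro image_eqI[of _ _ 0]) auto
    ultimately show ?thesis using T1(2) T2(2) SX by blast
  qed
  show thesis by (rule that[OF finF _ const]) (auto simp: F_def)
qed

section \<open>Indicators of cut sets and their smoothing\<close>

abbreviation cut_ind :: "'x set \<Rightarrow> 'v \<Rightarrow> real" where
  "cut_ind A v \<equiv> indicator A (\<iota> (Vertex v))"

lemma cut_ind_finite_incr:
  assumes "A \<in> cuts" shows "finite {e \<in> arcs G. incr (cut_ind A) e \<noteq> 0}"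
proof -
  obtain F where F: "finite F" "F \<subseteq> arcs G"
    "\<And>e t. e \<in> arcs G \<Longrightarrow> e \<notin> F \<Longrightarrow> t \<in> {0..len e} \<Longrightarrow> \<iota> (ep e t) \<in> A \<longleftrightarrow> \<iota> (Vertex (tail G e)) \<in> A"
    using assms by (rule cut_edges) (rule that; simp)
  have "incr (cut_ind A) e = 0" if "e \<in> arcs G" "e \<notin> F" for e
    using F(3)[OF that, of "len e"] len_pos[of e] that by (simp add: incr_def indicator_def)
  then have "{e \<in> arcs G. incr (cut_ind A) e \<noteq> 0} \<subseteq> F" by blast
  then show ?thesis using F(1) finite_subset by blast
qed

text \<open>The level 2/3 matches the flat thirds of the step function: an inner point of this star
  is on a loop at \<open>v\<close> or in the third of its edge adjacent to \<open>v\<close>.\<close>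

lemma star_cases:
  assumes p: "p \<in> star (2/3) v"
  obtains "p = Vertex v"
  | e t where "e \<in> arcs G" "0 < t" "t < len e" "p = Inner e t"
    "tail G e = v \<and> (head G e = v \<or> t / len e < 1/3) \<or> head G e = v \<and> 2/3 < t / len e"
proof -
  have gp: "p \<in> gp" and gt: "2/3 < interp (delta v) p" using p by (auto simp: star_def)
  from gp show thesis
  proof (cases rule: gp_cases)
    case (1 x)
    then show ?thesis using gt that(1) by (auto simp: delta_def split: if_splits)
  next
    case (2 e t)
    then show ?thesis using gt by (intro that(2)[of e t]) (auto simp: delta_def incr_def split: if_splits)
  qed
qed

text \<open>The indicator of a cut set is smoothed along the finitely many edges on which it jumps.\<close>

lemma smoothed_cut_exists:
  assumes A: "A \<in> cuts"
  obtains \<phi> where "\<phi> \<in> eventually_flat G len X \<iota>" "\<And>v. v \<in> verts G \<Longrightarrow> \<phi> (\<iota> (Vertex v)) = cut_ind A v"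
    "\<And>x. x \<in> X \<Longrightarrow> x \<notin> \<iota> ` gp \<or> x \<in> \<iota> ` Vertex ` verts G \<Longrightarrow>
      \<exists>U. openin (top_of_set X) U \<and> x \<in> U \<and> (\<forall>y\<in>U. \<phi> y = indicator A x)"
proof -
  obtain \<sigma> M where \<sigma>: "smooth \<sigma>" "\<And>t. t \<le> 1/3 \<Longrightarrow> \<sigma> t = 0" "\<And>t. t \<ge> 2/3 \<Longrightarrow> \<sigma> t = 1"
    "0 \<le> M" "\<And>s t. \<bar>\<sigma> s - \<sigma> t\<bar> \<le> M * \<bar>s - t\<bar>" using smooth_step_exists by metis
  define \<theta> where "\<theta> = cut_ind A"
  have finite_incr: "finite {e \<in> arcs G. incr \<theta> e \<noteq> 0}" unfolding \<theta>_def by (rule cut_ind_finite_incr[OF A])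
  \<comment> \<open>The step function interpolates on jumping edges; on every other edge
    \<open>\<Phi>\<close> is constant.\<close>
  define \<Phi> where "\<Phi> p = (case p of Vertex v \<Rightarrow> \<theta> v | Inner e t \<Rightarrow> \<theta> (tail G e) + \<sigma> (t / len e) * incr \<theta> e)" for p
  have \<Phi>_ep: "\<Phi> (ep e t) = \<theta> (tail G e) + \<sigma> (t / len e) * incr \<theta> e" if e: "e \<in> arcs G" for e t
  proof -
    consider "t \<le> 0" | "len e \<le> t" "0 < t" | "0 < t" "t < len e" by linarith
    then show ?thesis
    proof cases
      case 1
      then have "t / len e \<le> 0" using len_pos[OF e] by (simp add: divide_nonpos_pos)
      then have "\<sigma> (t / len e) = 0" using \<sigma>(2)[of "t / len e"] by linarith
      then show ?thesis using 1 by (simp add: edge_point_def \<Phi>_def)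
    next
      case 2
      then have "1 \<le> t / len e" using len_pos[OF e] by simp
      then have "\<sigma> (t / len e) = 1" using \<sigma>(3)[of "t / len e"] by linarith
      then show ?thesis using 2 by (simp add: edge_point_def \<Phi>_def incr_def)
    qed (simp add: \<Phi>_def)
  qed
  obtain L where L: "0 \<le> L" "\<And>e. e \<in> arcs G \<Longrightarrow> \<bar>incr \<theta> e\<bar> \<le> L * len e"
    by (rule finite_incr_bound[OF finite_incr]) (metis that)
  have "edge_lipschitz (M * L) \<Phi>"
    unfolding edge_lipschitz_def
  proof (intro conjI ballI)
    show "0 \<le> M * L" using \<sigma>(4) L(1) by simp
    fix e s t assume e: "e \<in> arcs G"
    have "\<Phi> (ep e s) - \<Phi> (ep e t) = (\<sigma> (s / len e) - \<sigma> (t / len e)) * incr \<theta> e"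
      by (simp add: \<Phi>_ep[OF e] algebra_simps)
    then have "\<bar>\<Phi> (ep e s) - \<Phi> (ep e t)\<bar> = \<bar>\<sigma> (s / len e) - \<sigma> (t / len e)\<bar> * \<bar>incr \<theta> e\<bar>"
      by (simp add: abs_mult)
    also have "\<dots> \<le> (M * \<bar>s / len e - t / len e\<bar>) * (L * len e)"
      using \<sigma>(4,5) L(2)[OF e] by (intro mult_mono) auto
    also have "\<bar>s / len e - t / len e\<bar> = \<bar>s - t\<bar> / len e"
      using len_pos[OF e] by (simp flip: diff_divide_distrib)
    also have "(M * (\<bar>s - t\<bar> / len e)) * (L * len e) = M * L * \<bar>s - t\<bar>" using len_pos[OF e] by simp
    finally show "\<bar>\<Phi> (ep e s) - \<Phi> (ep e t)\<bar> \<le> M * L * \<bar>s - t\<bar>" .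
  qed
  then obtain \<phi> where lip: "(M * L)-lipschitz_on X \<phi>" and \<phi>: "\<And>p. p \<in> gp \<Longrightarrow> \<phi> (\<iota> p) = \<Phi> p"
    using lipschitz_extension by blast
  have cont: "continuous_on X \<phi>" using lip by (rule lipschitz_on_continuous_on)
  have edge: "on_edge G len \<iota> \<phi> e = (\<lambda>t. \<theta> (tail G e) + \<sigma> (1 / len e * t + 0) * incr \<theta> e)" if "e \<in> arcs G" for e
    using that by (simp add: on_edge_def fun_eq_iff \<phi> \<Phi>_ep)
  have vert: "\<phi> (\<iota> (Vertex v)) = \<theta> v" if "v \<in> verts G" for v using \<phi>[of "Vertex v"] that by (simp add: \<Phi>_def)
  have const_v: "\<phi> y = \<theta> v" if v: "v \<in> verts G" and y: "y \<in> \<iota> ` star (2/3) v" for v y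
  proof -
    obtain p where p: "p \<in> star (2/3) v" "y = \<iota> p" using y by blast
    then have "p \<in> gp" by (simp add: star_def)
    from p(1) have "\<Phi> p = \<theta> v"
      by (cases rule: star_cases) (auto simp: \<Phi>_def \<sigma>(2,3) incr_def)
    then show ?thesis using \<phi>[OF \<open>p \<in> gp\<close>] p(2) by simp
  qed
  have const_e: "\<exists>U. openin (top_of_set X) U \<and> x \<in> U \<and> (\<forall>y\<in>U. \<phi> y = indicator A x)" if x: "x \<in> X" "x \<notin> \<iota> ` gp" for x
  proof -
    obtain W where W: "A \<subseteq> X" "finite W" "W \<subseteq> \<iota> ` gp" "openin (top_of_set X) (A - W)"
      "openin (top_of_set X) (X - A - W)" using A by (rule cutsE)
    have "\<exists>S. openin (top_of_set X) S \<and> x \<in> S \<and> (\<forall>y\<in>S. y \<in> A \<longleftrightarrow> x \<in> A)"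
    proof (cases "x \<in> A")
      case True
      then show ?thesis using W x by (intro exI[of _ "A - W"]) blast
    next
      case False
      then show ?thesis using W x by (intro exI[of _ "X - A - W"]) blast
    qed
    then obtain S where S: "openin (top_of_set X) S" "x \<in> S" "\<And>y. y \<in> S \<Longrightarrow> y \<in> A \<longleftrightarrow> x \<in> A" by blast
    then obtain T where T: "open T" "S = X \<inter> T" by (auto simp: openin_open)
    obtain F where F: "finite F" "F \<subseteq> arcs G"
      "\<And>e t. e \<in> arcs G \<Longrightarrow> e \<notin> F \<Longrightarrow> t \<in> {0..len e} \<Longrightarrow> \<iota> (ep e t) \<in> A \<longleftrightarrow> \<iota> (Vertex (tail G e)) \<in> A"
      using A by (rule cut_edges) (rule that; simp)
    \<comment> \<open>Off the finitely many edges that \<open>A\<close> cuts, \<open>\<Phi>\<close>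
      equals the indicator of \<open>A\<close>. Their union is closed and misses
      \<open>x\<close>.\<close>
    define K where "K = (\<Union>e\<in>F. (\<lambda>t. \<iota> (ep e t)) ` {0..len e})"
    have "compact K" unfolding K_def using F by (intro compact_UN edge_compact) auto
    then have K: "closed K" by (rule compact_imp_closed)
    have "K \<subseteq> \<iota> ` gp" using F(2) by (auto simp: K_def)
    then have xK: "x \<notin> K" using x by blast
    have op: "open (T - K)" using T K by (simp add: open_Diff)
    have "\<phi> (\<iota> q) = indicator A x" if q: "q \<in> gp" "\<iota> q \<in> T - K" for q
    proof -
      have qA: "\<iota> q \<in> A \<longleftrightarrow> x \<in> A" using S(3)[of "\<iota> q"] q T(2) \<iota>_in_X by blast
      from q(1) show ?thesis
      proof (cases rule: gp_cases)
        case (1 v)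
        then show ?thesis using qA by (simp add: vert \<theta>_def indicator_def)
      next
        case (2 e t)
        have t: "t \<in> {0..len e}" "q = ep e t" using 2 by auto
        have "e \<notin> F" using q(2) t unfolding K_def by blast
        from F(3)[OF 2(1) this t(1)] F(3)[OF 2(1) this, of "len e"]
        have "\<theta> (tail G e) = indicator A x" "\<theta> (head G e) = indicator A x"
          using qA t(2) len_pos[OF 2(1)] 2(1) by (auto simp: \<theta>_def indicator_def)
        then show ?thesis using \<phi>[OF q(1)] 2 by (simp add: \<Phi>_def incr_def)
      qed
    qed
    then have "\<phi> y = indicator A x" if "y \<in> X" "y \<in> T - K" for y
      using constant_by_density[OF cont op] that by blast
    moreover have "x \<in> X \<inter> (T - K)" using x xK S(2) T(2) by blast
    moreover have "openin (top_of_set X) (X \<inter> (T - K))" using op by (rule openin_open_Int)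
    ultimately show ?thesis by blast
  qed
  have flat: "\<phi> \<in> eventually_flat G len X \<iota>"
    unfolding eventually_flat_def
  proof (intro CollectI conjI cont ballI allI)
    fix e t n assume e: "e \<in> arcs G"
    have "smooth (on_edge G len \<iota> \<phi> e)"
      unfolding edge[OF e] by (intro smooth_add smooth_mult smooth_const smooth_affine_comp \<sigma>(1))
    then show "(deriv ^^ n) (on_edge G len \<iota> \<phi> e) differentiable (at t)" by (simp add: smooth_def)
  next
    show "\<exists>F. finite F \<and> F \<subseteq> arcs G \<and> (\<forall>e\<in>arcs G - F. \<forall>t\<in>{0<..<len e}. deriv (on_edge G len \<iota> \<phi> e) t = 0)"
      using finite_incr by (intro exI[of _ "{e \<in> arcs G. incr \<theta> e \<noteq> 0}"]) (auto simp: edge)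
  next
    fix v assume v: "v \<in> verts G"
    have op: "openin (top_of_set X) (\<iota> ` star (2/3) v)" using openin_star[OF v, of "2/3"] by simp
    have "deriv (on_edge G len \<iota> \<phi> e) t = 0" if e: "e \<in> arcs G" and t: "\<iota> (ep e t) \<in> \<iota> ` star (2/3) v" for e t
    proof -
      have "((\<lambda>_. \<theta> v) has_real_derivative 0) (at t)" by simp
      then have "(on_edge G len \<iota> \<phi> e has_real_derivative 0) (at t)"
      proof (rule has_field_derivative_transform_within_open[OF _ open_edge_preimage[OF e op]])
        show "\<theta> v = on_edge G len \<iota> \<phi> e s" if "s \<in> {t. \<iota> (ep e t) \<in> \<iota> ` star (2/3) v}" for s
          using const_v[OF v] that unfolding on_edge_def by simp
      qed (use t in simp)
      then show ?thesis by (rule DERIV_imp_deriv)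
    qed
    moreover have "\<iota> (Vertex v) \<in> \<iota> ` star (2/3) v" using v by simp
    ultimately show "\<exists>U. openin (top_of_set X) U \<and> \<iota> (Vertex v) \<in> U \<and> (\<forall>e\<in>arcs G. \<forall>t\<in>{0<..<len e}.
        \<iota> (ep e t) \<in> U \<longrightarrow> deriv (on_edge G len \<iota> \<phi> e) t = 0)"
      using op by blast
  qed
  show thesis
  proof (rule that[OF flat])
    show "\<phi> (\<iota> (Vertex v)) = cut_ind A v" if "v \<in> verts G" for v using vert[OF that] by (simp add: \<theta>_def)
    fix x assume "x \<in> X" "x \<notin> \<iota> ` gp \<or> x \<in> \<iota> ` Vertex ` verts G"
    then consider "x \<notin> \<iota> ` gp" | v where "v \<in> verts G" "x = \<iota> (Vertex v)" by blast
    then show "\<exists>U. openin (top_of_set X) U \<and> x \<in> U \<and> (\<forall>y\<in>U. \<phi> y = indicator A x)"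
    proof cases
      case 1
      then show ?thesis using const_e \<open>x \<in> X\<close> by blast
    next
      case (2 v)
      then show ?thesis using openin_star[OF 2(1), of "2/3"] const_v[OF 2(1)]
        by (intro exI[of _ "\<iota> ` star (2/3) v"]) (simp add: \<theta>_def)
    qed
  qed
qed

text \<open>A completion point outside the graph is never in \<open>W\<close>, and a degree-1 vertex
  in \<open>W\<close> is isolated in the boundary. So the trace of \<open>A\<close> is open there,
  and likewise that of its complement.\<close>

lemma cut_clopen:
  assumes "A \<in> cuts" shows "clopen_in bd (A \<inter> bd)"
proof -
  have op: "openin (top_of_set bd) (A \<inter> bd)" if A: "A \<in> cuts" for A
  proof -
    obtain W where W: "A \<subseteq> X" "finite W" "W \<subseteq> \<iota> ` gp" "openin (top_of_set X) (A - W)"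
      "openin (top_of_set X) (X - A - W)" using A by (rule cutsE)
    have "\<exists>S. openin (top_of_set bd) S \<and> x \<in> S \<and> S \<subseteq> A \<inter> bd" if x: "x \<in> A \<inter> bd" for x
    proof (cases "x \<in> W")
      case False
      obtain T where T: "open T" "A - W = X \<inter> T" using W(4) by (auto simp: openin_open)
      then have "bd \<inter> T \<subseteq> A \<inter> bd" "x \<in> bd \<inter> T" using x False boundary_subset by blast+
      then show ?thesis using openin_open_Int[OF T(1), of bd] by blast
    next
      case True
      then obtain p where p: "p \<in> gp" "x = \<iota> p" using W(3) by blast
      obtain T where T: "open T" "\<iota> p \<in> T" "T \<inter> X \<subseteq> \<iota> ` gp"
        "\<And>v. v \<in> verts G \<Longrightarrow> \<iota> (Vertex v) \<in> T \<Longrightarrow> p = Vertex v"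
        using graph_point_nhd[OF p(1)] by metis
      have "bd \<inter> T \<subseteq> {x}"
      proof
        fix y assume y: "y \<in> bd \<inter> T"
        then have "y \<in> bd" by blast
        then show "y \<in> {x}"
        proof (cases rule: boundary_cases)
          case (1 v)
          then show ?thesis using T(4)[of v] y p(2) by auto
        next
          case 2
          then show ?thesis using T(3) y by blast
        qed
      qed
      then have "bd \<inter> T \<subseteq> A \<inter> bd" "x \<in> bd \<inter> T" using x p(2) T(2) by blast+
      then show ?thesis using openin_open_Int[OF T(1), of bd] by blast
    qed
    then show ?thesis by (subst openin_subopen) blast
  qed
  have "bd - (X - A) \<inter> bd = A \<inter> bd" using boundary_subset by blast
  moreover have "closedin (top_of_set bd) (bd - (X - A) \<inter> bd)"
    using op[OF cuts_compl[OF assms]] by (intro closedin_diff) auto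
  ultimately show ?thesis using op[OF assms] by (simp add: clopen_in_def)
qed

lemma weakly_connected_separation:
  assumes wc: "weakly_connected G len X \<iota>" and "x \<in> X" "y \<in> X" "x \<noteq> y"
  shows "\<exists>A\<in>cuts. \<exists>U V. open U \<and> open V \<and> x \<in> U \<and> y \<in> V \<and> U \<inter> X \<subseteq> A \<and> V \<inter> X \<inter> A = {}"
proof -
  obtain W U V where W: "finite W" "W \<subseteq> \<iota> ` gp" and U: "openin (top_of_set X) U" and V: "openin (top_of_set X) V"
    and UV: "U \<inter> V = {}" "x \<in> U" "y \<in> V" "X - W = U \<union> V"
    using wc assms(2-4) unfolding weakly_connected_def by meson
  obtain S where S: "open S" "U = X \<inter> S" using U by (auto simp: openin_open)
  obtain T where T: "open T" "V = X \<inter> T" using V by (auto simp: openin_open)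
  have "U - W = U" "X - U - W = V" "U \<subseteq> X" using UV by blast+
  then have "U \<in> cuts" using W U V by (intro cutsI[of _ W]) auto
  moreover have "S \<inter> X \<subseteq> U" "T \<inter> X \<inter> U = {}" "x \<in> S" "y \<in> T" using S T UV by blast+
  ultimately show ?thesis using S(1) T(1) by blast
qed

lemma clopen_boundary_cut:
  assumes wc: "weakly_connected G len X \<iota>" and E: "clopen_in bd E"
  obtains A where "A \<in> cuts" "E \<subseteq> A" "(bd - E) \<inter> A = {}"
proof -
  have E_bd: "E \<subseteq> bd" using E by (rule clopen_in_subset)
  have "compact E" using E compact_boundary closedin_compact by (auto simp: clopen_in_def)
  moreover have "compact (bd - E)"
    using clopen_in_Diff[OF clopen_in_self E] compact_boundary closedin_compact by (auto simp: clopen_in_def)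
  ultimately have "\<exists>A\<in>cuts. \<exists>U V. open U \<and> open V \<and> E \<subseteq> U \<and> bd - E \<subseteq> V \<and> U \<inter> X \<subseteq> A \<and> V \<inter> X \<inter> A = {}"
  proof (rule compact_separation[OF _ _ cuts_empty cuts_whole cuts_Un cuts_Int])
    fix x y assume "x \<in> E" "y \<in> bd - E"
    then show "\<exists>A\<in>cuts. \<exists>U V. open U \<and> open V \<and> x \<in> U \<and> y \<in> V \<and> U \<inter> X \<subseteq> A \<and> V \<inter> X \<inter> A = {}"
      using E_bd boundary_subset by (intro weakly_connected_separation[OF wc]) blast+
  qed
  then obtain A U V where A: "A \<in> cuts" "E \<subseteq> U" "bd - E \<subseteq> V" "U \<inter> X \<subseteq> A" "V \<inter> X \<inter> A = {}" by (elim bexE exE conjE) simp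
  have "E \<subseteq> A" using A(2,4) E_bd boundary_subset by blast
  moreover have "(bd - E) \<inter> A = {}" using A(3,5) boundary_subset by blast
  ultimately show thesis using that A(1) by blast
qed

end

section \<open>The measure of a clopen set\<close>

context pointed_completion
begin

lemma w_notin_boundary: "\<iota> (Vertex w) \<notin> bd"
  using boundary_vertex[OF w_vert] w_degree by simp

text \<open>The cutoffs agree near the boundary and near \<open>w\<close>. The rest is a compact
  part of the graph with finitely many vertices, all interior and different from \<open>w\<close>,
  so \<open>h\<close> is harmonic at them and the difference has no flux.\<close>

lemma cutoff_flux_unique:
  assumes E: "E \<subseteq> bd" and 1: "is_cutoff G len X \<iota> w E \<phi>" and 2: "is_cutoff G len X \<iota> w E \<psi>"
  shows "flux (vals h) (vals \<phi>) = flux (vals h) (vals \<psi>)"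
proof -
  obtain U V where U: "openin (top_of_set X) U" "E \<subseteq> U" "\<And>x. x \<in> U \<Longrightarrow> \<phi> x = 1"
    and V: "openin (top_of_set X) V" "(bd \<union> {\<iota> (Vertex w)}) - E \<subseteq> V" "\<And>x. x \<in> V \<Longrightarrow> \<phi> x = 0"
    and \<phi>: "\<phi> \<in> eventually_flat G len X \<iota>" using 1 unfolding is_cutoff_def by metis
  obtain U' V' where U': "openin (top_of_set X) U'" "E \<subseteq> U'" "\<And>x. x \<in> U' \<Longrightarrow> \<psi> x = 1"
    and V': "openin (top_of_set X) V'" "(bd \<union> {\<iota> (Vertex w)}) - E \<subseteq> V'" "\<And>x. x \<in> V' \<Longrightarrow> \<psi> x = 0"
    and \<psi>: "\<psi> \<in> eventually_flat G len X \<iota>" using 2 unfolding is_cutoff_def by metis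
  define S where "S = (U \<inter> U') \<union> (V \<inter> V')"
  have "openin (top_of_set X) S"
    unfolding S_def by (intro openin_Un openin_Int U U' V V')
  then obtain T where T: "open T" "S = X \<inter> T" by (auto simp: openin_open)
  have S_bd: "bd \<union> {\<iota> (Vertex w)} \<subseteq> S" unfolding S_def using U(2) U'(2) V(2) V'(2) by blast
  have eq: "\<phi> x = \<psi> x" if xS: "x \<in> S" for x
  proof -
    consider "x \<in> U" "x \<in> U'" | "x \<in> V" "x \<in> V'" using xS unfolding S_def by blast
    then show ?thesis by cases (simp_all add: U(3) U'(3) V(3) V'(3))
  qed
  have "compact (X - T)" by (rule compact_diff[OF compact_X T(1)])
  moreover have "X - T \<subseteq> \<iota> ` gp"
  proof -
    have "X - bd \<subseteq> \<iota> ` gp" by (auto simp: completion_boundary_def graph_interior_def)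
    then show ?thesis using S_bd T(2) by blast
  qed
  ultimately have fin: "finite {v \<in> verts G. \<iota> (Vertex v) \<in> X - T}" by (rule finite_vertices_in_compact)
  let ?D = "{v \<in> verts G. \<iota> (Vertex v) \<in> X - T}" and ?d = "\<lambda>v. vals \<phi> v - vals \<psi> v"
  have d0: "?d v = 0" if "v \<in> verts G" "v \<notin> ?D" for v
    using eq[of "\<iota> (Vertex v)"] that T(2) \<iota>_in_X by (simp add: vals_def)
  have "lap (vals h) v = 0" if "v \<in> ?D" for v
  proof (rule h_lap)
    have nS: "\<iota> (Vertex v) \<notin> S" using that T(2) by blast
    show v: "v \<in> verts G" using that by simp
    show "degree G v \<noteq> 1" using nS S_bd boundary_vertex[OF v] by blast
    show "v \<noteq> w" using nS S_bd by blast
  qed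
  then have zero: "flux (vals h) ?d = 0" using fin d0 by (intro flux_finite_support[of ?D]) auto
  have "flux (vals h) (vals \<phi>) = flux (vals h) (\<lambda>v. vals \<psi> v + ?d v)" by simp
  also have "\<dots> = flux (vals h) (vals \<psi>) + flux (vals h) ?d"
    by (intro flux_add eventually_flat_finite_incr[OF \<psi>] finite_support_finite_incr[OF fin _ d0]) auto
  finally show ?thesis using zero by simp
qed

lemma nu_eq_flux:
  assumes "E \<subseteq> bd" "is_cutoff G len X \<iota> w E \<phi>"
  shows "nu G len X \<iota> w E = flux (vals h) (vals \<phi>)"
  unfolding nu_def
proof (rule the_equality)
  have eq: "integral_second_deriv G len \<iota> h \<psi> = flux (vals h) (vals \<psi>)" if "is_cutoff G len X \<iota> w E \<psi>" for \<psi>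
    using that by (intro integral_second_deriv_eq h_affine) (simp add: is_cutoff_def)
  show "\<exists>\<psi>. is_cutoff G len X \<iota> w E \<psi> \<and> flux (vals h) (vals \<phi>) = integral_second_deriv G len \<iota> h \<psi>"
    using eq assms(2) by (intro exI[of _ \<phi>]) simp
  show "c = flux (vals h) (vals \<phi>)"
    if "\<exists>\<psi>. is_cutoff G len X \<iota> w E \<psi> \<and> c = integral_second_deriv G len \<iota> h \<psi>" for c
    using that eq cutoff_flux_unique[OF assms(1) _ assms(2)] by auto
qed

definition separates :: "'x set \<Rightarrow> 'x set \<Rightarrow> bool" where
  "separates A E \<longleftrightarrow> A \<in> cuts \<and> E \<subseteq> bd \<and> E \<subseteq> A \<and> ((bd \<union> {\<iota> (Vertex w)}) - E) \<inter> A = {}"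

text \<open>The smoothed indicator is an admissible cutoff, and the flux sees only vertex values, so
  the discontinuous indicator already computes \<open>nu\<close>.\<close>

lemma nu_cut:
  assumes "separates A E"
  shows "nu G len X \<iota> w E = flux (vals h) (cut_ind A)"
proof -
  have A: "A \<in> cuts" "E \<subseteq> bd" "E \<subseteq> A" "((bd \<union> {\<iota> (Vertex w)}) - E) \<inter> A = {}"
    using assms by (auto simp: separates_def)
  obtain \<phi> where \<phi>: "\<phi> \<in> eventually_flat G len X \<iota>" "\<And>v. v \<in> verts G \<Longrightarrow> \<phi> (\<iota> (Vertex v)) = cut_ind A v"
    and nhd: "\<And>x. x \<in> X \<Longrightarrow> x \<notin> \<iota> ` gp \<or> x \<in> \<iota> ` Vertex ` verts G \<Longrightarrow>
      \<exists>U. openin (top_of_set X) U \<and> x \<in> U \<and> (\<forall>y\<in>U. \<phi> y = indicator A x)"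
    using smoothed_cut_exists[OF A(1)] by metis
  have nhd': "\<exists>U. openin (top_of_set X) U \<and> x \<in> U \<and> (\<forall>y\<in>U. \<phi> y = indicator A x)"
    if "x \<in> bd \<union> {\<iota> (Vertex w)}" for x
  proof (rule nhd)
    show "x \<in> X" using that boundary_subset \<iota>_w_X by blast
    \<comment> \<open>Inner edge points, where the smoothing may be in transition, are neither in
      the boundary nor equal to \<open>w\<close>.\<close>
    show "x \<notin> \<iota> ` gp \<or> x \<in> \<iota> ` Vertex ` verts G"
    proof (cases "x \<in> bd")
      case True
      then show ?thesis by (cases rule: boundary_cases) auto
    qed (use that w_vert in auto)
  qed
  have union: "\<exists>U. openin (top_of_set X) U \<and> Y \<subseteq> U \<and> (\<forall>x\<in>U. \<phi> x = c)"
    if "\<And>x. x \<in> Y \<Longrightarrow> \<exists>U. openin (top_of_set X) U \<and> x \<in> U \<and> (\<forall>y\<in>U. \<phi> y = c)" for Y c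
  proof (intro exI conjI)
    let ?U = "\<Union>{U. openin (top_of_set X) U \<and> (\<forall>y\<in>U. \<phi> y = c)}"
    show "openin (top_of_set X) ?U" by (intro openin_Union) simp
    show "Y \<subseteq> ?U" using that by blast
  qed auto
  have "is_cutoff G len X \<iota> w E \<phi>"
    unfolding is_cutoff_def
  proof (intro conjI \<phi>(1) union)
    fix x assume x: "x \<in> E"
    then have "indicator A x = (1::real)" using A(3) by (auto simp: indicator_def)
    then show "\<exists>U. openin (top_of_set X) U \<and> x \<in> U \<and> (\<forall>y\<in>U. \<phi> y = 1)" using nhd'[of x] x A(2) by auto
  next
    fix x assume x: "x \<in> (bd \<union> {\<iota> (Vertex w)}) - E"
    then have "indicator A x = (0::real)" using A(4) by (auto simp: indicator_def)
    then show "\<exists>U. openin (top_of_set X) U \<and> x \<in> U \<and> (\<forall>y\<in>U. \<phi> y = 0)" using nhd'[of x] x by auto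
  qed
  then have "nu G len X \<iota> w E = flux (vals h) (vals \<phi>)" by (rule nu_eq_flux[OF A(2)])
  also have "\<dots> = flux (vals h) (cut_ind A)" using \<phi>(2) by (intro flux_cong) (simp add: vals_def)
  finally show ?thesis .
qed

lemma separates_exists:
  assumes wc: "weakly_connected G len X \<iota>" and E: "clopen_in bd E"
  obtains A where "separates A E"
proof -
  obtain A where A: "A \<in> cuts" "E \<subseteq> A" "(bd - E) \<inter> A = {}" using clopen_boundary_cut[OF wc E] by metis
  have "E \<subseteq> bd" using E by (rule clopen_in_subset)
  \<comment> \<open>Weak connectedness does not control the side of \<open>w\<close>, so it is
    removed; being no boundary point, it is not in \<open>E\<close>.\<close>
  moreover have "A - {\<iota> (Vertex w)} \<in> cuts" by (intro cuts_Diff A cuts_singleton w_gp)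
  ultimately have "separates (A - {\<iota> (Vertex w)}) E"
    using A(2,3) w_notin_boundary unfolding separates_def by blast
  then show thesis by (rule that)
qed

lemma nu_additive:
  assumes wc: "weakly_connected G len X \<iota>" and E: "clopen_in bd E" and E': "clopen_in bd E'" and disj: "E \<inter> E' = {}"
  shows "nu G len X \<iota> w (E \<union> E') = nu G len X \<iota> w E + nu G len X \<iota> w E'"
proof -
  obtain A where A: "separates A E" using separates_exists[OF wc E] .
  obtain B where B: "separates B E'" using separates_exists[OF wc E'] .
  have cuts: "A \<in> cuts" "B \<in> cuts" using A B by (auto simp: separates_def)
  \<comment> \<open>\<open>A\<close> meets the boundary only in \<open>E\<close>, so
    \<open>B - A\<close> still contains \<open>E'\<close>; disjointness from \<open>A\<close> makes
    the indicators add up.\<close>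
  have 1: "separates (B - A) E'"
    using A B disj cuts_Diff[OF cuts(2,1)] unfolding separates_def by blast
  have 2: "separates (A \<union> (B - A)) (E \<union> E')"
    using A B disj cuts_Un[OF cuts(1) cuts_Diff[OF cuts(2,1)]] unfolding separates_def by blast
  have "cut_ind (A \<union> (B - A)) = (\<lambda>v. cut_ind A v + cut_ind (B - A) v)"
    by (auto simp: indicator_def fun_eq_iff)
  then have "flux (vals h) (cut_ind (A \<union> (B - A))) = flux (vals h) (cut_ind A) + flux (vals h) (cut_ind (B - A))"
    using flux_add[OF cut_ind_finite_incr[OF cuts(1)] cut_ind_finite_incr[OF cuts_Diff[OF cuts(2,1)]]] by simp
  then show ?thesis using nu_cut[OF A] nu_cut[OF 1] nu_cut[OF 2] by simp
qed

text \<open>An edge with two degree-1 ends would exhaust the connected graph and leave no room for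
  \<open>w\<close>.\<close>

lemma no_edge_between_boundary_vertices:
  assumes e: "e \<in> arcs G" shows "degree G (tail G e) \<noteq> 1 \<or> degree G (head G e) \<noteq> 1"
proof (rule ccontr)
  assume "\<not> ?thesis"
  then have d: "degree G (tail G e) = 1" "degree G (head G e) = 1" by auto
  have "w = tail G e \<or> w = head G e"
  proof (rule connected_induct[OF graph_connected w_vert tail_in_verts[OF e]])
    fix e' assume e': "e' \<in> arcs G"
    have "e' = e" if "v \<in> {tail G e, head G e}" "v \<in> {tail G e', head G e'}" for v
    proof (rule degree_one_unique_neighbour(1))
      show "degree G v = 1" "v \<in> verts G" using that(1) d e by auto
      show "e' \<in> in_arcs G v \<union> out_arcs G v" "e \<in> in_arcs G v \<union> out_arcs G v" using that e e' by auto
    qed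
    then show "(tail G e' = tail G e \<or> tail G e' = head G e) \<longleftrightarrow> (head G e' = tail G e \<or> head G e' = head G e)"
      by auto
  qed simp
  then show False using d w_degree by auto
qed

text \<open>Below a small level \<open>t\<close> of \<open>h\<close>, every edge leaving the part \<open>\<theta>\<close> of the cut set \<open>A\<close>
  carries flux towards \<open>E\<close>; passing from \<open>A\<close> to this part changes only finitely many vertices
  and hence not the flux.\<close>

lemma cut_flux:
  assumes A: "separates A E"
  shows "0 \<le> flux (vals h) (cut_ind A)" "E \<noteq> {} \<Longrightarrow> 0 < flux (vals h) (cut_ind A)"
proof -
  have Ac: "A \<in> cuts" and E: "E \<subseteq> bd" "E \<subseteq> A" and Aw: "\<iota> (Vertex w) \<notin> A"
    using A w_notin_boundary unfolding separates_def by blast+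
  let ?F = "{e \<in> arcs G. incr (cut_ind A) e \<noteq> 0}"
  let ?V = "{v \<in> tail G ` ?F \<union> head G ` ?F. degree G v \<noteq> 1}"
  have finF: "finite ?F" by (rule cut_ind_finite_incr[OF Ac])
  then have finV: "finite ?V" by simp
  \<comment> \<open>\<open>?V\<close> consists of the interior ends of the jumping edges, finitely
    many vertices at which \<open>h\<close> is positive; the element 1 covers an empty
    \<open>?V\<close>.\<close>
  define t where "t = Min (insert 1 (vals h ` ?V))"
  have t0: "0 < t"
    unfolding t_def using finV h_pos by (subst Min_gr_iff) auto
  have tV: "t \<le> vals h v" if "v \<in> ?V" for v
    unfolding t_def using finV that by (intro Min_le) auto
  define \<theta> :: "'v \<Rightarrow> real" where "\<theta> v = (if \<iota> (Vertex v) \<in> A \<and> vals h v < t then 1 else 0)" for v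
  define \<psi> :: "'v \<Rightarrow> real" where "\<psi> v = (if \<iota> (Vertex v) \<in> A \<and> t \<le> vals h v then 1 else 0)" for v
  define D where "D = {v \<in> verts G. \<iota> (Vertex v) \<in> A \<and> t \<le> vals h v}"
  \<comment> \<open>\<open>h\<close> vanishes on the boundary, so its superlevel set at the positive
    level \<open>t\<close> is a compact part of the graph.\<close>
  have finD: "finite D"
  proof -
    have "closedin (top_of_set X) (X \<inter> h -` {t..})"
      by (intro continuous_closedin_preimage h_cont closed_atLeast)
    then have "compact (X \<inter> h -` {t..})" using compact_X closedin_compact by blast
    moreover have "X \<inter> h -` {t..} \<subseteq> \<iota> ` gp"
    proof
      fix x assume x: "x \<in> X \<inter> h -` {t..}"
      then have "x \<notin> bd" using h_bd[of x] t0 by auto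
      then show "x \<in> \<iota> ` gp" using x by (auto simp: completion_boundary_def graph_interior_def)
    qed
    ultimately have "finite {v \<in> verts G. \<iota> (Vertex v) \<in> X \<inter> h -` {t..}}"
      by (rule finite_vertices_in_compact)
    then show ?thesis by (rule rev_finite_subset) (auto simp: D_def vals_def \<iota>_in_X)
  qed
  have D: "D \<subseteq> verts G" "\<And>v. v \<in> verts G \<Longrightarrow> v \<notin> D \<Longrightarrow> \<psi> v = 0" by (auto simp: D_def \<psi>_def)
  have "flux (vals h) \<psi> = 0"
  proof (rule flux_finite_support[OF finD D])
    fix v assume v: "v \<in> D"
    then have vv: "v \<in> verts G" by (simp add: D_def)
    have "degree G v \<noteq> 1"
      using h_bd[of "\<iota> (Vertex v)"] boundary_vertex[OF vv] v t0 by (auto simp: D_def vals_def)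
    moreover have "v \<noteq> w" using v Aw by (auto simp: D_def)
    ultimately show "lap (vals h) v = 0" using h_lap vv by blast
  qed
  moreover have eq: "cut_ind A = (\<lambda>v. \<theta> v + \<psi> v)" by (auto simp: \<theta>_def \<psi>_def indicator_def fun_eq_iff)
  have fin\<psi>: "finite {e \<in> arcs G. incr \<psi> e \<noteq> 0}" by (rule finite_support_finite_incr[OF finD D])
  have fin\<theta>: "finite {e \<in> arcs G. incr \<theta> e \<noteq> 0}"
  proof (rule finite_subset)
    show "{e \<in> arcs G. incr \<theta> e \<noteq> 0} \<subseteq> ?F \<union> {e \<in> arcs G. incr \<psi> e \<noteq> 0}" unfolding eq incr_plus by auto
  qed (use finF fin\<psi> in simp)
  ultimately have flux: "flux (vals h) (cut_ind A) = flux (vals h) \<theta>"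
    unfolding eq using flux_add[OF fin\<theta> fin\<psi>] by simp
  \<comment> \<open>If the end \<open>b\<close> is still in \<open>A\<close>, it has
    \<open>h\<close> at least \<open>t\<close>. Otherwise the edge jumps for \<open>A\<close>
    itself: the end \<open>a\<close>, with \<open>h\<close> below \<open>t\<close>, must then have
    degree 1, so \<open>b\<close> is an interior vertex and belongs to \<open>?V\<close>.\<close>
  have up: "vals h a < vals h b" if "\<theta> a = 1" "\<theta> b = 0" and e: "e \<in> arcs G" "{tail G e, head G e} = {a, b}" for a b e
  proof -
    have a: "\<iota> (Vertex a) \<in> A" "vals h a < t" using that(1) by (auto simp: \<theta>_def split: if_splits)
    show ?thesis
    proof (cases "\<iota> (Vertex b) \<in> A")
      case True
      then show ?thesis using that(2) a by (auto simp: \<theta>_def split: if_splits)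
    next
      case False
      have ab: "(tail G e = a \<and> head G e = b) \<or> (tail G e = b \<and> head G e = a)"
        using e(2) by (auto simp: doubleton_eq_iff)
      then have "e \<in> ?F" using e(1) a(1) False by (auto simp: incr_def indicator_def)
      then have "a \<in> tail G ` ?F \<union> head G ` ?F" "b \<in> tail G ` ?F \<union> head G ` ?F" using ab by blast+
      then have "degree G a \<noteq> 1 \<Longrightarrow> t \<le> vals h a" "degree G b \<noteq> 1 \<Longrightarrow> t \<le> vals h b" using tV by blast+
      then show ?thesis using a(2) no_edge_between_boundary_vertices[OF e(1)] ab by fastforce
    qed
  qed
  have term_pos: "incr (vals h) e * incr \<theta> e / len e < 0" if e: "e \<in> arcs G" "incr \<theta> e \<noteq> 0" for e
  proof -
    have "(\<theta> (tail G e) = 1 \<and> \<theta> (head G e) = 0) \<or> (\<theta> (tail G e) = 0 \<and> \<theta> (head G e) = 1)"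
      using e(2) by (auto simp: incr_def \<theta>_def split: if_splits)
    then have "incr (vals h) e * incr \<theta> e < 0"
      using up[of "tail G e" "head G e" e] up[of "head G e" "tail G e" e] e(1)
      by (auto simp: incr_def insert_commute)
    then show ?thesis using len_pos[OF e(1)] by (simp add: divide_neg_pos)
  qed
  show "0 \<le> flux (vals h) (cut_ind A)"
    unfolding flux unfolding flux_def neg_0_le_iff_le
    by (rule sum_nonpos) (use term_pos in \<open>auto intro: less_imp_le\<close>)
  show "0 < flux (vals h) (cut_ind A)" if ne: "E \<noteq> {}"
  proof -
    \<comment> \<open>A point of \<open>E\<close> is a degree-1 vertex, which serves itself, or lies
      outside the graph; then density gives a nearby graph point in \<open>A\<close> with small
      \<open>h\<close>, on an edge not cut by \<open>A\<close>.\<close>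
    have "\<exists>a\<in>verts G. \<theta> a = 1"
    proof -
      obtain x where x: "x \<in> E" using ne by blast
      then have "x \<in> bd" using E by blast
      then show ?thesis
      proof (cases rule: boundary_cases)
        case (1 v)
        then have "vals h v = 0" using h_bd \<open>x \<in> bd\<close> by (simp add: vals_def)
        then show ?thesis using 1 x E t0 by (intro bexI[of _ v]) (auto simp: \<theta>_def)
      next
        case 2
        obtain W where W: "A \<subseteq> X" "finite W" "W \<subseteq> \<iota> ` gp" "openin (top_of_set X) (A - W)"
          "openin (top_of_set X) (X - A - W)" using Ac by (rule cutsE)
        obtain T where T: "open T" "A - W = X \<inter> T" using W(4) by (auto simp: openin_open)
        have "openin (top_of_set X) (X \<inter> h -` {..<t})"
          by (intro continuous_openin_preimage_gen h_cont open_lessThan)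
        then obtain T' where T': "open T'" "X \<inter> h -` {..<t} = X \<inter> T'" by (auto simp: openin_open)
        obtain F where F: "finite F" "F \<subseteq> arcs G"
          "\<And>e t. e \<in> arcs G \<Longrightarrow> e \<notin> F \<Longrightarrow> t \<in> {0..len e} \<Longrightarrow> \<iota> (ep e t) \<in> A \<longleftrightarrow> \<iota> (Vertex (tail G e)) \<in> A"
          using Ac by (rule cut_edges) (rule that; simp)
        define K where "K = (\<Union>e\<in>F. (\<lambda>t. \<iota> (ep e t)) ` {0..len e})"
        have "compact K" unfolding K_def using F by (intro compact_UN edge_compact) auto
        then have K: "closed K" by (rule compact_imp_closed)
        have "K \<subseteq> \<iota> ` gp" using F(2) by (auto simp: K_def)
        then have "x \<notin> K" using 2 by blast
        moreover have "x \<in> T" using x E 2 W(3) T(2) by blast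
        moreover have "x \<in> T'" using 2 h_bd[OF \<open>x \<in> bd\<close>] t0 T'(2) by auto
        ultimately have "x \<in> T \<inter> T' - K" by blast
        moreover have "open (T \<inter> T' - K)" using T T' K by (intro open_Diff open_Int)
        ultimately obtain q where q: "q \<in> gp" "\<iota> q \<in> T \<inter> T' - K" using dense_point 2 by metis
        have qA: "\<iota> q \<in> A" using q T(2) \<iota>_in_X by blast
        have qt: "h (\<iota> q) < t" using q T'(2) \<iota>_in_X[OF q(1)] by blast
        from q(1) show ?thesis
        proof (cases rule: gp_cases)
          case (1 v)
          then show ?thesis using qA qt by (intro bexI[of _ v]) (auto simp: \<theta>_def vals_def)
        next
          case (2 e s)
          have s: "s \<in> {0..len e}" "q = ep e s" using 2 by auto
          have "e \<notin> F" using q(2) s unfolding K_def by blast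
          from F(3)[OF 2(1) this s(1)] F(3)[OF 2(1) this, of "len e"]
          have ends: "\<iota> (Vertex (tail G e)) \<in> A" "\<iota> (Vertex (head G e)) \<in> A"
            using qA s(2) len_pos[OF 2(1)] 2(1) by auto
          \<comment> \<open>\<open>h\<close> at \<open>q\<close> is a convex combination of the end
            values, so one of these must be below \<open>t\<close>.\<close>
          have "vals h (tail G e) < t \<or> vals h (head G e) < t"
          proof (rule ccontr)
            assume "\<not> ?thesis"
            then have le: "t \<le> vals h (tail G e)" "t \<le> vals h (head G e)" by auto
            have "t = (1 - s / len e) * t + s / len e * t" by (simp add: algebra_simps)
            also have "\<dots> \<le> (1 - s / len e) * vals h (tail G e) + s / len e * vals h (head G e)"
              using 2 by (intro add_mono mult_left_mono le) auto
            also have "\<dots> = h (\<iota> q)"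
              using h_affine q(1) unfolding edge_affine_def by (simp only: interp_inner 2(4))
            finally show False using qt by simp
          qed
          then show ?thesis
          proof
            assume "vals h (tail G e) < t"
            then show ?thesis using ends 2(1) by (intro bexI[of _ "tail G e"]) (auto simp: \<theta>_def)
          next
            assume "vals h (head G e) < t"
            then show ?thesis using ends 2(1) by (intro bexI[of _ "head G e"]) (auto simp: \<theta>_def)
          qed
        qed
      qed
    qed
    then obtain a where a: "a \<in> verts G" "\<theta> a = 1" by blast
    \<comment> \<open>\<open>\<theta>\<close> is 1 at \<open>a\<close> and 0 at \<open>w\<close>, so
      by connectedness it jumps on some edge, and that edge contributes a strictly positive
      amount.\<close>
    have "\<exists>e\<in>arcs G. incr \<theta> e \<noteq> 0"
    proof (rule ccontr)
      assume no: "\<not> ?thesis"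
      have "\<theta> w = 1"
        by (rule connected_induct[OF graph_connected w_vert a(1)]) (use a no in \<open>auto simp: incr_def\<close>)
      then show False using Aw by (simp add: \<theta>_def)
    qed
    then have "{e \<in> arcs G. incr \<theta> e \<noteq> 0} \<noteq> {}" by blast
    then have "0 < (\<Sum>e\<in>{e \<in> arcs G. incr \<theta> e \<noteq> 0}. - (incr (vals h) e * incr \<theta> e / len e))"
      using fin\<theta> term_pos by (intro sum_pos) auto
    then show ?thesis unfolding flux unfolding flux_def by (simp add: sum_negf)
  qed
qed

lemma nu_nonneg_pos:
  assumes wc: "weakly_connected G len X \<iota>" and E: "clopen_in bd E"
  shows "0 \<le> nu G len X \<iota> w E" "E \<noteq> {} \<Longrightarrow> 0 < nu G len X \<iota> w E"
proof -
  obtain A where A: "separates A E" using separates_exists[OF wc E] .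
  show "0 \<le> nu G len X \<iota> w E" "E \<noteq> {} \<Longrightarrow> 0 < nu G len X \<iota> w E"
    using cut_flux[OF A] nu_cut[OF A] by auto
qed

lemma boundary_clopen_separation:
  assumes wc: "weakly_connected G len X \<iota>" and xy: "x \<in> bd" "y \<in> bd" "x \<noteq> y"
  shows "\<exists>S. clopen_in bd S \<and> x \<in> S \<and> y \<notin> S"
proof -
  have X: "x \<in> X" "y \<in> X" using xy boundary_subset by auto
  obtain A U V where A: "A \<in> cuts" "x \<in> U" "y \<in> V" "U \<inter> X \<subseteq> A" "V \<inter> X \<inter> A = {}"
    using weakly_connected_separation[OF wc X xy(3)] by blast
  then have "x \<in> A" "y \<notin> A" using X by blast+
  then show ?thesis using cut_clopen[OF A(1)] xy by blast
qed

end

theorem theorem4p5: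
  fixes G :: "('v, 'e) pre_digraph" and len :: "'e \<Rightarrow> real"
    and X :: "'x::metric_space set" and \<iota> :: "('v, 'e) gpoint \<Rightarrow> 'x" and w :: 'v
  assumes "metric_graph G len"
    and "is_completion G len X \<iota>"
    and "compact X"
    and "weakly_connected G len X \<iota>"
    and "w \<in> verts G" and "Vertex w \<in> graph_interior G len"
  shows "(\<exists>\<mu>. radon_measure_on (completion_boundary G len X \<iota>) \<mu> \<and>
            (\<forall>S. clopen_in (completion_boundary G len X \<iota>) S \<longrightarrow>
               0 \<le> nu G len X \<iota> w S \<and> emeasure \<mu> S = ennreal (nu G len X \<iota> w S))) \<and>
         (\<forall>S. clopen_in (completion_boundary G len X \<iota>) S \<and> S \<noteq> {} \<longrightarrow> 0 < nu G len X \<iota> w S)"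
proof -
  interpret metric_graph G len by fact
  interpret pointed_completion G len X \<iota> w
    using assms(2,3,5,6)
    by unfold_locales (auto simp: graph_interior_def graph_boundary_def)
  note nn = nu_nonneg_pos[OF assms(4)]
  have "\<exists>\<mu>. radon_measure_on bd \<mu> \<and> (\<forall>S. clopen_in bd S \<longrightarrow> emeasure \<mu> S = ennreal (nu G len X \<iota> w S))"
    by (rule radon_extension[OF compact_boundary boundary_clopen_separation[OF assms(4)] nn(1) nu_additive[OF assms(4)]])
  then show ?thesis using nn by blast
qed

end
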